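(* Let $\boldsymbol\varphi_d=(\varphi_{1,d},\dots,\varphi_{m,d})$, with all components strictly positive, be the principal eigenfunction of $$-d\Delta\varphi_i-\boldsymbol b_i(x)\cdot\nabla\varphi_i+\sum_{j=1}^mM_{ij}(x)\varphi_j=\lambda\varphi_i\ \text{ in }\Omega,\qquad\partial_\nu\varphi_i=0\ \text{ on }\partial\Omega,\qquad1\le i\le m,$$ normalized by $\max_{i,x}\varphi_{i,d}(x)=1$, and set $W_{i,d}=-d\log\varphi_{i,d}$. For every sequence $d_k\searrow0$ there are a subsequence, still denoted $d_k$, and a function $W\in W^{1,\infty}(\Omega)\cap C(\overline\Omega)$ such that $W_{i,d_k}\to W$ uniformly on $\overline\Omega$ for each $i$. The common limit $W$ is a viscosity solution of $$\max_{1\le i\le m}\{|\nabla W|^2-\boldsymbol b_i(x)\cdot\nabla W\}=0\ \text{ in }\Omega,\qquad\partial_\nu W=0\ \text{ on }\partial\Omega,\qquad\min_{x\in\overline\Omega}W(x)=0,$$ where the Neumann condition is understood in the relaxed viscosity sense.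
   Context: Setting: $\Omega\subset\mathbb R^N$ is a bounded $C^2$ domain with outward unit normal $\nu$; $m\ge1$; $\boldsymbol b_i$ ($1\le i\le m$) are $C^1$ vector fields on $\overline\Omega$; $\boldsymbol M=(M_{ij})\in C^1(\overline\Omega;\mathbb R^{m\times m})$ with $M_{ij}<0$ on $\overline\Omega$ for $i\ne j$; $d>0$. The principal eigenvalue $\lambda(d)$ is the real simple eigenvalue with smallest real part; it has an eigenfunction with all components strictly positive (the principal eigenfunction). Viscosity solution with relaxed Neumann condition: put $H(x,p)=\max_{1\le i\le m}\{|p|^2-\boldsymbol b_i(x)\cdot p\}$. $W\in C(\overline\Omega)$ is a subsolution if, whenever $\phi\in C^2(\overline\Omega)$ and $W-\phi$ has a local maximum (relative to $\overline\Omega$) at $x_0$, $H(x_0,\nabla\phi(x_0))\le0$ if $x_0\in\Omega$ and $\min\{H(x_0,\nabla\phi(x_0)),\partial_\nu\phi(x_0)\}\le0$ if $x_0\in\partial\Omega$. It is a supersolution if, whenever $W-\phi$ has a local minimum at $x_0$, $H(x_0,\nabla\phi(x_0))\ge0$ if $x_0\in\Omega$ and $\max\{H(x_0,\nabla\phi(x_0)),\partial_\nu\phi(x_0)\}\ge0$ if $x_0\in\partial\Omega$. A solution is both. *)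

theory Defs
  imports "HOL-Analysis.Analysis"
begin

section \<open>Functions of class $C^k$ on open sets and on closures of domains\<close>

text \<open>
  Derivatives are taken relative to a set \<open>S\<close>.  For open \<open>S\<close> these are the ordinary derivatives;
  for the closure of a \<open>C\<^sup>2\<close> domain, the derivatives at boundary points are the continuous
  extensions of the derivatives in the interior, so that \<open>Ck_on k (closure \<Omega>)\<close> is the usual
  space of functions whose derivatives up to order \<open>k\<close> extend continuously to the closure.
  Values of the functions outside \<open>S\<close> are irrelevant.
\<close>

definition pd :: "(real^'n) set \<Rightarrow> 'n::finite \<Rightarrow> (real^'n \<Rightarrow> 'b::real_normed_vector) \<Rightarrow> real^'n \<Rightarrow> 'b"
  where "pd S k f x = frechet_derivative f (at x within S) (axis k 1)"

primrec Ck_on :: "nat \<Rightarrow> (real^'n::finite) set \<Rightarrow> (real^'n \<Rightarrow> 'b::real_normed_vector) \<Rightarrow> bool"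
  where
    "Ck_on 0 S f \<longleftrightarrow> continuous_on S f"
  | "Ck_on (Suc l) S f \<longleftrightarrow> f differentiable_on S \<and> (\<forall>k. Ck_on l S (pd S k f))"

definition grad :: "(real^'n::finite) set \<Rightarrow> (real^'n \<Rightarrow> real) \<Rightarrow> real^'n \<Rightarrow> real^'n"
  where "grad S f x = (\<chi> k. pd S k f x)"

definition laplacian ::
    "(real^'n::finite) set \<Rightarrow> (real^'n \<Rightarrow> 'b::real_normed_vector) \<Rightarrow> real^'n \<Rightarrow> 'b"
  where "laplacian S f x = (\<Sum>k\<in>UNIV. pd S k (pd S k f) x)"

section \<open>Bounded \<open>C\<^sup>2\<close> domains and the outward normal\<close>

text \<open>
  Near \<open>x\<close> the set \<open>\<Omega>\<close> is the part strictly above a \<open>C\<^sup>2\<close> graph in the direction \<open>e\<close>.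
  The third condition says that \<open>\<gamma>\<close> is a function of the \<open>N - 1\<close> coordinates orthogonal to \<open>e\<close>.
\<close>

definition local_C2_graph ::
    "(real^'n::finite) set \<Rightarrow> real^'n \<Rightarrow> real^'n \<Rightarrow> (real^'n \<Rightarrow> real) \<Rightarrow> real \<Rightarrow> bool"
  where "local_C2_graph \<Omega> x e \<gamma> r \<longleftrightarrow>
    r > 0 \<and> norm e = 1 \<and> (\<forall>y s. \<gamma> (y + s *\<^sub>R e) = \<gamma> y) \<and> Ck_on 2 UNIV \<gamma> \<and>
    \<Omega> \<inter> ball x r = {y \<in> ball x r. y \<bullet> e > \<gamma> y}"

definition bounded_C2_domain :: "(real^'n::finite) set \<Rightarrow> bool"
  where "bounded_C2_domain \<Omega> \<longleftrightarrow>
    open \<Omega> \<and> connected \<Omega> \<and> \<Omega> \<noteq> {} \<and> bounded \<Omega> \<and>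
    (\<forall>x\<in>frontier \<Omega>. \<exists>e \<gamma> r. local_C2_graph \<Omega> x e \<gamma> r)"

text \<open>
  In a chart, \<open>\<Omega>\<close> is locally the set where \<open>\<gamma> y - y \<bullet> e < 0\<close>, so the outward unit normal
  is the normalized gradient of this function.
\<close>

definition outward_unit_normal :: "(real^'n::finite) set \<Rightarrow> (real^'n \<Rightarrow> real^'n) \<Rightarrow> bool"
  where "outward_unit_normal \<Omega> \<nu> \<longleftrightarrow>
    (\<forall>x\<in>frontier \<Omega>. \<exists>e \<gamma> r. local_C2_graph \<Omega> x e \<gamma> r \<and>
        \<nu> x = (grad UNIV \<gamma> x - e) /\<^sub>R norm (grad UNIV \<gamma> x - e))"

definition normal_deriv ::
    "(real^'n::finite) set \<Rightarrow> (real^'n \<Rightarrow> real^'n) \<Rightarrow> (real^'n \<Rightarrow> 'b::real_normed_vector) \<Rightarrow> real^'n \<Rightarrow> 'b"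
  where "normal_deriv \<Omega> \<nu> f x = (\<Sum>k\<in>UNIV. (\<nu> x $ k) *\<^sub>R pd (closure \<Omega>) k f x)"

section \<open>The cooperative Neumann eigenvalue problem\<close>

definition system_op ::
    "(real^'n::finite) set \<Rightarrow> real \<Rightarrow> ('m::finite \<Rightarrow> real^'n \<Rightarrow> real^'n) \<Rightarrow> (real^'n \<Rightarrow> real^'m^'m)
      \<Rightarrow> ('m \<Rightarrow> real^'n \<Rightarrow> 'b::real_normed_vector) \<Rightarrow> 'm \<Rightarrow> real^'n \<Rightarrow> 'b"
  where "system_op \<Omega> d b M u i x =
    - (d *\<^sub>R laplacian \<Omega> (u i) x) - (\<Sum>k\<in>UNIV. (b i x $ k) *\<^sub>R pd \<Omega> k (u i) x)
    + (\<Sum>j\<in>UNIV. (M x $ i $ j) *\<^sub>R u j x)"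

text \<open>
  The classical regularity \<open>C\<^sup>2(\<Omega>) \<inter> C\<^sup>1(closure \<Omega>)\<close> is the one which elliptic regularity gives
  for all eigenfunctions; on a domain which is merely \<open>C\<^sup>2\<close> they need not be \<open>C\<^sup>2\<close> up to the
  boundary.
\<close>

definition neumann_domain ::
    "(real^'n::finite) set \<Rightarrow> (real^'n \<Rightarrow> real^'n) \<Rightarrow> ('m::finite \<Rightarrow> real^'n \<Rightarrow> 'b::real_normed_vector) \<Rightarrow> bool"
  where "neumann_domain \<Omega> \<nu> u \<longleftrightarrow>
    (\<forall>i. Ck_on 2 \<Omega> (u i) \<and> Ck_on 1 (closure \<Omega>) (u i) \<and>
         (\<forall>x\<in>frontier \<Omega>. normal_deriv \<Omega> \<nu> (u i) x = 0))"

text \<open>The scalar field \<open>'b\<close> will be \<open>real\<close> (principal eigenfunction) or \<open>complex\<close> (spectrum).\<close>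

definition eigenfunction ::
    "(real^'n::finite) set \<Rightarrow> (real^'n \<Rightarrow> real^'n) \<Rightarrow> ('m::finite \<Rightarrow> real^'n \<Rightarrow> real^'n)
      \<Rightarrow> (real^'n \<Rightarrow> real^'m^'m) \<Rightarrow> real \<Rightarrow> 'b::real_normed_field \<Rightarrow> ('m \<Rightarrow> real^'n \<Rightarrow> 'b) \<Rightarrow> bool"
  where "eigenfunction \<Omega> \<nu> b M d \<mu> u \<longleftrightarrow>
    neumann_domain \<Omega> \<nu> u \<and> (\<exists>i. \<exists>x\<in>\<Omega>. u i x \<noteq> 0) \<and>
    (\<forall>i. \<forall>x\<in>\<Omega>. system_op \<Omega> d b M u i x = \<mu> * u i x)"

text \<open>
  Simplicity is algebraic: the eigenspace is one-dimensional and there is no generalized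
  eigenfunction of rank two.
\<close>

definition simple_eigenvalue ::
    "(real^'n::finite) set \<Rightarrow> (real^'n \<Rightarrow> real^'n) \<Rightarrow> ('m::finite \<Rightarrow> real^'n \<Rightarrow> real^'n)
      \<Rightarrow> (real^'n \<Rightarrow> real^'m^'m) \<Rightarrow> real \<Rightarrow> complex \<Rightarrow> bool"
  where "simple_eigenvalue \<Omega> \<nu> b M d \<mu> \<longleftrightarrow>
    (\<exists>u. eigenfunction \<Omega> \<nu> b M d \<mu> u \<and>
      (\<forall>v. eigenfunction \<Omega> \<nu> b M d \<mu> v \<longrightarrow> (\<exists>c. \<forall>i. \<forall>x\<in>closure \<Omega>. v i x = c * u i x)) \<and>
      \<not> (\<exists>w. neumann_domain \<Omega> \<nu> w \<and>
            (\<forall>i. \<forall>x\<in>\<Omega>. system_op \<Omega> d b M w i x - \<mu> * w i x = u i x)))"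

definition principal_eigenvalue ::
    "(real^'n::finite) set \<Rightarrow> (real^'n \<Rightarrow> real^'n) \<Rightarrow> ('m::finite \<Rightarrow> real^'n \<Rightarrow> real^'n)
      \<Rightarrow> (real^'n \<Rightarrow> real^'m^'m) \<Rightarrow> real \<Rightarrow> real \<Rightarrow> bool"
  where "principal_eigenvalue \<Omega> \<nu> b M d \<kappa> \<longleftrightarrow>
    simple_eigenvalue \<Omega> \<nu> b M d (complex_of_real \<kappa>) \<and>
    (\<forall>\<mu>::complex. (\<exists>u. eigenfunction \<Omega> \<nu> b M d \<mu> u) \<longrightarrow> \<kappa> \<le> Re \<mu>)"

definition normalized_principal_eigenfunction ::
    "(real^'n::finite) set \<Rightarrow> (real^'n \<Rightarrow> real^'n) \<Rightarrow> ('m::finite \<Rightarrow> real^'n \<Rightarrow> real^'n)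
      \<Rightarrow> (real^'n \<Rightarrow> real^'m^'m) \<Rightarrow> real \<Rightarrow> ('m \<Rightarrow> real^'n \<Rightarrow> real) \<Rightarrow> bool"
  where "normalized_principal_eigenfunction \<Omega> \<nu> b M d \<phi> \<longleftrightarrow>
    (\<exists>\<kappa>. principal_eigenvalue \<Omega> \<nu> b M d \<kappa> \<and> eigenfunction \<Omega> \<nu> b M d \<kappa> \<phi>) \<and>
    (\<forall>i. \<forall>x\<in>closure \<Omega>. 0 < \<phi> i x) \<and>
    (\<forall>i. \<forall>x\<in>closure \<Omega>. \<phi> i x \<le> 1) \<and> (\<exists>i. \<exists>x\<in>closure \<Omega>. \<phi> i x = 1)"

section \<open>The Sobolev space \<open>W\<^sup>1\<^sup>,\<^sup>\<infinity>\<close>\<close>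

definition test_function :: "(real^'n::finite) set \<Rightarrow> (real^'n \<Rightarrow> real) \<Rightarrow> bool"
  where "test_function \<Omega> \<eta> \<longleftrightarrow>
    (\<forall>l. Ck_on l UNIV \<eta>) \<and> (\<exists>K. compact K \<and> K \<subseteq> \<Omega> \<and> (\<forall>x. x \<notin> K \<longrightarrow> \<eta> x = 0))"

definition L_infinity :: "(real^'n::finite) set \<Rightarrow> (real^'n \<Rightarrow> real) \<Rightarrow> bool"
  where "L_infinity \<Omega> f \<longleftrightarrow>
    f \<in> borel_measurable (lebesgue_on \<Omega>) \<and> (\<exists>C. AE x in lebesgue_on \<Omega>. \<bar>f x\<bar> \<le> C)"

definition weak_pd :: "(real^'n::finite) set \<Rightarrow> 'n \<Rightarrow> (real^'n \<Rightarrow> real) \<Rightarrow> (real^'n \<Rightarrow> real) \<Rightarrow> bool"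
  where "weak_pd \<Omega> k f g \<longleftrightarrow>
    (\<forall>\<eta>. test_function \<Omega> \<eta> \<longrightarrow>
      (\<integral>x. f x * pd UNIV k \<eta> x \<partial>lebesgue_on \<Omega>) = - (\<integral>x. g x * \<eta> x \<partial>lebesgue_on \<Omega>))"

definition W1_infinity :: "(real^'n::finite) set \<Rightarrow> (real^'n \<Rightarrow> real) \<Rightarrow> bool"
  where "W1_infinity \<Omega> f \<longleftrightarrow>
    L_infinity \<Omega> f \<and> (\<forall>k. \<exists>g. L_infinity \<Omega> g \<and> weak_pd \<Omega> k f g)"

section \<open>Viscosity solutions with the relaxed Neumann condition\<close>

definition hamiltonian :: "('m::finite \<Rightarrow> real^'n::finite \<Rightarrow> real^'n) \<Rightarrow> real^'n \<Rightarrow> real^'n \<Rightarrow> real"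
  where "hamiltonian b x p = (MAX i. (norm p)\<^sup>2 - b i x \<bullet> p)"

definition local_max_on :: "'a::metric_space set \<Rightarrow> ('a \<Rightarrow> real) \<Rightarrow> 'a \<Rightarrow> bool"
  where "local_max_on S f x \<longleftrightarrow> (\<exists>\<delta>>0. \<forall>y\<in>S. dist y x < \<delta> \<longrightarrow> f y \<le> f x)"

definition local_min_on :: "'a::metric_space set \<Rightarrow> ('a \<Rightarrow> real) \<Rightarrow> 'a \<Rightarrow> bool"
  where "local_min_on S f x \<longleftrightarrow> (\<exists>\<delta>>0. \<forall>y\<in>S. dist y x < \<delta> \<longrightarrow> f x \<le> f y)"

definition viscosity_subsolution ::
    "(real^'n::finite) set \<Rightarrow> (real^'n \<Rightarrow> real^'n) \<Rightarrow> ('m::finite \<Rightarrow> real^'n \<Rightarrow> real^'n)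
      \<Rightarrow> (real^'n \<Rightarrow> real) \<Rightarrow> bool"
  where "viscosity_subsolution \<Omega> \<nu> b W \<longleftrightarrow>
    continuous_on (closure \<Omega>) W \<and>
    (\<forall>\<phi> x. Ck_on 2 (closure \<Omega>) \<phi> \<and> x \<in> closure \<Omega> \<and>
        local_max_on (closure \<Omega>) (\<lambda>y. W y - \<phi> y) x \<longrightarrow>
      (x \<in> \<Omega> \<longrightarrow> hamiltonian b x (grad (closure \<Omega>) \<phi> x) \<le> 0) \<and>
      (x \<in> frontier \<Omega> \<longrightarrow>
        min (hamiltonian b x (grad (closure \<Omega>) \<phi> x)) (normal_deriv \<Omega> \<nu> \<phi> x) \<le> 0))"

definition viscosity_supersolution ::
    "(real^'n::finite) set \<Rightarrow> (real^'n \<Rightarrow> real^'n) \<Rightarrow> ('m::finite \<Rightarrow> real^'n \<Rightarrow> real^'n)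
      \<Rightarrow> (real^'n \<Rightarrow> real) \<Rightarrow> bool"
  where "viscosity_supersolution \<Omega> \<nu> b W \<longleftrightarrow>
    continuous_on (closure \<Omega>) W \<and>
    (\<forall>\<phi> x. Ck_on 2 (closure \<Omega>) \<phi> \<and> x \<in> closure \<Omega> \<and>
        local_min_on (closure \<Omega>) (\<lambda>y. W y - \<phi> y) x \<longrightarrow>
      (x \<in> \<Omega> \<longrightarrow> hamiltonian b x (grad (closure \<Omega>) \<phi> x) \<ge> 0) \<and>
      (x \<in> frontier \<Omega> \<longrightarrow>
        max (hamiltonian b x (grad (closure \<Omega>) \<phi> x)) (normal_deriv \<Omega> \<nu> \<phi> x) \<ge> 0))"

definition viscosity_solution ::
    "(real^'n::finite) set \<Rightarrow> (real^'n \<Rightarrow> real^'n) \<Rightarrow> ('m::finite \<Rightarrow> real^'n \<Rightarrow> real^'n)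
      \<Rightarrow> (real^'n \<Rightarrow> real) \<Rightarrow> bool"
  where "viscosity_solution \<Omega> \<nu> b W \<longleftrightarrow>
    viscosity_subsolution \<Omega> \<nu> b W \<and> viscosity_supersolution \<Omega> \<nu> b W"

end

theory Submission
  imports Defs "HOL-Complex_Analysis.Great_Picard"
begin

text \<open>
  Put \<open>W\<^sub>i = - d ln \<phi>\<^sub>i\<close>.  The eigenvalue problem becomes the viscous Hamilton--Jacobi system
    \<open>d \<Delta>W\<^sub>i = |\<nabla>W\<^sub>i|\<^sup>2 - b\<^sub>i \<bullet> \<nabla>W\<^sub>i + d (\<Sum>j\<noteq>i. - M\<^sub>i\<^sub>j exp ((W\<^sub>i - W\<^sub>j) / d)) - d (M\<^sub>i\<^sub>i - \<kappa>)\<close>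
  with the eigenvalue \<open>\<kappa>\<close> and homogeneous Neumann conditions, in which all coupling terms are nonnegative because the
  off-diagonal entries of \<open>M\<close> are negative (lemma \<open>eigenfunction_hj_system\<close>).  Looking at the extrema of
  \<open>W\<^sub>i \<plusminus> d h\<close>, where \<open>h\<close> is a function with outward normal derivative at least one, bounds \<open>\<kappa>\<close>
  uniformly in \<open>d\<close> (\<open>lam_lower\<close>, \<open>lam_upper\<close>).

  The heart of the matter is the two-point estimate
    \<open>W\<^sub>i(x) - W\<^sub>j(y) \<le> sqrt d + 2 d H + C |x - y|\<close>  for all \<open>i\<close>, \<open>j\<close> and \<open>|x - y| \<le> r\<close>,
  whose constants \<open>H\<close>, \<open>C\<close>, \<open>r\<close> do not depend on \<open>d\<close> (\<open>two_point_estimate\<close>, \<open>uniform_estimate\<close>).  It replaces both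
  the gradient estimate and the Harnack inequality between the components, and it is proved by doubling
  variables.  Suppose that
    \<open>W\<^sub>i(x) - W\<^sub>j(y) - \<psi>(\<rho>(x,y)) - d (h(x) + h(y))\<close>,  \<open>\<rho>(x,y) = |x - y| exp (K (h(x) + h(y)))\<close>,
  has a positive maximum over \<open>i\<close>, \<open>j\<close>, \<open>x\<close>, \<open>y\<close>, where \<open>\<psi>(0) = sqrt d\<close>, \<open>\<psi>\<close> is steep, and \<open>\<psi>\<close> tends to
  infinity at a fixed radius.  The weight in \<open>\<rho>\<close> compensates the curvature of the boundary, so that neither
  \<open>x\<close> nor \<open>y\<close> is a boundary point (\<open>frontier_excluded\<close>).  If \<open>\<rho>(x,y)\<close> is at least a multiple \<open>\<delta>\<close> of \<open>d\<close>, the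
  quadratic gradient term in the equation at \<open>x\<close> contradicts the second-order condition (\<open>no_far_maximum\<close>).
  For smaller \<open>\<rho>(x,y) > 0\<close> the two equations are subtracted; displacing \<open>y\<close> by the mirror image of the displacement
  of \<open>x\<close> makes the strong concavity of \<open>\<psi>\<close> effective, and maximality over \<open>j\<close> makes \<open>W\<^sub>j(y)\<close> the least
  of the \<open>W\<^sub>l(y)\<close>, so that its coupling term is of order \<open>d\<close> (\<open>no_near_maximum\<close>).  If \<open>x = y\<close>, then
  \<open>W\<^sub>i - W\<^sub>j\<close> is at least \<open>sqrt d\<close> there, and the coupling term of order \<open>d exp (1 / sqrt d)\<close> is too large
  (\<open>no_diagonal_maximum\<close>).

  Arzela--Ascoli now yields a subsequence along which all components converge uniformly to one Lipschitz
  function \<open>W\<close> (\<open>asymptotic_lipschitz_limit\<close>); the normalization gives that its minimum is zero.  A Lipschitz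
  function has bounded weak derivatives, namely weak-star cluster points of its difference quotients
  (\<open>lipschitz_W1_infinity\<close>).  Finally, testing with \<open>\<phi> \<plusminus> |\<cdot> - x|\<^sup>2\<close> passes to the limit in the
  equations: for subsolutions the coupling term is nonnegative and is dropped, for supersolutions the index with
  the least value is used, whose coupling term is of order \<open>d\<close> (\<open>limit_subsolution\<close>, \<open>limit_supersolution\<close>).
\<close>

section \<open>Second-order differentiability at a point\<close>

text \<open>
  \<open>F\<close> is differentiable near \<open>0\<close>, with \<open>F'(0) = a\<close> and \<open>F''(0) = c\<close>.  The value \<open>F 0\<close> is not part of the data.
\<close>
definition jet2 :: "(real \<Rightarrow> real) \<Rightarrow> real \<Rightarrow> real \<Rightarrow> bool"
  where "jet2 F a c \<longleftrightarrow> (\<exists>F'. (\<forall>\<^sub>F t in nhds 0. (F has_real_derivative F' t) (at t)) \<and>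
    F' 0 = a \<and> (F' has_real_derivative c) (at 0))"

lemma jet2_isCont: assumes "jet2 F a c" shows "isCont F 0"
proof -
  obtain F' where "\<forall>\<^sub>F t in nhds 0. (F has_real_derivative F' t) (at t)"
    using assms by (auto simp: jet2_def)
  then have "(F has_real_derivative F' 0) (at 0)" by (rule eventually_nhds_x_imp_x)
  then show ?thesis by (rule DERIV_isCont)
qed

lemma jet2_add:
  assumes "jet2 F a c" "jet2 G a' c'"
  shows "jet2 (\<lambda>t. F t + G t) (a + a') (c + c')"
proof -
  obtain F' where F: "\<forall>\<^sub>F t in nhds 0. (F has_real_derivative F' t) (at t)" "F' 0 = a"
      "(F' has_real_derivative c) (at 0)" using assms(1) by (auto simp: jet2_def)
  obtain G' where G: "\<forall>\<^sub>F t in nhds 0. (G has_real_derivative G' t) (at t)" "G' 0 = a'"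
      "(G' has_real_derivative c') (at 0)" using assms(2) by (auto simp: jet2_def)
  have "\<forall>\<^sub>F t in nhds 0. ((\<lambda>t. F t + G t) has_real_derivative F' t + G' t) (at t)"
    using F(1) G(1) by eventually_elim (rule DERIV_add)
  moreover have "((\<lambda>t. F' t + G' t) has_real_derivative c + c') (at 0)"
    using F(3) G(3) by (rule DERIV_add)
  ultimately show ?thesis unfolding jet2_def using F(2) G(2) by auto
qed

lemma jet2_cmult:
  assumes "jet2 F a c"
  shows "jet2 (\<lambda>t. k * F t) (k * a) (k * c)"
proof -
  obtain F' where F: "\<forall>\<^sub>F t in nhds 0. (F has_real_derivative F' t) (at t)" "F' 0 = a"
      "(F' has_real_derivative c) (at 0)" using assms(1) by (auto simp: jet2_def)
  have "\<forall>\<^sub>F t in nhds 0. ((\<lambda>t. k * F t) has_real_derivative k * F' t) (at t)"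
    using F(1) by eventually_elim (rule DERIV_cmult)
  moreover have "((\<lambda>t. k * F' t) has_real_derivative k * c) (at 0)"
    using F(3) by (rule DERIV_cmult)
  ultimately show ?thesis unfolding jet2_def using F(2) by auto
qed

lemma jet2_diff:
  assumes "jet2 F a c" "jet2 G a' c'"
  shows "jet2 (\<lambda>t. F t - G t) (a - a') (c - c')"
  using jet2_add[OF assms(1) jet2_cmult[OF assms(2), of "-1"]] by simp

lemma jet2_compose:
  assumes F: "jet2 F a c"
    and p: "\<forall>\<^sub>F y in nhds (F 0). (p has_real_derivative p1 y) (at y)"
    and p1: "(p1 has_real_derivative p2) (at (F 0))"
  shows "jet2 (\<lambda>t. p (F t)) (p1 (F 0) * a) (p2 * a\<^sup>2 + p1 (F 0) * c)"
proof -
  obtain F' where F: "\<forall>\<^sub>F t in nhds 0. (F has_real_derivative F' t) (at t)" "F' 0 = a"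
      "(F' has_real_derivative c) (at 0)" using assms(1) by (auto simp: jet2_def)
  have "(F \<longlongrightarrow> F 0) (nhds 0)"
    using jet2_isCont[OF assms(1)] tendsto_at_iff_tendsto_nhds isContD by blast
  then have "\<forall>\<^sub>F t in nhds 0. (p has_real_derivative p1 (F t)) (at (F t))"
    by (rule eventually_compose_filterlim[OF p])
  then have 1: "\<forall>\<^sub>F t in nhds 0. ((\<lambda>t. p (F t)) has_real_derivative p1 (F t) * F' t) (at t)"
    using F(1) by eventually_elim (rule DERIV_chain2)
  have "(F has_real_derivative a) (at 0)" using eventually_nhds_x_imp_x[OF F(1)] F(2) by simp
  then have "((\<lambda>t. p1 (F t)) has_real_derivative p2 * a) (at 0)"
    using p1 by (intro DERIV_chain2)
  from DERIV_mult[OF this F(3)]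
  have "((\<lambda>t. p1 (F t) * F' t) has_real_derivative p2 * a\<^sup>2 + p1 (F 0) * c) (at 0)"
    by (simp add: F(2) power2_eq_square algebra_simps)
  with 1 show ?thesis unfolding jet2_def using F(2)
    by (intro exI[of _ "\<lambda>t. p1 (F t) * F' t"]) auto
qed

lemma jet2_local_max:
  assumes F: "jet2 F a c" and mx: "\<forall>\<^sub>F t in nhds 0. F t \<le> F 0"
  shows "a = 0" "c \<le> 0"
proof -
  obtain F' where F: "\<forall>\<^sub>F t in nhds 0. (F has_real_derivative F' t) (at t)" "F' 0 = a"
      "(F' has_real_derivative c) (at 0)" using assms(1) by (auto simp: jet2_def)
  obtain e1 where e1: "e1 > 0" "\<And>t. \<bar>t\<bar> < e1 \<Longrightarrow> (F has_real_derivative F' t) (at t)"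
    using F(1) unfolding eventually_nhds_metric by (auto simp: dist_real_def)
  obtain e2 where e2: "e2 > 0" "\<And>t. \<bar>t\<bar> < e2 \<Longrightarrow> F t \<le> F 0"
    using mx unfolding eventually_nhds_metric by (auto simp: dist_real_def)
  have d0: "(F has_real_derivative a) (at 0)" using eventually_nhds_x_imp_x[OF F(1)] F(2) by simp
  show a: "a = 0" by (rule DERIV_local_max[OF d0 e2(1)]) (use e2(2) in auto)
  show "c \<le> 0"
  proof (rule ccontr)
    assume "\<not> c \<le> 0"
    then obtain e3 where e3: "e3 > 0" "\<And>t. 0 < t \<Longrightarrow> t < e3 \<Longrightarrow> F' t > 0"
      using DERIV_pos_inc_right[OF F(3)] F(2) a by auto
    define t where "t = min e1 (min e2 e3) / 2"
    have t: "t > 0" "t < e1" "t < e2" "t < e3" using e1 e2 e3 by (auto simp: t_def)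
    have "\<exists>z. 0 < z \<and> z < t \<and> F t - F 0 = (t - 0) * F' z"
      by (rule MVT2) (use t e1 in auto)
    then obtain z where "0 < z" "z < t" "F t - F 0 = t * F' z" by auto
    moreover have "F' z > 0" using \<open>0 < z\<close> \<open>z < t\<close> t e3 by auto
    ultimately have "F t > F 0" using t by (simp add: algebra_simps)
    then show False using e2(2)[of t] t by auto
  qed
qed

text \<open>
  \<open>f\<close> has the gradient \<open>g\<close> in a neighbourhood of \<open>x\<close>, and \<open>g\<close> is differentiable at \<open>x\<close> with derivative \<open>H x\<close>.  The Hessian is
  a linear map rather than a matrix.
\<close>
definition twice_diff_at ::
    "(real^'n::finite \<Rightarrow> real) \<Rightarrow> (real^'n \<Rightarrow> real^'n) \<Rightarrow> (real^'n \<Rightarrow> real^'n \<Rightarrow> real^'n) \<Rightarrow> real^'n \<Rightarrow> bool"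
  where "twice_diff_at f g H x \<longleftrightarrow>
    (\<forall>\<^sub>F y in nhds x. (f has_derivative (\<lambda>v. g y \<bullet> v)) (at y)) \<and> (g has_derivative H x) (at x)"

lemma twice_diff_at_jet2:
  assumes "twice_diff_at f g H x"
  shows "jet2 (\<lambda>t. f (x + t *\<^sub>R v)) (g x \<bullet> v) (H x v \<bullet> v)"
proof -
  have l: "((\<lambda>t. x + t *\<^sub>R v) has_derivative (\<lambda>s. s *\<^sub>R v)) (at t)" for t
    by (auto intro!: derivative_eq_intros)
  have "((\<lambda>t. x + t *\<^sub>R v) \<longlongrightarrow> x + 0 *\<^sub>R v) (nhds (0::real))"
    by (intro tendsto_intros filterlim_ident)
  then have "\<forall>\<^sub>F t in nhds 0. (f has_derivative (\<lambda>u. g (x + t *\<^sub>R v) \<bullet> u)) (at (x + t *\<^sub>R v))"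
    using assms eventually_compose_filterlim[of "\<lambda>y. (f has_derivative (\<lambda>u. g y \<bullet> u)) (at y)" "nhds x"]
    by (simp add: twice_diff_at_def)
  then have 1: "\<forall>\<^sub>F t in nhds 0. ((\<lambda>t. f (x + t *\<^sub>R v)) has_real_derivative g (x + t *\<^sub>R v) \<bullet> v) (at t)"
  proof eventually_elim
    case (elim t)
    show ?case using has_derivative_compose[OF l elim]
      by (simp add: has_field_derivative_def mult_commute_abs)
  qed
  have "(g has_derivative H x) (at (x + 0 *\<^sub>R v))" using assms by (simp add: twice_diff_at_def)
  from has_derivative_compose[OF l this]
  have "((\<lambda>t. g (x + t *\<^sub>R v)) has_derivative (\<lambda>s. H x (s *\<^sub>R v))) (at 0)" .
  moreover have "linear (H x)" using assms
    by (auto simp: twice_diff_at_def intro: has_derivative_linear)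
  ultimately have "((\<lambda>t. g (x + t *\<^sub>R v)) has_derivative (\<lambda>s. s *\<^sub>R H x v)) (at 0)"
    by (simp add: linear_cmul)
  then have "((\<lambda>t. g (x + t *\<^sub>R v) \<bullet> v) has_real_derivative H x v \<bullet> v) (at 0)"
    unfolding has_field_derivative_def
    by (auto intro!: derivative_eq_intros)
  with 1 show ?thesis unfolding jet2_def by (intro exI[of _ "\<lambda>t. g (x + t *\<^sub>R v) \<bullet> v"]) auto
qed

text \<open>
  The Hessian as a linear map, with partial derivatives relative to \<open>S\<close>.
\<close>
definition hess :: "(real^'n::finite) set \<Rightarrow> (real^'n \<Rightarrow> real) \<Rightarrow> real^'n \<Rightarrow> real^'n \<Rightarrow> real^'n"
  where "hess S f x v = (\<Sum>l\<in>UNIV. v $ l *\<^sub>R (\<chi> k. pd S l (pd S k f) x))"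

lemma has_derivative_pd:
  fixes f :: "real^'n::finite \<Rightarrow> 'b::real_normed_vector"
  assumes "f differentiable (at x within S)"
  shows "(f has_derivative (\<lambda>v. \<Sum>k\<in>UNIV. v $ k *\<^sub>R pd S k f x)) (at x within S)"
proof -
  have d: "(f has_derivative frechet_derivative f (at x within S)) (at x within S)"
    using assms by (simp add: frechet_derivative_works)
  interpret linear "frechet_derivative f (at x within S)"
    using d by (rule has_derivative_linear)
  have "frechet_derivative f (at x within S) v = (\<Sum>k\<in>UNIV. v $ k *\<^sub>R pd S k f x)" for v
  proof -
    have "v = (\<Sum>k\<in>UNIV. v $ k *\<^sub>R axis k 1)"
      using basis_expansion[of v] by (simp add: scalar_mult_eq_scaleR)
    then have "frechet_derivative f (at x within S) v
        = frechet_derivative f (at x within S) (\<Sum>k\<in>UNIV. v $ k *\<^sub>R axis k 1)" by simp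
    then show ?thesis by (simp only: sum scale pd_def)
  qed
  with d show ?thesis by (metis (no_types, lifting) ext)
qed

lemma has_derivative_grad:
  assumes "f differentiable (at x within S)"
  shows "(f has_derivative (\<lambda>v. grad S f x \<bullet> v)) (at x within S)"
  using has_derivative_pd[OF assms]
  by (simp add: grad_def inner_vec_def mult.commute)

lemma normal_deriv_grad: "normal_deriv \<Omega> \<nu> f x = grad (closure \<Omega>) f x \<bullet> \<nu> x" for f :: "_ \<Rightarrow> real"
  by (simp add: normal_deriv_def grad_def inner_vec_def mult.commute)

lemma Ck2_twice_diff_at:
  fixes f :: "real^'n::finite \<Rightarrow> real"
  assumes f: "Ck_on 2 S f" and x: "x \<in> interior S"
  shows "twice_diff_at f (grad S f) (hess S f) x"
proof -
  have d1: "f differentiable_on S" and d2: "\<And>k. pd S k f differentiable_on S"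
    using f by (auto simp: numeral_2_eq_2)
  have "\<forall>\<^sub>F y in nhds x. y \<in> interior S"
    using x by (intro eventually_nhds_in_open) auto
  then have "\<forall>\<^sub>F y in nhds x. (f has_derivative (\<lambda>v. grad S f y \<bullet> v)) (at y)"
  proof eventually_elim
    case (elim y)
    then have "y \<in> S" using interior_subset by auto
    with d1 have "f differentiable (at y within S)" by (auto simp: differentiable_on_def)
    from has_derivative_grad[OF this] show ?case
      by (simp only: at_within_interior[OF elim])
  qed
  moreover have "(grad S f has_derivative hess S f x) (at x)"
  proof -
    have "((\<lambda>y. \<chi> k. pd S k f y) has_derivative (\<lambda>v. \<chi> k. \<Sum>l\<in>UNIV. v $ l *\<^sub>R pd S l (pd S k f) x)) (at x)"
    proof (subst has_derivative_componentwise_within, rule ballI)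
      fix i :: "real^'n" assume "i \<in> Basis"
      then obtain k where k: "i = axis k 1" by (auto simp: Basis_vec_def)
      have "x \<in> S" using x interior_subset by auto
      with d2 have dk: "pd S k f differentiable (at x within S)" by (auto simp: differentiable_on_def)
      have "(pd S k f has_derivative (\<lambda>v. \<Sum>l\<in>UNIV. v $ l *\<^sub>R pd S l (pd S k f) x)) (at x)"
        using has_derivative_pd[OF dk] by (simp only: at_within_interior[OF x])
      then show "((\<lambda>y. (\<chi> k. pd S k f y) \<bullet> i) has_derivative
          (\<lambda>v. (\<chi> k. \<Sum>l\<in>UNIV. v $ l *\<^sub>R pd S l (pd S k f) x) \<bullet> i)) (at x)"
        by (simp only: k inner_axis vec_lambda_beta inner_real_def mult_1_right)
    qed
    moreover have "(\<lambda>v. \<chi> k. \<Sum>l\<in>UNIV. v $ l *\<^sub>R pd S l (pd S k f) x) = hess S f x"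
      by (auto simp: hess_def fun_eq_iff vec_eq_iff)
    ultimately show ?thesis by (simp add: grad_def[abs_def])
  qed
  ultimately show ?thesis by (simp add: twice_diff_at_def)
qed

text \<open>The trace of a linear map.\<close>
definition tr :: "(real^'n::finite \<Rightarrow> real^'n) \<Rightarrow> real"
  where "tr H = (\<Sum>k\<in>UNIV. H (axis k 1) \<bullet> axis k 1)"

lemma tr_hess: "tr (hess S f x) = laplacian S f x"
proof -
  have "hess S f x (axis k 1) \<bullet> axis k 1 = pd S k (pd S k f) x" for k
    by (simp add: hess_def inner_axis axis_def[of k "1::real"] if_distrib[of "\<lambda>c. c *\<^sub>R _"] if_distrib[of "\<lambda>c. c * _"] cong: if_cong) (simp flip: axis_def add: inner_axis)
  then show ?thesis by (simp add: tr_def laplacian_def)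
qed

section \<open>Functions of class $C^k$ and cut-off functions\<close>

lemma Ck_on_Suc_imp: "Ck_on (Suc l) S f \<Longrightarrow> Ck_on l S f"
proof (induction l arbitrary: f)
  case 0 then show ?case by (auto intro: differentiable_imp_continuous_on)
next
  case (Suc l)
  then have "f differentiable_on S" "\<And>k. Ck_on (Suc l) S (pd S k f)"
    by (auto simp del: Ck_on.simps(2) simp: Ck_on.simps(2)[of _ S f] )
  then show ?case using Suc.IH by simp
qed

lemma pd_UNIV_eq: "(f has_derivative D) (at x) \<Longrightarrow> pd UNIV k f x = D (axis k 1)"
  by (simp add: pd_def frechet_derivative_at[symmetric])

lemma Ck_on_const: "Ck_on l UNIV (\<lambda>x::real^'n::finite. c)"
proof (induction l arbitrary: c)
  case (Suc l)
  have "pd UNIV k (\<lambda>x::real^'n. c) = (\<lambda>x. 0)" for k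
    by (rule ext, rule pd_UNIV_eq[OF has_derivative_const])
  with Suc show ?case by simp
qed simp

lemma Ck_on_inner: "Ck_on l UNIV (\<lambda>y. y \<bullet> e)" for e :: "real^'n::finite"
proof (cases l)
  case (Suc l')
  have d: "((\<lambda>y. y \<bullet> e) has_derivative (\<lambda>v. v \<bullet> e)) (at x)" for x
    by (auto intro!: derivative_eq_intros)
  have "pd UNIV k (\<lambda>y. y \<bullet> e) = (\<lambda>x. axis k 1 \<bullet> e)" for k
    by (rule ext, rule pd_UNIV_eq[OF d])
  moreover have "(\<lambda>y. y \<bullet> e) differentiable_on UNIV"
    using d by (auto simp: differentiable_on_def differentiable_def)
  ultimately show ?thesis by (simp add: Suc Ck_on_const)
qed (simp add: continuous_intros)

lemma Ck_on_add:
  fixes f g :: "real^'n::finite \<Rightarrow> real"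
  shows "Ck_on l UNIV f \<Longrightarrow> Ck_on l UNIV g \<Longrightarrow> Ck_on l UNIV (\<lambda>x. f x + g x)"
proof (induction l arbitrary: f g)
  case 0 then show ?case by (simp add: continuous_intros)
next
  case (Suc l)
  then have d: "f differentiable (at x)" "g differentiable (at x)" for x
    by (auto simp: differentiable_on_def)
  have "pd UNIV k (\<lambda>x. f x + g x) = (\<lambda>x. pd UNIV k f x + pd UNIV k g x)" for k
  proof
    fix x
    from d[of x] have "((\<lambda>x. f x + g x) has_derivative
        (\<lambda>v. frechet_derivative f (at x) v + frechet_derivative g (at x) v)) (at x)"
      by (intro has_derivative_add) (simp_all add: frechet_derivative_works)
    from pd_UNIV_eq[OF this] show "pd UNIV k (\<lambda>x. f x + g x) x = pd UNIV k f x + pd UNIV k g x"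
      by (simp add: pd_def)
  qed
  moreover have "(\<lambda>x. f x + g x) differentiable_on UNIV"
    using d by (auto simp: differentiable_on_def)
  ultimately show ?case using Suc by simp
qed

lemma Ck_on_mult:
  fixes f g :: "real^'n::finite \<Rightarrow> real"
  shows "Ck_on l UNIV f \<Longrightarrow> Ck_on l UNIV g \<Longrightarrow> Ck_on l UNIV (\<lambda>x. f x * g x)"
proof (induction l arbitrary: f g)
  case 0 then show ?case by (simp add: continuous_intros)
next
  case (Suc l)
  then have d: "f differentiable (at x)" "g differentiable (at x)" for x
    by (auto simp: differentiable_on_def)
  have "pd UNIV k (\<lambda>x. f x * g x) = (\<lambda>x. f x * pd UNIV k g x + pd UNIV k f x * g x)" for k
  proof
    fix x
    from d[of x] have "((\<lambda>x. f x * g x) has_derivative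
        (\<lambda>v. f x * frechet_derivative g (at x) v + frechet_derivative f (at x) v * g x)) (at x)"
      by (intro has_derivative_mult) (simp_all add: frechet_derivative_works)
    from pd_UNIV_eq[OF this]
    show "pd UNIV k (\<lambda>x. f x * g x) x = f x * pd UNIV k g x + pd UNIV k f x * g x"
      by (simp add: pd_def)
  qed
  moreover have "(\<lambda>x. f x * g x) differentiable_on UNIV"
    using d by (auto simp: differentiable_on_def)
  moreover have "Ck_on l UNIV f" "Ck_on l UNIV g"
    using Suc.prems by (auto intro: Ck_on_Suc_imp)
  ultimately show ?case using Suc by (auto intro!: Ck_on_add)
qed

lemma Ck_on_sum:
  fixes f :: "'i \<Rightarrow> real^'n::finite \<Rightarrow> real"
  assumes "\<And>i. i \<in> I \<Longrightarrow> Ck_on l UNIV (f i)"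
  shows "Ck_on l UNIV (\<lambda>x. \<Sum>i\<in>I. f i x)"
  using assms
proof (induction I rule: infinite_finite_induct)
  case (insert i I)
  then show ?case by (auto intro!: Ck_on_add)
qed (auto simp: Ck_on_const)

text \<open>
  \<open>max 0 u ^ (n + 1)\<close> is of class \<open>C\<^sup>n\<close> whenever \<open>u\<close> is smooth; this gives elementary cut-off functions of
  finite smoothness.
\<close>
lemma DERIV_max0_power:
  "((\<lambda>u::real. max 0 u ^ Suc (Suc n)) has_real_derivative real (Suc (Suc n)) * max 0 u ^ Suc n) (at u)"
proof -
  consider "u > 0" | "u < 0" | "u = 0" by linarith
  then show ?thesis
  proof cases
    case 1
    have "((\<lambda>u::real. u ^ Suc (Suc n)) has_real_derivative real (Suc (Suc n)) * u ^ Suc n) (at u)"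
      using DERIV_pow[of "Suc (Suc n)" u] by simp
    then show ?thesis
      by (rule DERIV_cong_ev[OF refl _ _, THEN iffD1, rotated 2])
        (use 1 eventually_nhds_in_open[of "{0<..}" u] in \<open>auto elim!: eventually_mono simp: max_def\<close>)
  next
    case 2
    have "((\<lambda>u::real. 0) has_real_derivative 0) (at u)" by simp
    then show ?thesis
      by (rule DERIV_cong_ev[OF refl _ _, THEN iffD1, rotated 2])
        (use 2 eventually_nhds_in_open[of "{..<0}" u] in \<open>auto elim!: eventually_mono simp: max_def\<close>)
  next
    case 3
    have "\<bar>max 0 h ^ Suc n\<bar> \<le> \<bar>h\<bar> ^ Suc n" for h :: real
      by (subst power_abs, rule power_mono) auto
    note le = this
    have "((\<lambda>h::real. \<bar>h\<bar> ^ Suc n) \<longlongrightarrow> \<bar>0\<bar> ^ Suc n) (at 0)" by (intro tendsto_intros)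
    then have lim: "((\<lambda>h::real. \<bar>h\<bar> ^ Suc n) \<longlongrightarrow> 0) (at 0)" by simp
    have "((\<lambda>h::real. max 0 h ^ Suc n) \<longlongrightarrow> 0) (at 0)"
      by (rule Lim_null_comparison[OF always_eventually lim]) (use le in simp)
    then have "((\<lambda>h::real. max 0 h ^ Suc (Suc n) / h) \<longlongrightarrow> 0) (at 0)"
    proof (rule Lim_transform_eventually)
      show "\<forall>\<^sub>F h in at 0. max 0 h ^ Suc n = max 0 h ^ Suc (Suc n) / (h::real)"
        by (rule eventually_mono[OF eventually_at_ball'[of 1 0 UNIV]]) (auto simp: max_def)
    qed
    then show ?thesis using 3 by (simp add: DERIV_def)
  qed
qed

lemma Ck_on_max0_power:
  fixes u :: "real^'n::finite \<Rightarrow> real"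
  assumes u: "\<And>l. Ck_on l UNIV u"
  shows "Ck_on n UNIV (\<lambda>y. max 0 (u y) ^ Suc n)"
proof (induction n)
  case 0
  have "continuous_on UNIV u" using u[of 0] by simp
  then show ?case by (simp add: continuous_intros)
next
  case (Suc n)
  have "u differentiable (at x)" for x using u[of 1] by (auto simp: differentiable_on_def)
  then have u': "(u has_derivative frechet_derivative u (at x)) (at x)" for x
    by (simp add: frechet_derivative_works)
  have d: "((\<lambda>y. max 0 (u y) ^ Suc (Suc n)) has_derivative
      (\<lambda>v. real (Suc (Suc n)) * max 0 (u x) ^ Suc n * frechet_derivative u (at x) v)) (at x)" for x
    using has_derivative_compose[OF u'[of x] DERIV_max0_power[of n "u x", unfolded has_field_derivative_def]]
    by simp
  have "pd UNIV k (\<lambda>y. max 0 (u y) ^ Suc (Suc n)) =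
      (\<lambda>x. (real (Suc (Suc n)) * max 0 (u x) ^ Suc n) * pd UNIV k u x)" for k
  proof (rule ext)
    fix x
    show "pd UNIV k (\<lambda>y. max 0 (u y) ^ Suc (Suc n)) x =
      real (Suc (Suc n)) * max 0 (u x) ^ Suc n * pd UNIV k u x"
      using pd_UNIV_eq[OF d[of x]] by (simp add: pd_def)
  qed
  moreover have "Ck_on n UNIV (\<lambda>x. (real (Suc (Suc n)) * max 0 (u x) ^ Suc n) * pd UNIV k u x)" for k
  proof (intro Ck_on_mult Ck_on_const)
    show "Ck_on n UNIV (\<lambda>x. max 0 (u x) ^ Suc n)" by (fact Suc)
    show "Ck_on n UNIV (pd UNIV k u)" using u[of "Suc n"] by simp
  qed
  moreover have "(\<lambda>y. max 0 (u y) ^ Suc (Suc n)) differentiable_on UNIV"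
    using d by (auto simp: differentiable_on_def differentiable_def)
  ultimately show ?case by (simp only: Ck_on.simps) simp
qed

text \<open>
  For \<open>r > 0\<close>, a \<open>C\<^sup>2\<close> function which is positive exactly on \<open>ball x r\<close>; the exponent \<open>3\<close> is the least one that gives \<open>C\<^sup>2\<close>.
\<close>
definition bump :: "real^'n::finite \<Rightarrow> real \<Rightarrow> real^'n \<Rightarrow> real"
  where "bump x r y = max 0 (r\<^sup>2 - (y - x) \<bullet> (y - x)) ^ 3"

lemma Ck_on_bump: "Ck_on 2 UNIV (bump x r)"
proof -
  have u: "(y - x) \<bullet> (y - x) = (\<Sum>k\<in>UNIV. (y \<bullet> axis k 1) * (y \<bullet> axis k 1)) + ((-2) * (y \<bullet> x) + x \<bullet> x)" for y
    by (simp add: inner_axis) (simp add: inner_vec_def algebra_simps sum.distrib sum_subtractf sum_distrib_left)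
  then have e: "bump x r = (\<lambda>y. max 0 (r\<^sup>2 + (-1) * ((\<Sum>k\<in>UNIV. (y \<bullet> axis k 1) * (y \<bullet> axis k 1)) + ((-2) * (y \<bullet> x) + x \<bullet> x))) ^ Suc 2)"
    by (intro ext) (simp add: bump_def u diff_diff_eq2 diff_add_eq diff_diff_eq add_diff_eq)
  show ?thesis unfolding e
    by (intro Ck_on_max0_power Ck_on_add Ck_on_mult Ck_on_const Ck_on_sum Ck_on_inner)
qed

lemma bump_nonneg: "bump x r y \<ge> 0" by (simp add: bump_def)

lemma bump_pos_iff: assumes "r > 0" shows "bump x r y > 0 \<longleftrightarrow> y \<in> ball x r"
proof -
  have "bump x r y > 0 \<longleftrightarrow> (norm (y - x))\<^sup>2 < r\<^sup>2"
    by (auto simp: bump_def dot_square_norm max_def)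
  also have "\<dots> \<longleftrightarrow> norm (y - x) < r"
    using assms by (metis abs_norm_cancel abs_of_pos power2_less_eq_zero_iff power2_less_imp_less
        power_strict_mono less_imp_le norm_ge_zero zero_less_numeral)
  finally show ?thesis by (simp add: dist_norm norm_minus_commute)
qed

section \<open>The outward normal and a global defining function\<close>

lemma Ck2_C1: assumes "Ck_on 2 UNIV \<gamma>" shows "\<gamma> differentiable (at x)" "continuous_on UNIV \<gamma>"
  using assms by (auto simp: numeral_2_eq_2 differentiable_on_def differentiable_imp_continuous_on)

text \<open>
  In a chart the domain is the set where \<open>\<gamma> y - y \<bullet> e < 0\<close>.  The gradient of this function does not vanish, since \<open>\<gamma>\<close> is constant
  along \<open>e\<close>.
\<close>
lemma graph_grad:
  assumes "local_C2_graph \<Omega> x e \<gamma> r"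
  shows "((\<lambda>y. \<gamma> y - y \<bullet> e) has_derivative (\<lambda>v. (grad UNIV \<gamma> y - e) \<bullet> v)) (at y)"
    and "(grad UNIV \<gamma> y - e) \<bullet> e = -1" and "norm (grad UNIV \<gamma> y - e) \<ge> 1"
proof -
  have g: "Ck_on 2 UNIV \<gamma>" and e: "norm e = 1" and c: "\<And>y s. \<gamma> (y + s *\<^sub>R e) = \<gamma> y"
    using assms by (auto simp: local_C2_graph_def)
  have d: "(\<gamma> has_derivative (\<lambda>v. grad UNIV \<gamma> y \<bullet> v)) (at y)"
    using has_derivative_grad[of \<gamma> y UNIV] Ck2_C1[OF g] by auto
  then show "((\<lambda>y. \<gamma> y - y \<bullet> e) has_derivative (\<lambda>v. (grad UNIV \<gamma> y - e) \<bullet> v)) (at y)"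
    by (auto intro!: derivative_eq_intros simp: inner_diff_left inner_commute[of e])
  have d': "(\<gamma> has_derivative (\<lambda>v. grad UNIV \<gamma> y \<bullet> v)) (at (y + 0 *\<^sub>R e))" using d by simp
  have "((\<lambda>t. y + t *\<^sub>R e) has_derivative (\<lambda>s. s *\<^sub>R e)) (at 0)"
    by (auto intro!: derivative_eq_intros)
  from has_derivative_compose[OF this d']
  have "((\<lambda>t. \<gamma> y) has_derivative (\<lambda>s. grad UNIV \<gamma> y \<bullet> (s *\<^sub>R e))) (at 0)" by (simp add: c)
  then have "(\<lambda>s. grad UNIV \<gamma> y \<bullet> (s *\<^sub>R e)) = (\<lambda>s. 0)"
    by (rule has_derivative_unique[OF _ has_derivative_const])
  from fun_cong[OF this, of 1] have "grad UNIV \<gamma> y \<bullet> e = 0" by simp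
  then show i: "(grad UNIV \<gamma> y - e) \<bullet> e = -1"
    using e by (simp add: inner_diff_left dot_square_norm)
  have "\<bar>(grad UNIV \<gamma> y - e) \<bullet> e\<bar> \<le> norm (grad UNIV \<gamma> y - e) * norm e"
    by (rule Cauchy_Schwarz_ineq2)
  with i e show "norm (grad UNIV \<gamma> y - e) \<ge> 1" by simp
qed

lemma graph_closure:
  assumes "local_C2_graph \<Omega> x e \<gamma> r" "y \<in> closure \<Omega>" "y \<in> ball x r"
  shows "\<gamma> y - y \<bullet> e \<le> 0"
proof -
  have g: "Ck_on 2 UNIV \<gamma>" and O: "\<Omega> \<inter> ball x r = {y \<in> ball x r. y \<bullet> e > \<gamma> y}"
    using assms by (auto simp: local_C2_graph_def)
  have c: "continuous_on UNIV (\<lambda>y. \<gamma> y - y \<bullet> e)"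
    using Ck2_C1[OF g] by (intro continuous_intros) auto
  have "y \<in> closure (\<Omega> \<inter> ball x r)"
    using assms open_Int_closure_subset[of "ball x r" \<Omega>] by (auto simp: Int_commute)
  also have "closure (\<Omega> \<inter> ball x r) \<subseteq> {y. \<gamma> y - y \<bullet> e \<le> 0}"
    using closed_Collect_le[OF c continuous_on_const[of UNIV 0]] O
    by (intro closure_minimal) auto
  finally show ?thesis by simp
qed

lemma graph_frontier:
  assumes "open \<Omega>" "local_C2_graph \<Omega> x e \<gamma> r" "y \<in> frontier \<Omega>" "y \<in> ball x r"
  shows "\<gamma> y - y \<bullet> e = 0"
proof -
  have "\<Omega> \<inter> ball x r = {y \<in> ball x r. y \<bullet> e > \<gamma> y}"
    using assms by (auto simp: local_C2_graph_def)
  moreover have "y \<notin> \<Omega>" "y \<in> closure \<Omega>" using assms by (auto simp: frontier_def interior_open)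
  ultimately show ?thesis using graph_closure[OF assms(2), of y] assms(4) by force
qed

lemma has_derivative_ray:
  fixes f :: "'a::real_inner \<Rightarrow> real"
  assumes "(f has_derivative (\<lambda>v. g \<bullet> v)) (at y)" "g \<bullet> v < 0"
  shows "\<forall>\<^sub>F t in at_right 0. f (y + t *\<^sub>R v) < f y"
proof -
  have d': "(f has_derivative (\<lambda>v. g \<bullet> v)) (at (y + 0 *\<^sub>R v))" using assms by simp
  have "((\<lambda>t. y + t *\<^sub>R v) has_derivative (\<lambda>s. s *\<^sub>R v)) (at 0)"
    by (auto intro!: derivative_eq_intros)
  from has_derivative_compose[OF this d']
  have "((\<lambda>t. f (y + t *\<^sub>R v)) has_real_derivative g \<bullet> v) (at 0)"
    by (simp add: has_field_derivative_def mult_commute_abs)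
  from DERIV_neg_dec_right[OF this assms(2)] obtain \<delta> where "\<delta> > 0"
    "\<And>h. 0 < h \<Longrightarrow> h < \<delta> \<Longrightarrow> f (y + h *\<^sub>R v) < f y" by auto
  then show ?thesis unfolding eventually_at_right_field by auto
qed

lemma graph_enter:
  assumes O: "open \<Omega>" and G: "local_C2_graph \<Omega> x e \<gamma> r" and y: "y \<in> frontier \<Omega>" "y \<in> ball x r"
    and v: "(grad UNIV \<gamma> y - e) \<bullet> v < 0"
  shows "\<forall>\<^sub>F t in at_right 0. y + t *\<^sub>R v \<in> \<Omega>"
proof -
  have "((\<lambda>t. y + t *\<^sub>R v) \<longlongrightarrow> y + 0 *\<^sub>R v) (at_right (0::real))"
    by (intro tendsto_intros)
  moreover have "\<forall>\<^sub>F z in nhds y. z \<in> ball x r" using y by (intro eventually_nhds_in_open) auto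
  ultimately have "\<forall>\<^sub>F t in at_right 0. y + t *\<^sub>R v \<in> ball x r"
    by (auto simp: filterlim_iff)
  moreover have "\<forall>\<^sub>F t in at_right 0. \<gamma> (y + t *\<^sub>R v) - (y + t *\<^sub>R v) \<bullet> e < \<gamma> y - y \<bullet> e"
    by (rule has_derivative_ray[OF graph_grad(1)[OF G] v])
  ultimately show ?thesis
  proof eventually_elim
    case (elim t)
    moreover have "\<Omega> \<inter> ball x r = {y \<in> ball x r. y \<bullet> e > \<gamma> y}"
      using G by (auto simp: local_C2_graph_def)
    ultimately show ?case using graph_frontier[OF O G y] by auto
  qed
qed

text \<open>
  If the open negative half-space of one nonzero vector is contained in the closed negative half-space of another,
  then the two vectors are positive multiples of each other.
\<close>
lemma halfspace_parallel:
  fixes g g' :: "'a::real_inner"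
  assumes H: "\<And>v. g' \<bullet> v < 0 \<Longrightarrow> g \<bullet> v \<le> 0" and "g \<noteq> 0" "g' \<noteq> 0"
  shows "g /\<^sub>R norm g = g' /\<^sub>R norm g'"
proof -
  define c where "c = (g \<bullet> g') / (g' \<bullet> g')"
  define w where "w = g - c *\<^sub>R g'"
  have p: "g' \<bullet> g' > 0" using assms by simp
  then have w: "w \<bullet> g' = 0" by (simp add: w_def c_def inner_diff_left)
  have "w \<bullet> w \<le> \<epsilon> * (g \<bullet> g')" if "\<epsilon> > 0" for \<epsilon>
  proof -
    have "g' \<bullet> (w - \<epsilon> *\<^sub>R g') < 0" using w p that by (simp add: inner_diff_right inner_commute)
    then have "g \<bullet> (w - \<epsilon> *\<^sub>R g') \<le> 0" by (rule H)
    moreover have "g \<bullet> w = w \<bullet> w" using w by (simp add: w_def inner_diff_left inner_diff_right inner_commute)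
    ultimately show ?thesis by (simp add: inner_diff_right)
  qed
  note ww = this
  have "w \<bullet> w \<le> 0"
  proof (rule field_le_epsilon)
    fix e :: real assume "e > 0"
    have "w \<bullet> w \<le> e / (1 + \<bar>g \<bullet> g'\<bar>) * (g \<bullet> g')" using \<open>e > 0\<close> by (intro ww) auto
    also have "\<dots> \<le> e / (1 + \<bar>g \<bullet> g'\<bar>) * (1 + \<bar>g \<bullet> g'\<bar>)" using \<open>e > 0\<close> by (intro mult_left_mono) auto
    also have "\<dots> = e" by (simp add: add_nonneg_eq_0_iff)
    finally show "w \<bullet> w \<le> 0 + e" by simp
  qed
  then have "w = 0" by (metis inner_ge_zero inner_eq_zero_iff order_antisym)
  then have g: "g = c *\<^sub>R g'" by (simp add: w_def)
  have "g \<bullet> (- g') \<le> 0" using p by (intro H) simp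
  then have "c > 0" using g p \<open>g \<noteq> 0\<close> by (cases "c = 0") (auto simp: zero_le_mult_iff)
  with g show ?thesis by simp
qed

text \<open>
  The outward normal does not depend on the chart: directions that enter the domain in one chart do not leave it in another.
\<close>
lemma graph_normal:
  assumes O: "open \<Omega>" and G: "local_C2_graph \<Omega> x e \<gamma> r" and y: "y \<in> frontier \<Omega>" "y \<in> ball x r"
    and nu: "outward_unit_normal \<Omega> \<nu>"
  shows "grad UNIV \<gamma> y - e = norm (grad UNIV \<gamma> y - e) *\<^sub>R \<nu> y"
proof -
  obtain e' \<gamma>' r' where G': "local_C2_graph \<Omega> y e' \<gamma>' r'"
    and n: "\<nu> y = (grad UNIV \<gamma>' y - e') /\<^sub>R norm (grad UNIV \<gamma>' y - e')"
    using nu y by (auto simp: outward_unit_normal_def)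
  have y': "y \<in> ball y r'" using G' by (simp add: local_C2_graph_def)
  have nz: "grad UNIV \<gamma> y - e \<noteq> 0" "grad UNIV \<gamma>' y - e' \<noteq> 0"
    using graph_grad(3)[OF G, of y] graph_grad(3)[OF G', of y] by auto
  have "(grad UNIV \<gamma> y - e) \<bullet> v \<le> 0" if "(grad UNIV \<gamma>' y - e') \<bullet> v < 0" for v
  proof (rule ccontr)
    assume "\<not> ?thesis"
    then have "(-(grad UNIV \<gamma> y - e)) \<bullet> v < 0" by (simp only: inner_minus_left)
    moreover have "((\<lambda>y. - (\<gamma> y - y \<bullet> e)) has_derivative (\<lambda>v. (-(grad UNIV \<gamma> y - e)) \<bullet> v)) (at y)"
      using has_derivative_minus[OF graph_grad(1)[OF G]] by (simp only: inner_minus_left)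
    ultimately have 1: "\<forall>\<^sub>F t in at_right 0. -(\<gamma> (y + t *\<^sub>R v) - (y + t *\<^sub>R v) \<bullet> e) < - (\<gamma> y - y \<bullet> e)"
      by (intro has_derivative_ray)
    have 2: "\<forall>\<^sub>F t in at_right 0. y + t *\<^sub>R v \<in> \<Omega>" by (rule graph_enter[OF O G' y(1) y' that])
    have "((\<lambda>t. y + t *\<^sub>R v) \<longlongrightarrow> y + 0 *\<^sub>R v) (at_right (0::real))"
      by (intro tendsto_intros)
    moreover have "\<forall>\<^sub>F z in nhds y. z \<in> ball x r" using y by (intro eventually_nhds_in_open) auto
    ultimately have 3: "\<forall>\<^sub>F t in at_right 0. y + t *\<^sub>R v \<in> ball x r"
      by (auto simp: filterlim_iff)
    from 1 2 3 have "\<forall>\<^sub>F t in at_right (0::real). False"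
    proof eventually_elim
      case (elim t)
      have "\<Omega> \<inter> ball x r = {y \<in> ball x r. y \<bullet> e > \<gamma> y}"
        using G by (auto simp: local_C2_graph_def)
      then have "y + t *\<^sub>R v \<in> {y \<in> ball x r. y \<bullet> e > \<gamma> y}" using elim by blast
      with elim show ?case using graph_frontier[OF O G y] by auto
    qed
    then show False by simp
  qed
  from halfspace_parallel[OF this nz] n nz(1) show ?thesis
    by (metis divideR_right norm_eq_zero)
qed

text \<open>The outward normal has length one, and its negative points into the domain.\<close>
lemma outward_normal_unit_exterior:
  assumes O: "open \<Omega>" and nu: "outward_unit_normal \<Omega> \<nu>" and x: "x \<in> frontier \<Omega>"
  shows "norm (\<nu> x) = 1" and "\<forall>\<^sub>F t in at_right 0. x - t *\<^sub>R \<nu> x \<in> \<Omega>"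
proof -
  obtain e \<gamma> r where G: "local_C2_graph \<Omega> x e \<gamma> r"
    and n: "\<nu> x = (grad UNIV \<gamma> x - e) /\<^sub>R norm (grad UNIV \<gamma> x - e)"
    using nu x by (auto simp: outward_unit_normal_def)
  have x': "x \<in> ball x r" using G by (simp add: local_C2_graph_def)
  have "norm (grad UNIV \<gamma> x - e) \<ge> 1" using graph_grad(3)[OF G] by simp
  then have "norm (grad UNIV \<gamma> x - e) \<noteq> 0" by linarith
  then show n1: "norm (\<nu> x) = 1" by (simp add: n)
  let ?g = "grad UNIV \<gamma> x - e"
  have ge: "?g = norm ?g *\<^sub>R \<nu> x" by (rule graph_normal[OF O G x x' nu])
  have "?g \<bullet> (- \<nu> x) = - norm ?g"
    by (subst ge) (simp add: dot_square_norm n1)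
  then have "?g \<bullet> (- \<nu> x) < 0" using \<open>norm ?g \<ge> 1\<close> by linarith
  from graph_enter[OF O G x x' this] show "\<forall>\<^sub>F t in at_right 0. x - t *\<^sub>R \<nu> x \<in> \<Omega>" by simp
qed

text \<open>
  The chart functions \<open>\<gamma> y - y \<bullet> e\<close> all vanish on the boundary and are nonpositive on the closure.  These properties survive the
  weighting with cut-off functions; on the boundary, where the chart functions vanish, the gradients of the weights do not
  contribute, and the gradient of the sum is a positive multiple of the normal.
\<close>
lemma defining_function:
  fixes \<Omega> :: "(real^'n::finite) set"
  assumes D: "bounded_C2_domain \<Omega>" and nu: "outward_unit_normal \<Omega> \<nu>"
  obtains h where "Ck_on 2 UNIV h" "\<And>x. x \<in> frontier \<Omega> \<Longrightarrow> h x = 0" "\<And>x. x \<in> closure \<Omega> \<Longrightarrow> h x \<le> 0"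
    "\<And>x. x \<in> frontier \<Omega> \<Longrightarrow> \<exists>\<sigma>\<ge>1. grad UNIV h x = \<sigma> *\<^sub>R \<nu> x"
proof -
  have O: "open \<Omega>" and "bounded \<Omega>" using D by (auto simp: bounded_C2_domain_def)
  then have cF: "compact (frontier \<Omega>)" by (simp add: compact_frontier_bounded)
  have "\<forall>x\<in>frontier \<Omega>. \<exists>e \<gamma> r. local_C2_graph \<Omega> x e \<gamma> r" using D by (auto simp: bounded_C2_domain_def)
  then obtain e \<gamma> r where G: "\<And>x. x \<in> frontier \<Omega> \<Longrightarrow> local_C2_graph \<Omega> x (e x) (\<gamma> x) (r x)"
    by metis
  have rpos: "\<And>x. x \<in> frontier \<Omega> \<Longrightarrow> r x > 0" using G by (auto simp: local_C2_graph_def)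
  obtain P where P: "P \<subseteq> frontier \<Omega>" "finite P" "frontier \<Omega> \<subseteq> (\<Union>x\<in>P. ball x (r x))"
    using compactE_image[OF cF, of "frontier \<Omega>" "\<lambda>x. ball x (r x)"] rpos by force
  define \<psi> where "\<psi> p y = \<gamma> p y - y \<bullet> e p" for p y
  define h0 where "h0 y = (\<Sum>p\<in>P. bump p (r p) y * \<psi> p y)" for y
  have C\<psi>: "Ck_on 2 UNIV (\<psi> p)" if "p \<in> P" for p
  proof -
    have "Ck_on 2 UNIV (\<lambda>y. \<gamma> p y + (-1) * (y \<bullet> e p))"
      using G[of p] that P by (intro Ck_on_add Ck_on_mult Ck_on_const Ck_on_inner) (auto simp: local_C2_graph_def)
    then show ?thesis by (simp add: \<psi>_def[abs_def])
  qed
  then have Ch: "Ck_on 2 UNIV h0" unfolding h0_def[abs_def]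
    by (intro Ck_on_sum Ck_on_mult Ck_on_bump)
  have zero: "bump p (r p) y = 0 \<or> (y \<in> ball p (r p))" if "p \<in> P" for p y
    using bump_pos_iff[OF rpos, of p p y] bump_nonneg[of p "r p" y] that P by force
  have h0: "h0 y = 0" if "y \<in> frontier \<Omega>" for y unfolding h0_def
  proof (intro sum.neutral ballI)
    fix p assume p: "p \<in> P"
    from zero[OF p, of y] show "bump p (r p) y * \<psi> p y = 0"
    proof
      assume "y \<in> ball p (r p)"
      then have "\<psi> p y = 0" using graph_frontier[OF O G that] p P unfolding \<psi>_def by blast
      then show ?thesis by simp
    qed simp
  qed
  have h1: "h0 y \<le> 0" if "y \<in> closure \<Omega>" for y unfolding h0_def
  proof (rule sum_nonpos)
    fix p assume p: "p \<in> P"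
    from zero[OF p, of y] show "bump p (r p) y * \<psi> p y \<le> 0"
    proof
      assume "y \<in> ball p (r p)"
      then have "\<psi> p y \<le> 0" using graph_closure[OF G that] p P unfolding \<psi>_def by blast
      then show ?thesis using bump_nonneg by (intro mult_nonneg_nonpos)
    qed simp
  qed
  define s where "s y = (\<Sum>p\<in>P. bump p (r p) y)" for y
  have Cs: "continuous_on (frontier \<Omega>) s"
    unfolding s_def[abs_def] by (intro continuous_on_sum continuous_on_subset[OF Ck2_C1(2)[OF Ck_on_bump]]) auto
  have sp: "s y > 0" if yF: "y \<in> frontier \<Omega>" for y
  proof -
    obtain p where "p \<in> P" "y \<in> ball p (r p)" using P(3) yF by blast
    then show ?thesis unfolding s_def using bump_pos_iff[OF rpos, of p p y] P
      by (intro sum_pos2[of _ p]) (auto simp: bump_nonneg)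
  qed
  \<comment> \<open>Dividing by this lower bound for the sum of the weights makes the normal derivative at least one.\<close>
  obtain c where c: "c > 0" "\<And>y. y \<in> frontier \<Omega> \<Longrightarrow> s y \<ge> c"
  proof (cases "frontier \<Omega> = {}")
    case True then show ?thesis using that[of 1] by auto
  next
    case False
    from continuous_attains_inf[OF cF this Cs] obtain y where "y \<in> frontier \<Omega>" "\<forall>z\<in>frontier \<Omega>. s y \<le> s z" by auto
    then show ?thesis using that[of "s y"] sp by auto
  qed
  have grad0: "\<exists>\<sigma>\<ge>c. grad UNIV h0 y = \<sigma> *\<^sub>R \<nu> y" if y: "y \<in> frontier \<Omega>" for y
  proof -
    let ?N = "\<lambda>p. norm (grad UNIV (\<gamma> p) y - e p)"
    define \<sigma> where "\<sigma> = (\<Sum>p\<in>P. bump p (r p) y * ?N p)"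
    have dp: "((\<lambda>y. bump p (r p) y * \<psi> p y) has_derivative
        (\<lambda>v. bump p (r p) y * ?N p * (\<nu> y \<bullet> v))) (at y)" if p: "p \<in> P" for p
    proof -
      have pf: "p \<in> frontier \<Omega>" using p P by auto
      have db: "(bump p (r p) has_derivative (\<lambda>v. grad UNIV (bump p (r p)) y \<bullet> v)) (at y)"
        using has_derivative_grad[of "bump p (r p)" y UNIV] Ck2_C1(1)[OF Ck_on_bump] by auto
      have dpsi: "(\<psi> p has_derivative (\<lambda>v. (grad UNIV (\<gamma> p) y - e p) \<bullet> v)) (at y)"
        unfolding \<psi>_def[abs_def] by (rule graph_grad(1)[OF G[OF pf]])
      have "((\<lambda>y. bump p (r p) y * \<psi> p y) has_derivative
        (\<lambda>v. bump p (r p) y * ((grad UNIV (\<gamma> p) y - e p) \<bullet> v) + (grad UNIV (bump p (r p)) y \<bullet> v) * \<psi> p y)) (at y)"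
        by (rule has_derivative_mult[OF db dpsi])
      moreover consider "bump p (r p) y = 0" "y \<notin> ball p (r p)" | "y \<in> ball p (r p)" using zero[OF p] by blast
      then have "(\<lambda>v. bump p (r p) y * ((grad UNIV (\<gamma> p) y - e p) \<bullet> v) + (grad UNIV (bump p (r p)) y \<bullet> v) * \<psi> p y)
         = (\<lambda>v. bump p (r p) y * ?N p * (\<nu> y \<bullet> v))"
      proof cases
        case 1
        \<comment> \<open>Outside its ball the weight is minimal, hence its gradient vanishes.\<close>
        have "bump p (r p) y \<le> bump p (r p) z" for z using 1 by (simp add: bump_nonneg)
        then have "(\<lambda>v. grad UNIV (bump p (r p)) y \<bullet> v) = (\<lambda>v. 0)"
          using differential_zero_maxmin[of y UNIV "bump p (r p)"] db by auto
        from fun_cong[OF this] show ?thesis using 1 by simp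
      next
        case 2
        have "\<psi> p y = 0" unfolding \<psi>_def by (rule graph_frontier[OF O G[OF pf] y 2])
        moreover have "(grad UNIV (\<gamma> p) y - e p) \<bullet> v = ?N p * (\<nu> y \<bullet> v)" for v
          by (metis graph_normal[OF O G[OF pf] y 2 nu] inner_scaleR_left)
        ultimately show ?thesis by (simp add: mult.assoc)
      qed
      ultimately show ?thesis by simp
    qed
    have "(h0 has_derivative (\<lambda>v. \<Sum>p\<in>P. bump p (r p) y * ?N p * (\<nu> y \<bullet> v))) (at y)"
      unfolding h0_def[abs_def] by (rule has_derivative_sum[OF dp])
    then have "(h0 has_derivative (\<lambda>v. (\<sigma> *\<^sub>R \<nu> y) \<bullet> v)) (at y)"
      by (simp add: \<sigma>_def sum_distrib_right)
    moreover have "(h0 has_derivative (\<lambda>v. grad UNIV h0 y \<bullet> v)) (at y)"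
      using has_derivative_grad[of h0 y UNIV] Ck2_C1(1)[OF Ch] by auto
    ultimately have "(\<lambda>v. (\<sigma> *\<^sub>R \<nu> y) \<bullet> v) = (\<lambda>v. grad UNIV h0 y \<bullet> v)"
      by (rule has_derivative_unique)
    then have "grad UNIV h0 y = \<sigma> *\<^sub>R \<nu> y"
      by (metis vector_eq_rdot)
    moreover have "s y \<le> \<sigma>" unfolding s_def \<sigma>_def
    proof (rule sum_mono)
      fix p assume "p \<in> P"
      then have "?N p \<ge> 1" using graph_grad(3)[OF G, of p y] P by auto
      then show "bump p (r p) y \<le> bump p (r p) y * ?N p"
        using mult_left_mono[OF _ bump_nonneg[of p "r p" y], of 1 "?N p"] by simp
    qed
    ultimately show ?thesis using c(2)[OF y] by (intro exI[of _ \<sigma>]) auto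
  qed
  show thesis
  proof (rule that[of "\<lambda>y. (1/c) * h0 y"])
    show "Ck_on 2 UNIV (\<lambda>y. (1/c) * h0 y)" by (intro Ck_on_mult Ck_on_const Ch)
    show "\<And>x. x \<in> frontier \<Omega> \<Longrightarrow> (1/c) * h0 x = 0" using h0 by simp
    show "\<And>x. x \<in> closure \<Omega> \<Longrightarrow> (1/c) * h0 x \<le> 0" using h1 c by (simp add: divide_nonpos_pos)
    fix x assume x: "x \<in> frontier \<Omega>"
    obtain \<sigma> where s: "\<sigma> \<ge> c" "grad UNIV h0 x = \<sigma> *\<^sub>R \<nu> x" using grad0[OF x] by auto
    have "(h0 has_derivative (\<lambda>v. grad UNIV h0 x \<bullet> v)) (at x)"
      using has_derivative_grad[of h0 x UNIV] Ck2_C1(1)[OF Ch] by auto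
    then have "((\<lambda>y. (1/c) * h0 y) has_derivative (\<lambda>v. (1/c) * (grad UNIV h0 x \<bullet> v))) (at x)"
      by (rule has_derivative_mult_right)
    then have "pd UNIV k (\<lambda>y. (1/c) * h0 y) x = (\<sigma>/c) * \<nu> x $ k" for k
      using pd_UNIV_eq s by (fastforce simp: inner_axis)
    then have "grad UNIV (\<lambda>y. (1/c) * h0 y) x = (\<sigma>/c) *\<^sub>R \<nu> x"
      by (simp add: grad_def vec_eq_iff)
    then show "\<exists>\<sigma>\<ge>1. grad UNIV (\<lambda>y. (1/c) * h0 y) x = \<sigma> *\<^sub>R \<nu> x"
      using s c by (intro exI[of _ "\<sigma>/c"]) auto
  qed
qed

section \<open>The weighted distance and maxima of functions of two points\<close>

lemma jet2_cong:
  assumes "\<forall>\<^sub>F t in nhds 0. F t = G t" "jet2 F a c"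
  shows "jet2 G a c"
proof -
  obtain F' where F: "\<forall>\<^sub>F t in nhds 0. (F has_real_derivative F' t) (at t)" "F' 0 = a"
      "(F' has_real_derivative c) (at 0)" using assms(2) by (auto simp: jet2_def)
  have "\<forall>\<^sub>F t in nhds 0. \<forall>\<^sub>F s in nhds t. F s = G s"
    using assms(1) by (simp add: eventually_eventually)
  then have "\<forall>\<^sub>F t in nhds 0. (G has_real_derivative F' t) (at t)"
    using F(1)
  proof eventually_elim
    case (elim t)
    then show ?case using DERIV_cong_ev[OF refl elim(1) refl] by blast
  qed
  with F show ?thesis unfolding jet2_def by blast
qed

lemma jet2_exp:
  assumes "jet2 F a c" shows "jet2 (\<lambda>t. exp (F t)) (exp (F 0) * a) (exp (F 0) * a\<^sup>2 + exp (F 0) * c)"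
  by (rule jet2_compose[OF assms, of exp exp]) (auto intro: DERIV_exp)

lemma jet2_ln_norm:
  fixes w u :: "'a::real_inner"
  assumes "w \<noteq> 0"
  shows "jet2 (\<lambda>t. ln (norm (w + t *\<^sub>R u))) (w \<bullet> u / (norm w)\<^sup>2)
    (u \<bullet> u / (norm w)\<^sup>2 - 2 * (w \<bullet> u)\<^sup>2 / (norm w)^4)"
proof -
  have p: "norm w > 0" using assms by simp
  have q: "jet2 (\<lambda>t. (w + t *\<^sub>R u) \<bullet> (w + t *\<^sub>R u)) (2 * (w \<bullet> u)) (2 * (u \<bullet> u))"
  proof -
    have e: "(w + t *\<^sub>R u) \<bullet> (w + t *\<^sub>R u) = w \<bullet> w + t * (2 * (w \<bullet> u)) + t * t * (u \<bullet> u)" for t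
      by (simp add: inner_add_left inner_add_right inner_commute algebra_simps)
    have 1: "((\<lambda>t. w \<bullet> w + t * (2 * (w \<bullet> u)) + t * t * (u \<bullet> u)) has_real_derivative
        2 * (w \<bullet> u) + 2 * t * (u \<bullet> u)) (at t)" for t
      by (auto intro!: derivative_eq_intros)
    have 2: "((\<lambda>t. 2 * (w \<bullet> u) + 2 * t * (u \<bullet> u)) has_real_derivative 2 * (u \<bullet> u)) (at 0)"
      by (auto intro!: derivative_eq_intros)
    show ?thesis unfolding e jet2_def using 1 2
      by (intro exI[of _ "\<lambda>t. 2 * (w \<bullet> u) + 2 * t * (u \<bullet> u)"]) simp
  qed
  have ww: "w \<bullet> w = (norm w)\<^sup>2" by (simp add: dot_square_norm)
  have "jet2 (\<lambda>t. ln ((w + t *\<^sub>R u) \<bullet> (w + t *\<^sub>R u)))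
      (1 / (norm w)\<^sup>2 * (2 * (w \<bullet> u))) (- 1 / (norm w)^4 * (2 * (w \<bullet> u))\<^sup>2 + 1 / (norm w)\<^sup>2 * (2 * (u \<bullet> u)))"
  proof -
    have "\<forall>\<^sub>F y in nhds ((norm w)\<^sup>2). y \<in> {0<..}" using p by (intro eventually_nhds_in_open) auto
    then have a: "\<forall>\<^sub>F y in nhds ((norm w)\<^sup>2). (ln has_real_derivative 1 / y) (at y)"
      by eventually_elim (auto intro: DERIV_ln_divide)
    have "((\<lambda>y. 1 / y) has_real_derivative - 1 / (norm w)^4) (at ((norm w)\<^sup>2))"
      using p by (auto intro!: derivative_eq_intros simp: power2_eq_square power4_eq_xxxx divide_inverse)
    with a show ?thesis using jet2_compose[OF q, of ln "\<lambda>y. 1 / y" "- 1 / (norm w)^4"] by (simp add: ww)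
  qed
  from jet2_cmult[OF this, of "1/2"]
  have "jet2 (\<lambda>t. 1/2 * ln ((w + t *\<^sub>R u) \<bullet> (w + t *\<^sub>R u))) (w \<bullet> u / (norm w)\<^sup>2)
    (u \<bullet> u / (norm w)\<^sup>2 - 2 * (w \<bullet> u)\<^sup>2 / (norm w)^4)"
    by (simp add: field_simps diff_divide_distrib)
  moreover have "1/2 * ln (v \<bullet> v) = ln (norm v)" for v :: 'a
    by (cases "v = 0") (simp_all add: dot_square_norm ln_realpow)
  ultimately show ?thesis by simp
qed

text \<open>
  The distance with the weight \<open>exp (K (h x + h y))\<close>.  When \<open>h\<close> increases towards the boundary, a large \<open>K\<close> makes \<open>rho\<close> increase in
  the outward direction at boundary points, even where the domain is not convex.
\<close>
definition rho :: "real \<Rightarrow> (real^'n::finite \<Rightarrow> real) \<Rightarrow> real^'n \<Rightarrow> real^'n \<Rightarrow> real"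
  where "rho K h x y = norm (x - y) * exp (K * (h x + h y))"

text \<open>
  The logarithm of \<open>rho\<close> is a sum, with first and second derivatives \<open>\<tau>\<close> and \<open>\<zeta>\<close> along the displacement \<open>(a, c)\<close>.
\<close>
lemma jet2_rho:
  fixes h :: "real^'n::finite \<Rightarrow> real" and K :: real
  assumes h: "twice_diff_at h gh Hh x" "twice_diff_at h gh Hh y" and "x \<noteq> y"
  defines "r \<equiv> norm (x - y)"
  defines "\<tau> a c \<equiv> (x - y) \<bullet> (a - c) / r\<^sup>2 + K * (gh x \<bullet> a + gh y \<bullet> c)"
  defines "\<zeta> a c \<equiv> (a - c) \<bullet> (a - c) / r\<^sup>2 - 2 * ((x - y) \<bullet> (a - c))\<^sup>2 / r^4 + K * (Hh x a \<bullet> a + Hh y c \<bullet> c)"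
  shows "jet2 (\<lambda>t. rho K h (x + t *\<^sub>R a) (y + t *\<^sub>R c)) (rho K h x y * \<tau> a c)
    (rho K h x y * ((\<tau> a c)\<^sup>2 + \<zeta> a c))"
proof -
  have "x - y \<noteq> 0" using \<open>x \<noteq> y\<close> by simp
  have "jet2 (\<lambda>t. ln (norm ((x - y) + t *\<^sub>R (a - c))) + K * (h (x + t *\<^sub>R a) + h (y + t *\<^sub>R c))) (\<tau> a c) (\<zeta> a c)"
    unfolding \<tau>_def \<zeta>_def r_def
    by (intro jet2_add jet2_cmult jet2_ln_norm twice_diff_at_jet2 h) fact
  from jet2_exp[OF this]
  have "jet2 (\<lambda>t. exp (ln (norm ((x - y) + t *\<^sub>R (a - c))) + K * (h (x + t *\<^sub>R a) + h (y + t *\<^sub>R c))))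
     (rho K h x y * \<tau> a c) (rho K h x y * ((\<tau> a c)\<^sup>2 + \<zeta> a c))"
    using \<open>x \<noteq> y\<close> by (simp add: exp_add rho_def algebra_simps)
  moreover have "\<forall>\<^sub>F t in nhds 0. exp (ln (norm ((x - y) + t *\<^sub>R (a - c))) + K * (h (x + t *\<^sub>R a) + h (y + t *\<^sub>R c)))
     = rho K h (x + t *\<^sub>R a) (y + t *\<^sub>R c)"
  proof -
    have "((\<lambda>t. (x - y) + t *\<^sub>R (a - c)) \<longlongrightarrow> (x - y) + 0 *\<^sub>R (a - c)) (nhds (0::real))"
      by (intro tendsto_intros filterlim_ident)
    then have "\<forall>\<^sub>F t in nhds (0::real). (x - y) + t *\<^sub>R (a - c) \<noteq> 0"
      using \<open>x - y \<noteq> 0\<close> by (intro tendsto_imp_eventually_ne) auto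
    then show ?thesis
    proof eventually_elim
      case (elim t)
      have eq: "(x - y) + t *\<^sub>R (a - c) = (x + t *\<^sub>R a) - (y + t *\<^sub>R c)" by (simp add: algebra_simps)
      then have "norm ((x + t *\<^sub>R a) - (y + t *\<^sub>R c)) > 0" using elim by (simp only: zero_less_norm_iff not_False_eq_True)
      then show ?case by (simp only: eq exp_add rho_def exp_ln)
    qed
  qed
  ultimately show ?thesis by (rule jet2_cong[rotated])
qed

text \<open>
  The first- and second-order conditions at a maximum, along an arbitrary displacement \<open>(a, c)\<close> of the two points.
\<close>
lemma two_point_max:
  fixes f g h :: "real^'n::finite \<Rightarrow> real" and K \<epsilon> :: real
  assumes f: "twice_diff_at f gf Hf x" and g: "twice_diff_at g gg Hg y"
    and h: "twice_diff_at h gh Hh x" "twice_diff_at h gh Hh y" and xy: "x \<noteq> y"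
    and p: "\<forall>\<^sub>F s in nhds (rho K h x y). (p has_real_derivative p1 s) (at s)"
    and p1: "(p1 has_real_derivative p2) (at (rho K h x y))"
    and e: "e > 0" and mx: "\<And>x' y'. x' \<in> ball x e \<Longrightarrow> y' \<in> ball y e \<Longrightarrow>
      f x' - g y' - (p (rho K h x' y') + \<epsilon> * (h x' + h y'))
      \<le> f x - g y - (p (rho K h x y) + \<epsilon> * (h x + h y))"
  defines "r \<equiv> norm (x - y)" and "\<rho> \<equiv> rho K h x y"
  defines "\<tau> a c \<equiv> (x - y) \<bullet> (a - c) / r\<^sup>2 + K * (gh x \<bullet> a + gh y \<bullet> c)"
  defines "\<zeta> a c \<equiv> (a - c) \<bullet> (a - c) / r\<^sup>2 - 2 * ((x - y) \<bullet> (a - c))\<^sup>2 / r^4 + K * (Hh x a \<bullet> a + Hh y c \<bullet> c)"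
  shows "gf x \<bullet> a - gg y \<bullet> c = p1 \<rho> * \<rho> * \<tau> a c + \<epsilon> * (gh x \<bullet> a + gh y \<bullet> c)" (is ?A)
    and "Hf x a \<bullet> a - Hg y c \<bullet> c \<le> p2 * \<rho>\<^sup>2 * (\<tau> a c)\<^sup>2 + p1 \<rho> * \<rho> * ((\<tau> a c)\<^sup>2 + \<zeta> a c)
      + \<epsilon> * (Hh x a \<bullet> a + Hh y c \<bullet> c)" (is ?B)
proof -
  have r0: "jet2 (\<lambda>t. rho K h (x + t *\<^sub>R a) (y + t *\<^sub>R c)) (\<rho> * \<tau> a c) (\<rho> * ((\<tau> a c)\<^sup>2 + \<zeta> a c))"
    unfolding \<rho>_def \<tau>_def \<zeta>_def r_def by (rule jet2_rho[OF h xy])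
  have "jet2 (\<lambda>t. p (rho K h (x + t *\<^sub>R a) (y + t *\<^sub>R c)))
      (p1 (rho K h (x + 0 *\<^sub>R a) (y + 0 *\<^sub>R c)) * (\<rho> * \<tau> a c))
      (p2 * (\<rho> * \<tau> a c)\<^sup>2 + p1 (rho K h (x + 0 *\<^sub>R a) (y + 0 *\<^sub>R c)) * (\<rho> * ((\<tau> a c)\<^sup>2 + \<zeta> a c)))"
    by (rule jet2_compose[OF r0]) (use p p1 in simp_all)
  then have j: "jet2 (\<lambda>t. p (rho K h (x + t *\<^sub>R a) (y + t *\<^sub>R c)))
      (p1 \<rho> * (\<rho> * \<tau> a c)) (p2 * (\<rho> * \<tau> a c)\<^sup>2 + p1 \<rho> * (\<rho> * ((\<tau> a c)\<^sup>2 + \<zeta> a c)))"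
    by (simp add: \<rho>_def)
  define Z where "Z t = (f (x + t *\<^sub>R a) - g (y + t *\<^sub>R c)) - (p (rho K h (x + t *\<^sub>R a) (y + t *\<^sub>R c))
     + \<epsilon> * (h (x + t *\<^sub>R a) + h (y + t *\<^sub>R c)))" for t
  have Z: "jet2 Z ((gf x \<bullet> a - gg y \<bullet> c) - (p1 \<rho> * (\<rho> * \<tau> a c) + \<epsilon> * (gh x \<bullet> a + gh y \<bullet> c)))
     ((Hf x a \<bullet> a - Hg y c \<bullet> c) - (p2 * (\<rho> * \<tau> a c)\<^sup>2 + p1 \<rho> * (\<rho> * ((\<tau> a c)\<^sup>2 + \<zeta> a c))
       + \<epsilon> * (Hh x a \<bullet> a + Hh y c \<bullet> c)))"
    unfolding Z_def[abs_def] by (intro jet2_diff jet2_add jet2_cmult j twice_diff_at_jet2 f g h)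
  have "((\<lambda>t. x + t *\<^sub>R a) \<longlongrightarrow> x + 0 *\<^sub>R a) (nhds (0::real))"
       "((\<lambda>t. y + t *\<^sub>R c) \<longlongrightarrow> y + 0 *\<^sub>R c) (nhds (0::real))"
    by (intro tendsto_intros filterlim_ident)+
  then have "\<forall>\<^sub>F t in nhds 0. x + t *\<^sub>R a \<in> ball x e" "\<forall>\<^sub>F t in nhds 0. y + t *\<^sub>R c \<in> ball y e"
    using e by (auto elim!: topological_tendstoD simp del: mem_ball)
  then have mz: "\<forall>\<^sub>F t in nhds 0. Z t \<le> Z 0"
    by eventually_elim (use mx in \<open>auto simp: Z_def\<close>)
  from jet2_local_max[OF Z mz] show ?A ?B
    by (simp_all add: power_mult_distrib algebra_simps)
qed

lemma inner_expand: "(x::real^'n::finite) \<bullet> y = (\<Sum>k\<in>UNIV. x \<bullet> axis k 1 * (y \<bullet> axis k 1))"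
  by (simp add: inner_axis) (simp add: inner_vec_def)

text \<open>
  The reflection in the hyperplane orthogonal to \<open>w\<close>; it is the identity for \<open>w = 0\<close>.  The trace is invariant under it.
\<close>
definition refl_along :: "'a::real_inner \<Rightarrow> 'a \<Rightarrow> 'a"
  where "refl_along w a = a - (2 * (w \<bullet> a) / (norm w)\<^sup>2) *\<^sub>R w"

lemma refl_along_inner: "refl_along w a \<bullet> v = a \<bullet> refl_along w v"
  by (simp add: refl_along_def inner_diff_left inner_diff_right inner_commute)

lemma refl_along_idem: "refl_along w (refl_along w a) = a"
proof (cases "w = 0")
  case False
  then have "norm w \<noteq> 0" by simp
  then show ?thesis
    by (simp add: refl_along_def inner_diff_right dot_square_norm field_simps flip: scaleR_left.add)
qed (simp add: refl_along_def)

lemma norm_refl_along: "norm (refl_along w a) = norm a"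
  by (metis norm_eq refl_along_inner refl_along_idem)

lemma tr_refl_along:
  assumes "linear H"
  shows "(\<Sum>k\<in>UNIV. H (refl_along w (axis k 1)) \<bullet> refl_along w (axis k 1)) = tr H"
proof -
  interpret linear H by fact
  let ?R = "refl_along w"
  have ex: "v = (\<Sum>l\<in>UNIV. (v \<bullet> axis l 1) *\<^sub>R axis l 1)" for v :: "real^'n"
    using basis_expansion[of v] by (simp add: scalar_mult_eq_scaleR inner_axis)
  have "H (?R (axis k 1)) \<bullet> ?R (axis k 1)
     = (\<Sum>l\<in>UNIV. (?R (axis k 1) \<bullet> axis l 1) * (H (axis l 1) \<bullet> ?R (axis k 1)))" for k
    by (subst (1) ex) (simp add: sum scale inner_sum_left)
  also have "\<dots> k = (\<Sum>l\<in>UNIV. (?R (axis l 1) \<bullet> axis k 1) * (?R (H (axis l 1)) \<bullet> axis k 1))" for k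
    by (intro sum.cong refl) (metis inner_commute refl_along_inner)
  finally have "(\<Sum>k\<in>UNIV. H (?R (axis k 1)) \<bullet> ?R (axis k 1))
     = (\<Sum>k\<in>UNIV. \<Sum>l\<in>UNIV. (?R (axis l 1) \<bullet> axis k 1) * (?R (H (axis l 1)) \<bullet> axis k 1))" by simp
  also have "\<dots> = (\<Sum>l\<in>UNIV. ?R (axis l 1) \<bullet> ?R (H (axis l 1)))"
    by (subst sum.swap) (simp add: inner_expand[symmetric])
  also have "\<dots> = tr H" by (simp add: refl_along_inner refl_along_idem tr_def inner_commute)
  finally show ?thesis .
qed

lemma sum_inner_axis_sq: "(\<Sum>k\<in>UNIV. (v \<bullet> axis k 1)\<^sup>2) = (norm (v::real^'n::finite))\<^sup>2"
  using inner_expand[of v v] by (simp add: power2_eq_square dot_square_norm[unfolded power2_eq_square])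

text \<open>
  The second-order conditions are summed over an orthonormal basis in two ways: over displacements of \<open>x\<close> alone, and over
  displacements \<open>(a, refl_along (x - y) a)\<close>.  The latter change \<open>x - y\<close> only along its own
  direction, so that the second derivative of the distance vanishes, and only terms with the derivatives of the profile \<open>p\<close> and of \<open>h\<close> remain.
\<close>
lemma two_point_trace:
  fixes f g h :: "real^'n::finite \<Rightarrow> real" and K \<epsilon> :: real
  assumes f: "twice_diff_at f gf Hf x" and g: "twice_diff_at g gg Hg y"
    and h: "twice_diff_at h gh Hh x" "twice_diff_at h gh Hh y" and xy: "x \<noteq> y"
    and p: "\<forall>\<^sub>F s in nhds (rho K h x y). (p has_real_derivative p1 s) (at s)"
    and p1: "(p1 has_real_derivative p2) (at (rho K h x y))"
    and e: "e > 0" and mx: "\<And>x' y'. x' \<in> ball x e \<Longrightarrow> y' \<in> ball y e \<Longrightarrow>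
      f x' - g y' - (p (rho K h x' y') + \<epsilon> * (h x' + h y'))
      \<le> f x - g y - (p (rho K h x y) + \<epsilon> * (h x + h y))"
  defines "r \<equiv> norm (x - y)" and "\<rho> \<equiv> rho K h x y"
  defines "S \<equiv> p1 \<rho> * \<rho>"
  defines "\<sigma> \<equiv> (x - y) /\<^sub>R r\<^sup>2 + K *\<^sub>R gh x"
  defines "\<tau> \<equiv> (2 / r\<^sup>2) *\<^sub>R (x - y) + K *\<^sub>R (gh x + refl_along (x - y) (gh y))"
  shows "gf x = S *\<^sub>R \<sigma> + \<epsilon> *\<^sub>R gh x"
    and "gg y = S *\<^sub>R ((x - y) /\<^sub>R r\<^sup>2 - K *\<^sub>R gh y) - \<epsilon> *\<^sub>R gh y"
    and "tr (Hf x) \<le> p2 * \<rho>\<^sup>2 * (norm \<sigma>)\<^sup>2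
      + S * ((norm \<sigma>)\<^sup>2 + (real CARD('n) - 2) / r\<^sup>2 + K * tr (Hh x)) + \<epsilon> * tr (Hh x)"
    and "tr (Hf x) - tr (Hg y) \<le> p2 * \<rho>\<^sup>2 * (norm \<tau>)\<^sup>2
      + S * ((norm \<tau>)\<^sup>2 - 4 / r\<^sup>2 + K * (tr (Hh x) + tr (Hh y))) + \<epsilon> * (tr (Hh x) + tr (Hh y))"
proof -
  let ?\<tau> = "\<lambda>a c. (x - y) \<bullet> (a - c) / r\<^sup>2 + K * (gh x \<bullet> a + gh y \<bullet> c)"
  let ?\<zeta> = "\<lambda>a c. (a - c) \<bullet> (a - c) / r\<^sup>2 - 2 * ((x - y) \<bullet> (a - c))\<^sup>2 / r^4 + K * (Hh x a \<bullet> a + Hh y c \<bullet> c)"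
  note tp = two_point_max[OF f g h xy p p1 e mx, folded r_def \<rho>_def, folded S_def]
  have A: "gf x \<bullet> a - gg y \<bullet> c = S * ?\<tau> a c + \<epsilon> * (gh x \<bullet> a + gh y \<bullet> c)" for a c
    by (rule tp(1))
  have B: "Hf x a \<bullet> a - Hg y c \<bullet> c \<le> p2 * \<rho>\<^sup>2 * (?\<tau> a c)\<^sup>2 + S * ((?\<tau> a c)\<^sup>2 + ?\<zeta> a c)
      + \<epsilon> * (Hh x a \<bullet> a + Hh y c \<bullet> c)" for a c
    by (rule tp(2))
  have r: "r > 0" using xy by (simp add: r_def)
  have w2: "(x - y) \<bullet> (x - y) = r\<^sup>2" by (simp add: r_def dot_square_norm)
  have lin: "linear (Hh x)" "linear (Hh y)" "linear (Hg y)" "linear (Hf x)"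
    using h f g by (auto simp: twice_diff_at_def intro: has_derivative_linear)
  then have H0: "Hh y 0 = 0" "Hg y 0 = 0" by (auto simp: linear_0)
  have "gf x \<bullet> a = (S *\<^sub>R \<sigma> + \<epsilon> *\<^sub>R gh x) \<bullet> a" for a
    using A[of a 0] by (simp add: \<sigma>_def inner_add_left divide_inverse mult.commute)
  then show "gf x = S *\<^sub>R \<sigma> + \<epsilon> *\<^sub>R gh x" by (metis vector_eq_rdot)
  have "gg y \<bullet> c = (S *\<^sub>R ((x - y) /\<^sub>R r\<^sup>2 - K *\<^sub>R gh y) - \<epsilon> *\<^sub>R gh y) \<bullet> c" for c
  proof -
    have "- (gg y \<bullet> c) = S * (- ((x - y) \<bullet> c) / r\<^sup>2 + K * (gh y \<bullet> c)) + \<epsilon> * (gh y \<bullet> c)"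
      using A[of 0 c] by simp
    then have "gg y \<bullet> c = - (S * (- ((x - y) \<bullet> c) / r\<^sup>2 + K * (gh y \<bullet> c)) + \<epsilon> * (gh y \<bullet> c))" by linarith
    then show ?thesis by (simp add: inner_diff_left divide_inverse algebra_simps)
  qed
  then show "gg y = S *\<^sub>R ((x - y) /\<^sub>R r\<^sup>2 - K *\<^sub>R gh y) - \<epsilon> *\<^sub>R gh y" by (metis vector_eq_rdot)
  have sig: "?\<tau> a 0 = \<sigma> \<bullet> a" for a by (simp add: \<sigma>_def inner_add_left divide_inverse mult.commute)
  have zet: "?\<zeta> (axis k 1) 0 = 1 / r\<^sup>2 - 2 * (((x - y) \<bullet> axis k 1)\<^sup>2 / r^4) + K * (Hh x (axis k 1) \<bullet> axis k 1)" for k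
    by (simp add: H0 dot_square_norm)
  have "tr (Hf x) \<le> (\<Sum>k\<in>UNIV. p2 * \<rho>\<^sup>2 * (\<sigma> \<bullet> axis k 1)\<^sup>2 + S * ((\<sigma> \<bullet> axis k 1)\<^sup>2 +
      (1 / r\<^sup>2 - 2 * (((x - y) \<bullet> axis k 1)\<^sup>2 / r^4) + K * (Hh x (axis k 1) \<bullet> axis k 1)))
      + \<epsilon> * (Hh x (axis k 1) \<bullet> axis k 1))"
    unfolding tr_def
  proof (rule sum_mono)
    fix k
    show "Hf x (axis k 1) \<bullet> axis k 1 \<le> p2 * \<rho>\<^sup>2 * (\<sigma> \<bullet> axis k 1)\<^sup>2 + S * ((\<sigma> \<bullet> axis k 1)\<^sup>2 +
      (1 / r\<^sup>2 - 2 * (((x - y) \<bullet> axis k 1)\<^sup>2 / r^4) + K * (Hh x (axis k 1) \<bullet> axis k 1)))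
      + \<epsilon> * (Hh x (axis k 1) \<bullet> axis k 1)"
      using B[of "axis k 1" 0] unfolding sig zet by (simp add: H0)
  qed
  also have "\<dots> = p2 * \<rho>\<^sup>2 * (norm \<sigma>)\<^sup>2
      + S * ((norm \<sigma>)\<^sup>2 + (real CARD('n) / r\<^sup>2 - 2 * (r\<^sup>2 / r^4) + K * tr (Hh x))) + \<epsilon> * tr (Hh x)"
    by (simp add: sum.distrib sum_subtractf sum_distrib_left[symmetric] sum_divide_distrib[symmetric]
        sum_inner_axis_sq tr_def r_def[symmetric])
  also have "real CARD('n) / r\<^sup>2 - 2 * (r\<^sup>2 / r^4) = (real CARD('n) - 2) / r\<^sup>2"
    using r by (simp add: field_simps power2_eq_square power4_eq_xxxx)
  finally show "tr (Hf x) \<le> p2 * \<rho>\<^sup>2 * (norm \<sigma>)\<^sup>2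
      + S * ((norm \<sigma>)\<^sup>2 + (real CARD('n) - 2) / r\<^sup>2 + K * tr (Hh x)) + \<epsilon> * tr (Hh x)"
    by (simp add: add.assoc)
  let ?R = "refl_along (x - y)"
  have aR: "a - ?R a = (2 * ((x - y) \<bullet> a) / r\<^sup>2) *\<^sub>R (x - y)" for a
    by (simp add: refl_along_def r_def)
  have waR: "(x - y) \<bullet> (a - ?R a) = 2 * ((x - y) \<bullet> a)" for a
    using r by (simp add: aR w2)
  have tau: "?\<tau> a (?R a) = \<tau> \<bullet> a" for a
    unfolding waR \<tau>_def by (simp add: inner_add_left refl_along_inner)
  have zeta: "?\<zeta> a (?R a) = - 4 * (((x - y) \<bullet> a)\<^sup>2 / r^4) + K * (Hh x a \<bullet> a + Hh y (?R a) \<bullet> ?R a)" for a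
  proof -
    have "(a - ?R a) \<bullet> (a - ?R a) = 4 * ((x - y) \<bullet> a)\<^sup>2 / r\<^sup>2"
      unfolding aR using r by (simp add: w2 power2_eq_square)
    then show ?thesis unfolding waR using r by (simp add: power2_eq_square power4_eq_xxxx)
  qed
  have "tr (Hf x) - tr (Hg y) = (\<Sum>k\<in>UNIV. Hf x (axis k 1) \<bullet> axis k 1 - Hg y (?R (axis k 1)) \<bullet> ?R (axis k 1))"
    using tr_refl_along[OF lin(3), of "x - y"] by (simp add: sum_subtractf tr_def)
  also have "\<dots> \<le> (\<Sum>k\<in>UNIV. p2 * \<rho>\<^sup>2 * (\<tau> \<bullet> axis k 1)\<^sup>2 + S * ((\<tau> \<bullet> axis k 1)\<^sup>2 +
      (- 4 * (((x - y) \<bullet> axis k 1)\<^sup>2 / r^4) + K * (Hh x (axis k 1) \<bullet> axis k 1 + Hh y (?R (axis k 1)) \<bullet> ?R (axis k 1))))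
      + \<epsilon> * (Hh x (axis k 1) \<bullet> axis k 1 + Hh y (?R (axis k 1)) \<bullet> ?R (axis k 1)))"
  proof (rule sum_mono)
    fix k
    show "Hf x (axis k 1) \<bullet> axis k 1 - Hg y (?R (axis k 1)) \<bullet> ?R (axis k 1) \<le> p2 * \<rho>\<^sup>2 * (\<tau> \<bullet> axis k 1)\<^sup>2
      + S * ((\<tau> \<bullet> axis k 1)\<^sup>2 +
      (- 4 * (((x - y) \<bullet> axis k 1)\<^sup>2 / r^4) + K * (Hh x (axis k 1) \<bullet> axis k 1 + Hh y (?R (axis k 1)) \<bullet> ?R (axis k 1))))
      + \<epsilon> * (Hh x (axis k 1) \<bullet> axis k 1 + Hh y (?R (axis k 1)) \<bullet> ?R (axis k 1))"
      using B[of "axis k 1" "?R (axis k 1)"] by (simp only: tau zeta)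
  qed
  also have "\<dots> = p2 * \<rho>\<^sup>2 * (norm \<tau>)\<^sup>2
      + S * ((norm \<tau>)\<^sup>2 + (- 4 * (r\<^sup>2 / r^4) + K * (tr (Hh x) + tr (Hh y)))) + \<epsilon> * (tr (Hh x) + tr (Hh y))"
    using tr_refl_along[OF lin(2), of "x - y"]
    by (simp add: sum.distrib sum_subtractf sum_negf sum_distrib_left[symmetric] sum_divide_distrib[symmetric]
        sum_inner_axis_sq tr_def r_def[symmetric])
  also have "- 4 * (r\<^sup>2 / r^4) = - 4 / r\<^sup>2"
    using r by (simp add: field_simps power2_eq_square power4_eq_xxxx)
  finally show "tr (Hf x) - tr (Hg y) \<le> p2 * \<rho>\<^sup>2 * (norm \<tau>)\<^sup>2
      + S * ((norm \<tau>)\<^sup>2 - 4 / r\<^sup>2 + K * (tr (Hh x) + tr (Hh y))) + \<epsilon> * (tr (Hh x) + tr (Hh y))"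
    by (simp add: algebra_simps)
qed

section \<open>Viscous Hamilton--Jacobi systems with Neumann conditions\<close>

lemma finite_family_attains_sup:
  fixes f :: "'i \<Rightarrow> 'a::topological_space \<Rightarrow> real"
  assumes "finite I" "I \<noteq> {}" "compact S" "S \<noteq> {}" "\<And>i. i \<in> I \<Longrightarrow> continuous_on S (f i)"
  shows "\<exists>i\<in>I. \<exists>x\<in>S. \<forall>j\<in>I. \<forall>y\<in>S. f j y \<le> f i x"
proof -
  have "\<forall>i\<in>I. \<exists>x\<in>S. \<forall>y\<in>S. f i y \<le> f i x"
    using continuous_attains_sup[OF assms(3,4) assms(5)] by blast
  then obtain X where X: "\<And>i. i \<in> I \<Longrightarrow> X i \<in> S \<and> (\<forall>y\<in>S. f i y \<le> f i (X i))" by metis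
  have "Max ((\<lambda>j. f j (X j)) ` I) \<in> (\<lambda>j. f j (X j)) ` I" using assms(1,2) by (intro Max_in) auto
  then obtain i where i: "i \<in> I" "Max ((\<lambda>j. f j (X j)) ` I) = f i (X i)" by auto
  have "f j y \<le> f i (X i)" if "j \<in> I" "y \<in> S" for j y
  proof -
    have "f j y \<le> f j (X j)" using X that by blast
    also have "\<dots> \<le> f i (X i)" unfolding i(2)[symmetric] using assms(1) that by (intro Max_ge) auto
    finally show ?thesis .
  qed
  then show ?thesis using X i by blast
qed

lemma one_point_max:
  assumes f: "twice_diff_at f gf Hf x" and g: "twice_diff_at g gg Hg x"
    and e: "e > 0" and mx: "\<And>y. y \<in> ball x e \<Longrightarrow> f y - g y \<le> f x - g x"
  shows "gf x = gg x" "tr (Hf x) \<le> tr (Hg x)"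
proof -
  have j: "jet2 (\<lambda>t. f (x + t *\<^sub>R v) - g (x + t *\<^sub>R v)) (gf x \<bullet> v - gg x \<bullet> v) (Hf x v \<bullet> v - Hg x v \<bullet> v)" for v
    by (intro jet2_diff twice_diff_at_jet2 f g)
  have mz: "\<forall>\<^sub>F t in nhds 0. f (x + t *\<^sub>R v) - g (x + t *\<^sub>R v) \<le> f (x + 0 *\<^sub>R v) - g (x + 0 *\<^sub>R v)" for v
  proof -
    have "((\<lambda>t. x + t *\<^sub>R v) \<longlongrightarrow> x + 0 *\<^sub>R v) (nhds (0::real))"
      by (intro tendsto_intros filterlim_ident)
    then have "\<forall>\<^sub>F t in nhds 0. x + t *\<^sub>R v \<in> ball x e"
      using e by (auto elim!: topological_tendstoD simp del: mem_ball)
    then show ?thesis by eventually_elim (use mx in simp)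
  qed
  have "gf x \<bullet> v - gg x \<bullet> v = 0" for v by (rule jet2_local_max(1)[OF j mz])
  then show "gf x = gg x" by (metis eq_iff_diff_eq_0 vector_eq_rdot)
  have "Hf x v \<bullet> v - Hg x v \<bullet> v \<le> 0" for v by (rule jet2_local_max(2)[OF j mz])
  then show "tr (Hf x) \<le> tr (Hg x)" unfolding tr_def by (intro sum_mono) (simp add: le_diff_eq)
qed

lemma twice_diff_at_add:
  assumes "twice_diff_at f gf Hf x" "twice_diff_at g gg Hg x"
  shows "twice_diff_at (\<lambda>y. f y + g y) (\<lambda>y. gf y + gg y) (\<lambda>y v. Hf y v + Hg y v) x"
proof -
  have "\<forall>\<^sub>F y in nhds x. (f has_derivative (\<lambda>v. gf y \<bullet> v)) (at y)"
    "\<forall>\<^sub>F y in nhds x. (g has_derivative (\<lambda>v. gg y \<bullet> v)) (at y)" using assms by (auto simp: twice_diff_at_def)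
  then have "\<forall>\<^sub>F y in nhds x. ((\<lambda>y. f y + g y) has_derivative (\<lambda>v. (gf y + gg y) \<bullet> v)) (at y)"
    by eventually_elim (auto simp: inner_add_left intro: has_derivative_add)
  then show ?thesis using assms by (auto simp: twice_diff_at_def intro: has_derivative_add)
qed

lemma twice_diff_at_cmult:
  assumes "twice_diff_at f gf Hf x"
  shows "twice_diff_at (\<lambda>y. k * f y) (\<lambda>y. k *\<^sub>R gf y) (\<lambda>y v. k *\<^sub>R Hf y v) x"
proof -
  have "\<forall>\<^sub>F y in nhds x. (f has_derivative (\<lambda>v. gf y \<bullet> v)) (at y)" using assms by (auto simp: twice_diff_at_def)
  then have "\<forall>\<^sub>F y in nhds x. ((\<lambda>y. k * f y) has_derivative (\<lambda>v. (k *\<^sub>R gf y) \<bullet> v)) (at y)"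
    by eventually_elim (auto intro: has_derivative_mult_right)
  then show ?thesis using assms by (auto simp: twice_diff_at_def intro: has_derivative_scaleR_right)
qed

lemma tr_add: "tr (\<lambda>v. H v + H' v) = tr H + tr H'"
  by (simp add: tr_def inner_add_left sum.distrib)

lemma tr_scaleR: "tr (\<lambda>v. k *\<^sub>R H v) = k * tr H"
  by (simp add: tr_def sum_distrib_left)

lemma twice_diff_at_DERIV:
  assumes "twice_diff_at f gf Hf x" shows "(f has_derivative (\<lambda>v. gf x \<bullet> v)) (at x)"
  using assms by (auto simp: twice_diff_at_def dest: eventually_nhds_x_imp_x)

text \<open>
  A bounded domain with a function \<open>h\<close> on its closure that takes values in \<open>[0, Hm]\<close> and whose outward normal derivative is at
  least one.  The constant \<open>G\<close> bounds the first and second derivatives of \<open>h\<close>, and \<open>Q\<close> measures the failure of convexity: for \<open>Q > 0\<close>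
  there is an exterior ball of radius \<open>1 / (2 Q)\<close> at every boundary point.  Of the normal \<open>\<nu>\<close> only these relations are used, together with
  the fact that \<open>- \<nu>\<close> points into the domain.
\<close>
locale neumann_geometry =
  fixes \<Omega> :: "(real^'n::finite) set" and \<nu> :: "real^'n \<Rightarrow> real^'n"
    and h :: "real^'n \<Rightarrow> real" and gh Hh and Hm G Q :: real
  assumes open_dom: "open \<Omega>" and bounded_dom: "bounded \<Omega>" and dom_ne: "\<Omega> \<noteq> {}"
    and enter: "\<And>x. x \<in> frontier \<Omega> \<Longrightarrow> \<forall>\<^sub>F t in at_right 0. x - t *\<^sub>R \<nu> x \<in> \<Omega>"
    and h2: "\<And>x. twice_diff_at h gh Hh x"
    and h_nonneg: "\<And>x. x \<in> closure \<Omega> \<Longrightarrow> 0 \<le> h x"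
    and h_le: "\<And>x. x \<in> closure \<Omega> \<Longrightarrow> h x \<le> Hm"
    and gh_le: "\<And>x. x \<in> closure \<Omega> \<Longrightarrow> norm (gh x) \<le> G"
    and Hh_le: "\<And>x v. x \<in> closure \<Omega> \<Longrightarrow> norm (Hh x v) \<le> G * norm v"
    and gh_nu: "\<And>x. x \<in> frontier \<Omega> \<Longrightarrow> gh x \<bullet> \<nu> x \<ge> 1"
    and nu_curv: "\<And>x y. x \<in> frontier \<Omega> \<Longrightarrow> y \<in> closure \<Omega> \<Longrightarrow> (x - y) \<bullet> \<nu> x \<ge> - Q * (norm (x - y))\<^sup>2"
    and Q_nonneg: "Q \<ge> 0"
begin

lemma compact_cl: "compact (closure \<Omega>)" using bounded_dom by simp

lemma cl_ne: "closure \<Omega> \<noteq> {}" using dom_ne by simp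

lemma cl_obtain: obtains x where "x \<in> closure \<Omega>"
  using dom_ne closure_subset[of \<Omega>] by (metis equals0I subsetD)

lemma cl_cases: "x \<in> closure \<Omega> \<Longrightarrow> x \<in> \<Omega> \<or> x \<in> frontier \<Omega>"
  using open_dom by (auto simp: frontier_def interior_open)

lemma in_cl: "x \<in> \<Omega> \<Longrightarrow> x \<in> closure \<Omega>" using closure_subset by auto

lemma frontier_cl: "x \<in> frontier \<Omega> \<Longrightarrow> x \<in> closure \<Omega>" by (simp add: frontier_def)

lemma G_nonneg: "G \<ge> 0"
proof -
  obtain x where x: "x \<in> closure \<Omega>" by (rule cl_obtain)
  from gh_le[OF x] norm_ge_zero[of "gh x"] show ?thesis by linarith
qed

lemma Hm_nonneg: "Hm \<ge> 0"
proof -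
  obtain x where x: "x \<in> closure \<Omega>" by (rule cl_obtain)
  from h_le[OF x] h_nonneg[OF x] show ?thesis by linarith
qed

lemma tr_Hh: "x \<in> closure \<Omega> \<Longrightarrow> \<bar>tr (Hh x)\<bar> \<le> real CARD('n) * G"
proof -
  assume x: "x \<in> closure \<Omega>"
  have "\<bar>Hh x (axis k 1) \<bullet> axis k 1\<bar> \<le> G" for k
    using Cauchy_Schwarz_ineq2[of "Hh x (axis k 1)" "axis k 1"] Hh_le[OF x, of "axis k 1"] by simp
  then have "(\<Sum>k\<in>UNIV. \<bar>Hh x (axis k 1) \<bullet> axis k 1\<bar>) \<le> (\<Sum>k\<in>(UNIV::'n set). G)"
    by (intro sum_mono)
  then show ?thesis unfolding tr_def by (intro order_trans[OF sum_abs]) simp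
qed

text \<open>
  The one-sided first-order condition at a boundary maximum, tested along the inward normal.
\<close>
lemma frontier_max:
  assumes x: "x \<in> frontier \<Omega>" and D: "(F has_derivative D) (at x within closure \<Omega>)"
    and e: "e > 0" and mx: "\<And>y. y \<in> closure \<Omega> \<Longrightarrow> y \<in> ball x e \<Longrightarrow> F y \<le> (F x :: real)"
  shows "D (\<nu> x) \<ge> 0"
proof (rule ccontr)
  assume "\<not> ?thesis"
  let ?l = "\<lambda>t. x - t *\<^sub>R \<nu> x"
  let ?s = "{t. ?l t \<in> closure \<Omega>}"
  have lin: "linear D" using D by (rule has_derivative_linear)
  have l: "(?l has_derivative (\<lambda>s. - (s *\<^sub>R \<nu> x))) (at 0 within ?s)"
    by (auto intro!: derivative_eq_intros)
  have "(F has_derivative D) (at (?l 0) within ?l ` ?s)"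
    using D by (auto intro: has_derivative_subset)
  from has_derivative_in_compose[OF l this]
  have "((\<lambda>t. F (?l t)) has_derivative (\<lambda>s. D (- (s *\<^sub>R \<nu> x)))) (at 0 within ?s)" .
  then have "((\<lambda>t. F (?l t)) has_real_derivative - D (\<nu> x)) (at 0 within ?s)"
    unfolding has_field_derivative_def
    by (rule has_derivative_eq_rhs) (auto simp: linear_neg[OF lin] linear_cmul[OF lin])
  from has_real_derivative_pos_inc_right[OF this] \<open>\<not> ?thesis\<close>
  obtain r where r: "r > 0" "\<And>t. t > 0 \<Longrightarrow> t \<in> ?s \<Longrightarrow> t < r \<Longrightarrow> F x < F (?l t)" by auto
  have "((\<lambda>t. x - t *\<^sub>R \<nu> x) \<longlongrightarrow> x - 0 *\<^sub>R \<nu> x) (at_right (0::real))" by (intro tendsto_intros)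
  then have "\<forall>\<^sub>F t in at_right 0. ?l t \<in> ball x e"
    using e by (auto elim!: topological_tendstoD simp del: mem_ball)
  moreover have "\<forall>\<^sub>F t in at_right 0. t \<in> {0<..<r}" by (rule eventually_at_rightI[of 0 r]) (use r in auto)
  ultimately have "\<forall>\<^sub>F t in at_right (0::real). False" using enter[OF x]
  proof eventually_elim
    case (elim t)
    then have "?l t \<in> closure \<Omega>" using in_cl by auto
    then have "F (?l t) \<le> F x" "F x < F (?l t)" using elim r(2)[of t] mx[of "?l t"] by auto
    then show ?case by simp
  qed
  then show False by simp
qed

end

text \<open>
  The system satisfied by \<open>W i = - d ln (\<phi> i)\<close>.  The gradients \<open>gW\<close> exist up to the boundary, the Hessians \<open>HW\<close> only in the interior,
  and \<open>B\<close>, \<open>Mb\<close>, \<open>c\<close> are the bounds for the coefficients on which the estimates are allowed to depend.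
\<close>
locale hj_system = neumann_geometry \<Omega> \<nu> h gh Hh Hm G Q
  for \<Omega> :: "(real^'n::finite) set" and \<nu> h gh Hh Hm G Q +
  fixes b :: "'m::finite \<Rightarrow> real^'n \<Rightarrow> real^'n" and M :: "real^'n \<Rightarrow> real^'m^'m"
    and W :: "'m \<Rightarrow> real^'n \<Rightarrow> real" and gW HW and d lam B Mb c :: real
  assumes d0: "d > 0" and d1: "d \<le> 1"
    and W1: "\<And>i x. x \<in> closure \<Omega> \<Longrightarrow> (W i has_derivative (\<lambda>v. gW i x \<bullet> v)) (at x within closure \<Omega>)"
    and W2: "\<And>i x. x \<in> \<Omega> \<Longrightarrow> twice_diff_at (W i) (gW i) (HW i) x"
    and neumann: "\<And>i x. x \<in> frontier \<Omega> \<Longrightarrow> gW i x \<bullet> \<nu> x = 0"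
    and hj_eq: "\<And>i x. x \<in> \<Omega> \<Longrightarrow> d * tr (HW i x) = gW i x \<bullet> gW i x - b i x \<bullet> gW i x
        + d * (\<Sum>j\<in>UNIV-{i}. - (M x $ i $ j) * exp ((W i x - W j x) / d)) - d * (M x $ i $ i - lam)"
    and b_le: "\<And>i x. x \<in> closure \<Omega> \<Longrightarrow> norm (b i x) \<le> B"
    and M_le: "\<And>i j x. x \<in> closure \<Omega> \<Longrightarrow> \<bar>M x $ i $ j\<bar> \<le> Mb"
    and M_off: "\<And>i j x. x \<in> closure \<Omega> \<Longrightarrow> i \<noteq> j \<Longrightarrow> M x $ i $ j \<le> - c"
    and c0: "c > 0"
begin

text \<open>The zero-order coupling of the \<open>i\<close>-th equation to the other ones.\<close>
definition "coupling i x = d * (\<Sum>j\<in>UNIV-{i}. - (M x $ i $ j) * exp ((W i x - W j x) / d))"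

lemma coupling_terms: "x \<in> closure \<Omega> \<Longrightarrow> j \<in> UNIV - {i} \<Longrightarrow>
    c * exp ((W i x - W j x) / d) \<le> - (M x $ i $ j) * exp ((W i x - W j x) / d)"
  using M_off[of x i j] by (intro mult_right_mono) auto

lemma coupling_nonneg: assumes x: "x \<in> closure \<Omega>" shows "coupling i x \<ge> 0"
  unfolding coupling_def
proof (rule mult_nonneg_nonneg, use d0 in simp, rule sum_nonneg)
  fix j assume "j \<in> UNIV - {i}"
  with x have "c * exp ((W i x - W j x) / d) \<le> - (M x $ i $ j) * exp ((W i x - W j x) / d)"
    by (rule coupling_terms)
  moreover have "0 \<le> c * exp ((W i x - W j x) / d)" using c0 by simp
  ultimately show "0 \<le> - (M x $ i $ j) * exp ((W i x - W j x) / d)" by linarith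
qed

lemma coupling_ge:
  assumes "x \<in> closure \<Omega>" "i \<noteq> j"
  shows "coupling i x \<ge> d * (c * exp ((W i x - W j x) / d))"
proof -
  have "c * exp ((W i x - W j x) / d) \<le> - (M x $ i $ j) * exp ((W i x - W j x) / d)"
    using assms by (intro coupling_terms) auto
  also have "\<dots> \<le> (\<Sum>j\<in>UNIV-{i}. - (M x $ i $ j) * exp ((W i x - W j x) / d))"
  proof (rule member_le_sum)
    fix k assume "k \<in> UNIV - {i} - {j}"
    then have "0 \<le> c * exp ((W i x - W k x) / d)" "c * exp ((W i x - W k x) / d) \<le> - (M x $ i $ k) * exp ((W i x - W k x) / d)"
      using assms c0 coupling_terms[of x k i] by auto
    then show "0 \<le> - (M x $ i $ k) * exp ((W i x - W k x) / d)" by linarith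
  qed (use assms in auto)
  finally show ?thesis unfolding coupling_def using d0 by (intro mult_left_mono) auto
qed

lemma Mb_nonneg: "Mb \<ge> 0"
proof -
  obtain x where x: "x \<in> closure \<Omega>" by (rule cl_obtain)
  from M_le[OF x] abs_ge_zero show ?thesis by (rule order_trans[rotated])
qed

lemma B_nonneg: "B \<ge> 0"
proof -
  obtain x where x: "x \<in> closure \<Omega>" by (rule cl_obtain)
  from b_le[OF x] norm_ge_zero show ?thesis by (rule order_trans[rotated])
qed

text \<open>
  For an index at which the components attain their least value the coupling is of order \<open>d\<close>, since all exponentials are at most one.
\<close>
lemma coupling_le:
  assumes x: "x \<in> closure \<Omega>" and mn: "\<And>j. W i x \<le> W j x"
  shows "coupling i x \<le> d * (real CARD('m) * Mb)"
proof -
  have "(\<Sum>j\<in>UNIV-{i}. - (M x $ i $ j) * exp ((W i x - W j x) / d)) \<le> (\<Sum>j\<in>UNIV-{i}. Mb)"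
  proof (rule sum_mono)
    fix j assume "j \<in> UNIV - {i}"
    have "(W i x - W j x) / d \<le> 0" using mn[of j] d0 by (intro divide_nonpos_pos) auto
    then have "exp ((W i x - W j x) / d) \<le> 1" by simp
    moreover have "- (M x $ i $ j) \<le> Mb" using M_le[OF x, of i j] by linarith
    ultimately show "- (M x $ i $ j) * exp ((W i x - W j x) / d) \<le> Mb"
      using mult_mono[of "- (M x $ i $ j)" Mb "exp ((W i x - W j x) / d)" 1] Mb_nonneg by simp
  qed
  also have "\<dots> \<le> real CARD('m) * Mb"
    using Mb_nonneg by (simp add: card_Diff_singleton) (intro mult_right_mono, auto)
  finally show ?thesis unfolding coupling_def using d0 by (intro mult_left_mono) auto
qed

lemma hj_eq': "x \<in> \<Omega> \<Longrightarrow> d * tr (HW i x) = gW i x \<bullet> gW i x - b i x \<bullet> gW i x + coupling i x - d * (M x $ i $ i - lam)"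
  using hj_eq unfolding coupling_def by simp

lemma b_inner: "x \<in> closure \<Omega> \<Longrightarrow> \<bar>b i x \<bullet> p\<bar> \<le> B * norm p"
  using Cauchy_Schwarz_ineq2[of "b i x" p] b_le[of x i] mult_right_mono[of "norm (b i x)" B "norm p"] by simp

lemma W_cont: "continuous_on (closure \<Omega>) (W i)"
  unfolding continuous_on_eq_continuous_within
  by (intro ballI has_derivative_continuous[OF W1])

lemma h_deriv: "(h has_derivative (\<lambda>v. gh x \<bullet> v)) (at x within S)"
  by (rule has_derivative_at_withinI[OF twice_diff_at_DERIV[OF h2]])

lemma h_cont: "continuous_on S h"
  by (intro continuous_at_imp_continuous_on ballI has_derivative_continuous[OF twice_diff_at_DERIV[OF h2]])

text \<open>
  Bounds for the eigenvalue, from the minimum of \<open>W i + d h\<close> and the maximum of \<open>W i - d h\<close>.  The perturbation by \<open>d h\<close> keeps these points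
  off the boundary.
\<close>

lemma lam_lower: "- lam \<le> Mb + real CARD('n) * G + G\<^sup>2 + B * G + real CARD('m) * Mb"
proof -
  have "continuous_on (closure \<Omega>) (\<lambda>y. - W j y - d * h y)" for j
    by (intro continuous_intros W_cont h_cont)
  from finite_family_attains_sup[OF finite UNIV_not_empty compact_cl cl_ne this, of "\<lambda>j. j"]
  obtain i x where x: "x \<in> closure \<Omega>" and mx: "\<And>j y. y \<in> closure \<Omega> \<Longrightarrow> - W j y - d * h y \<le> - W i x - d * h x"
    by blast
  have xO: "x \<in> \<Omega>"
  proof (rule ccontr)
    assume "x \<notin> \<Omega>"
    then have xf: "x \<in> frontier \<Omega>" using cl_cases x by auto
    have "((\<lambda>y. - W i y - d * h y) has_derivative (\<lambda>v. - (gW i x \<bullet> v) - d * (gh x \<bullet> v))) (at x within closure \<Omega>)"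
      by (intro has_derivative_diff has_derivative_minus has_derivative_mult_right W1 x h_deriv)
    from frontier_max[OF xf this, of 1] mx have "- (gW i x \<bullet> \<nu> x) - d * (gh x \<bullet> \<nu> x) \<ge> 0" by auto
    then have "d * (gh x \<bullet> \<nu> x) \<le> 0" using neumann[OF xf] by simp
    moreover have "d * (gh x \<bullet> \<nu> x) > 0" using gh_nu[OF xf] d0 by (intro mult_pos_pos) auto
    ultimately show False by simp
  qed
  obtain e where e: "e > 0" "ball x e \<subseteq> \<Omega>" using open_dom xO open_contains_ball by blast
  have mx': "- d * h y - W i y \<le> - d * h x - W i x" if "y \<in> ball x e" for y
    using mx[of y i] e(2) in_cl that by auto
  have "- d *\<^sub>R gh x = gW i x \<and> tr (\<lambda>v. - d *\<^sub>R Hh x v) \<le> tr (HW i x)"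
    using one_point_max[OF twice_diff_at_cmult[OF h2, of "-d" x] W2[OF xO, of i] e(1) mx'] by blast
  then have g: "gW i x = - d *\<^sub>R gh x" and H: "- d * tr (Hh x) \<le> tr (HW i x)"
    unfolding tr_scaleR by auto
  have ng: "norm (gW i x) \<le> d * G" using gh_le[OF x] d0 by (simp add: g mult_left_mono)
  have "tr (HW i x) \<ge> - (d * (real CARD('n) * G))"
  proof -
    have "d * tr (Hh x) \<le> d * (real CARD('n) * G)" using tr_Hh[OF x] d0 by (intro mult_left_mono) auto
    then show ?thesis using H by simp
  qed
  then have 1: "d * tr (HW i x) \<ge> d * (- (d * (real CARD('n) * G)))" using d0 by (intro mult_left_mono) auto
  have "gW i x \<bullet> gW i x \<le> (d * G)\<^sup>2"
    using ng by (simp add: dot_square_norm power_mono)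
  also have "\<dots> = d * (d * G\<^sup>2)" by (simp add: power2_eq_square)
  finally have 2: "gW i x \<bullet> gW i x \<le> d * (d * G\<^sup>2)" .
  have 3: "- (b i x \<bullet> gW i x) \<le> d * (B * G)"
    using b_inner[OF x, of i "gW i x"] mult_left_mono[OF ng B_nonneg] by (simp add: algebra_simps)
  have "W i x \<le> W j x" for j using mx[OF x, of j] by simp
  then have 4: "coupling i x \<le> d * (real CARD('m) * Mb)" by (rule coupling_le[OF x])
  have "d * (M x $ i $ i - lam) \<le> d * (d * (real CARD('n) * G) + d * G\<^sup>2 + B * G + real CARD('m) * Mb)"
    using 1 2 3 4 hj_eq'[OF xO, of i] by (simp add: algebra_simps)
  then have "M x $ i $ i - lam \<le> d * (real CARD('n) * G) + d * G\<^sup>2 + B * G + real CARD('m) * Mb"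
    using d0 by simp
  moreover have "d * (real CARD('n) * G) \<le> real CARD('n) * G" "d * G\<^sup>2 \<le> G\<^sup>2"
    using d1 d0 G_nonneg by (auto intro!: mult_left_le_one_le)
  moreover have "- Mb \<le> M x $ i $ i" using M_le[OF x, of i i] by linarith
  ultimately show ?thesis by linarith
qed

lemma lam_upper: "lam \<le> Mb + real CARD('n) * G + B * G"
proof -
  have "continuous_on (closure \<Omega>) (\<lambda>y. W j y - d * h y)" for j
    by (intro continuous_intros W_cont h_cont)
  from finite_family_attains_sup[OF finite UNIV_not_empty compact_cl cl_ne this, of "\<lambda>j. j"]
  obtain i x where x: "x \<in> closure \<Omega>" and mx: "\<And>j y. y \<in> closure \<Omega> \<Longrightarrow> W j y - d * h y \<le> W i x - d * h x"
    by blast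
  have xO: "x \<in> \<Omega>"
  proof (rule ccontr)
    assume "x \<notin> \<Omega>"
    then have xf: "x \<in> frontier \<Omega>" using cl_cases x by auto
    have "((\<lambda>y. W i y - d * h y) has_derivative (\<lambda>v. (gW i x \<bullet> v) - d * (gh x \<bullet> v))) (at x within closure \<Omega>)"
      by (intro has_derivative_diff has_derivative_mult_right W1 x h_deriv)
    from frontier_max[OF xf this, of 1] mx have "(gW i x \<bullet> \<nu> x) - d * (gh x \<bullet> \<nu> x) \<ge> 0" by auto
    then have "d * (gh x \<bullet> \<nu> x) \<le> 0" using neumann[OF xf] by simp
    moreover have "d * (gh x \<bullet> \<nu> x) > 0" using gh_nu[OF xf] d0 by (intro mult_pos_pos) auto
    ultimately show False by simp
  qed
  obtain e where e: "e > 0" "ball x e \<subseteq> \<Omega>" using open_dom xO open_contains_ball by blast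
  have mx': "W i y - d * h y \<le> W i x - d * h x" if "y \<in> ball x e" for y
    using mx[of y i] e(2) in_cl that by auto
  have "gW i x = d *\<^sub>R gh x \<and> tr (HW i x) \<le> tr (\<lambda>v. d *\<^sub>R Hh x v)"
    using one_point_max[OF W2[OF xO, of i] twice_diff_at_cmult[OF h2, of d x] e(1) mx'] by blast
  then have g: "gW i x = d *\<^sub>R gh x" and H: "tr (HW i x) \<le> d * tr (Hh x)"
    unfolding tr_scaleR by auto
  have ng: "norm (gW i x) \<le> d * G" using gh_le[OF x] d0 by (simp add: g mult_left_mono)
  have "d * tr (Hh x) \<le> d * (real CARD('n) * G)" using tr_Hh[OF x] d0 by (intro mult_left_mono) auto
  then have "tr (HW i x) \<le> d * (real CARD('n) * G)" using H by linarith
  then have 1: "d * tr (HW i x) \<le> d * (d * (real CARD('n) * G))" using d0 by (intro mult_left_mono) auto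
  have 3: "b i x \<bullet> gW i x \<le> d * (B * G)"
    using b_inner[OF x, of i "gW i x"] mult_left_mono[OF ng B_nonneg] by (simp add: algebra_simps)
  have "0 \<le> gW i x \<bullet> gW i x" by simp
  then have "d * (lam - M x $ i $ i) \<le> d * (d * (real CARD('n) * G) + B * G)"
    using 1 3 coupling_nonneg[OF x, of i] hj_eq'[OF xO, of i]
    unfolding right_diff_distrib distrib_left by linarith
  then have "lam - M x $ i $ i \<le> d * (real CARD('n) * G) + B * G"
    using d0 by simp
  moreover have "d * (real CARD('n) * G) \<le> real CARD('n) * G"
    using d1 d0 G_nonneg by (auto intro!: mult_left_le_one_le)
  moreover have "M x $ i $ i \<le> Mb" using M_le[OF x, of i i] by linarith
  ultimately show ?thesis by linarith
qed

end

section \<open>The two-point estimate\<close>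

lemma rho_commute: "rho K h x y = rho K h y x"
  by (simp add: rho_def norm_minus_commute add.commute)

lemma has_derivative_rho:
  fixes h :: "real^'n::finite \<Rightarrow> real" and K :: real
  assumes h: "(h has_derivative (\<lambda>v. gh x \<bullet> v)) (at x within S)" and xy: "x \<noteq> y"
  shows "((\<lambda>z. rho K h z y) has_derivative
    (\<lambda>v. rho K h x y * ((x - y) \<bullet> v / (norm (x - y))\<^sup>2 + K * (gh x \<bullet> v)))) (at x within S)"
proof -
  have "((\<lambda>z. z - y) has_derivative (\<lambda>v. v)) (at x within S)"
    by (auto intro!: derivative_eq_intros)
  from has_derivative_compose[OF this has_derivative_norm]
  have "((\<lambda>z. norm (z - y)) has_derivative (\<lambda>v. v \<bullet> sgn (x - y))) (at x within S)"
    using xy by simp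
  then have "((\<lambda>z. norm (z - y) * exp (K * (h z + h y))) has_derivative
     (\<lambda>v. norm (x - y) * (K * (gh x \<bullet> v) * exp (K * (h x + h y))) + v \<bullet> sgn (x - y) * exp (K * (h x + h y)))) (at x within S)"
    by (rule has_derivative_mult) (auto intro!: derivative_eq_intros h)
  moreover have "norm (x - y) * (K * (gh x \<bullet> v) * exp (K * (h x + h y))) + v \<bullet> sgn (x - y) * exp (K * (h x + h y))
      = norm (x - y) * exp (K * (h x + h y)) * ((x - y) \<bullet> v / (norm (x - y))\<^sup>2 + K * (gh x \<bullet> v))" for v
  proof -
    have "v \<bullet> sgn (x - y) = (x - y) \<bullet> v / norm (x - y)"
      by (simp only: sgn_div_norm inner_scaleR_right inner_commute[of v] divide_inverse mult.commute)
    moreover have "norm (x - y) \<noteq> 0" using xy by simp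
    ultimately show ?thesis by (simp add: field_simps power2_eq_square)
  qed
  ultimately show ?thesis unfolding rho_def by simp
qed

text \<open>
  The constants of the doubling argument, in the order in which they are chosen: the exponent \<open>K\<close> of the weight, which dominates \<open>Q\<close>;
  the bound \<open>E\<close> for the weight; the radius \<open>R\<close>; the ratio \<open>\<eta>\<close> between the scale of concavity of the profile and \<open>d\<close>; a bound \<open>Cl\<close> for
  \<open>Mb - lam\<close>; the slope \<open>L\<close>.  All of them can be chosen independently of \<open>d\<close>, and the last four conditions hold once \<open>d\<close> is small.
\<close>
locale hj_estimate = hj_system \<Omega> \<nu> h gh Hh Hm G Q b M W gW HW d lam B Mb c
  for \<Omega> :: "(real^'n::finite) set" and \<nu> h gh Hh Hm G Q
    and b :: "'m::finite \<Rightarrow> real^'n \<Rightarrow> real^'n" and M :: "real^'n \<Rightarrow> real^'m^'m"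
    and W gW HW d lam B Mb c +
  fixes K E R L \<eta> Cl :: real
  assumes KQ: "Q \<le> K" and E_def: "E = exp (2 * K * Hm)"
    and R0: "R > 0" and R1: "R \<le> 1" and KGR: "4 * K * G * R \<le> 1"
    and L2: "L \<ge> 2" and eta0: "\<eta> > 0"
    and eta1: "24 * B * E + 2 * B * G + 2 \<le> 1 / \<eta>"
    and Cl: "Mb - lam \<le> Cl" and Cl0: "0 \<le> Cl"
    and L1: "4 * (2 * G + B + 5 * real CARD('n) * E / \<eta> + B * G + Cl + real CARD('n) * G) + 2 \<le> L"
    and dLR: "d \<le> L * R / 2" and dR: "8 * \<eta> * d \<le> R"
    and d2: "d * (66 * L * E * K * real CARD('n) * G + 2 * real CARD('n) * G
        + 4 * G * (6 * L * K * \<eta> + 1) * (12 * L * E + G) + (real CARD('m) + 2) * Mb) \<le> 1"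
    and d3: "(6 * L * E + G)\<^sup>2 + 2 * B * (6 * L * E + G) + real CARD('m) * Mb + 2 * Mb + 2 * real CARD('n) * G
        < d * c * exp (1 / sqrt d)"
begin

text \<open>
  The profile \<open>psi\<close> with its first two derivatives.  Its first logarithm makes it strongly concave on the scale \<open>\<delta>\<close>; the second one makes
  it tend to infinity at \<open>R\<close>, with a second derivative that is dominated by the square of the first.  The value \<open>psi 0 = sqrt d\<close>
  is the gap between two components that the coupling terms cannot sustain.
\<close>
definition "\<delta> = \<eta> * d"
definition "psi s = sqrt d + 4 * L * \<delta> * ln (1 + s / \<delta>) - L * R * ln (1 - s / R)"
definition "psi1 s = 4 * L / (1 + s / \<delta>) + L / (1 - s / R)"
definition "psi2 s = - (4 * L / \<delta>) / (1 + s / \<delta>)\<^sup>2 + (L / R) / (1 - s / R)\<^sup>2"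

lemma delta0: "\<delta> > 0" using eta0 d0 by (simp add: \<delta>_def)

lemma deltaR: "\<delta> \<le> R / 8" using dR by (simp add: \<delta>_def)

lemma K0: "K \<ge> 0" using KQ Q_nonneg by simp

lemma E1: "E \<ge> 1" using K0 Hm_nonneg by (simp add: E_def)

lemma psi_deriv: assumes "- \<delta> < s" "s < R" shows "(psi has_real_derivative psi1 s) (at s)"
proof -
  have "1 + s / \<delta> > 0" "1 - s / R > 0" using assms delta0 R0 by (simp_all add: field_simps)
  moreover have "\<delta> \<noteq> 0" "R \<noteq> 0" using delta0 R0 by auto
  ultimately show ?thesis unfolding psi_def[abs_def] psi1_def
    by (auto intro!: derivative_eq_intros simp: field_simps)
qed

lemma psi1_deriv: assumes "- \<delta> < s" "s < R" shows "(psi1 has_real_derivative psi2 s) (at s)"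
proof -
  have "1 + s / \<delta> > 0" "1 - s / R > 0" using assms delta0 R0 by (simp_all add: field_simps)
  moreover have "\<delta> \<noteq> 0" "R \<noteq> 0" using delta0 R0 by auto
  ultimately show ?thesis unfolding psi1_def[abs_def] psi2_def
    by (auto intro!: derivative_eq_intros simp: power2_eq_square)
qed

lemma psi_lower:
  assumes "0 \<le> s" "s < R" shows "sqrt d - L * R * ln (1 - s / R) \<le> psi s" "sqrt d \<le> psi s"
proof -
  have 1: "0 \<le> 4 * L * \<delta> * ln (1 + s / \<delta>)" using assms delta0 L2 by auto
  then show "sqrt d - L * R * ln (1 - s / R) \<le> psi s" by (simp add: psi_def)
  have "1 - s / R > 0" "1 - s / R \<le> 1" using assms R0 by (auto simp: field_simps)
  then have "ln (1 - s / R) \<le> 0" by simp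
  then have "L * R * ln (1 - s / R) \<le> 0" using L2 R0 by (auto simp: mult_le_0_iff)
  with 1 show "sqrt d \<le> psi s" by (simp add: psi_def)
qed

lemma psi_upper:
  assumes "0 \<le> s" "s \<le> R / 2" shows "psi s \<le> sqrt d + 6 * L * s"
proof -
  have "ln (1 + s / \<delta>) \<le> s / \<delta>" using assms delta0 by (intro ln_add_one_self_le_self) auto
  then have "4 * L * \<delta> * ln (1 + s / \<delta>) \<le> 4 * L * \<delta> * (s / \<delta>)"
    using L2 delta0 by (intro mult_left_mono) auto
  then have 1: "4 * L * \<delta> * ln (1 + s / \<delta>) \<le> 4 * L * s" using delta0 by simp
  have q: "0 \<le> s / R" "s / R \<le> 1/2" using assms R0 by (auto simp: field_simps)
  have "- (s / R) - 2 * (s / R)\<^sup>2 \<le> ln (1 - s / R)" by (rule ln_one_minus_pos_lower_bound[OF q])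
  moreover have "2 * (s / R)\<^sup>2 \<le> s / R"
    using mult_left_mono[OF q(2) q(1)] by (simp add: power2_eq_square)
  ultimately have "- ln (1 - s / R) \<le> 2 * (s / R)" by linarith
  then have "L * R * (- ln (1 - s / R)) \<le> L * R * (2 * (s / R))"
    using L2 R0 by (intro mult_left_mono) auto
  then have "- (L * R * ln (1 - s / R)) \<le> 2 * L * s" using R0 by simp
  with 1 show ?thesis unfolding psi_def by linarith
qed

lemma psi1_ge: assumes "0 \<le> s" "s < R" shows "psi1 s \<ge> L / (1 - s / R)" "psi1 s \<ge> L"
proof -
  have "0 \<le> 4 * L / (1 + s / \<delta>)" using assms delta0 L2 by auto
  then show 1: "psi1 s \<ge> L / (1 - s / R)" by (simp add: psi1_def)
  have "0 < 1 - s / R" "1 - s / R \<le> 1" using assms R0 by (auto simp: field_simps)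
  then have "L \<le> L / (1 - s / R)" using L2 by (simp add: le_divide_eq mult_left_le)
  with 1 show "psi1 s \<ge> L" by linarith
qed

lemma psi2_le: assumes "0 \<le> s" "s < R" shows "psi2 s \<le> (psi1 s)\<^sup>2 / (L * R)"
proof -
  have p: "0 < 1 - s / R" using assms R0 by (auto simp: field_simps)
  have "psi2 s \<le> (L / R) / (1 - s / R)\<^sup>2" using L2 delta0 by (simp add: psi2_def)
  also have "\<dots> = (L / (1 - s / R))\<^sup>2 / (L * R)"
    using L2 R0 p by (simp add: power2_eq_square)
  also have "\<dots> \<le> (psi1 s)\<^sup>2 / (L * R)"
    using psi1_ge(1)[OF assms] p L2 R0 by (intro divide_right_mono power_mono) auto
  finally show ?thesis .
qed

lemma near_bounds:
  assumes "0 \<le> s" "s \<le> \<delta>" shows "psi1 s \<le> 6 * L" "d * psi2 s \<le> - L / (2 * \<eta>)"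
proof -
  have sR: "s / R \<le> 1/8" using assms deltaR R0 by (simp add: field_simps)
  have q: "1 + s / \<delta> \<ge> 1" using assms delta0 by simp
  then have "4 * L / (1 + s / \<delta>) \<le> 4 * L / 1" using L2 by (intro divide_left_mono) auto
  moreover have "L / (1 - s / R) \<le> L / (1/2)" using sR L2 by (intro divide_left_mono mult_pos_pos) linarith+
  ultimately show "psi1 s \<le> 6 * L" by (simp add: psi1_def)
  have "(1 + s / \<delta>)\<^sup>2 \<le> 2\<^sup>2" using assms delta0 by (intro power_mono) (auto simp: field_simps)
  then have "(4 * L / \<delta>) / 4 \<le> (4 * L / \<delta>) / (1 + s / \<delta>)\<^sup>2"
    using L2 delta0 q by (intro divide_left_mono mult_pos_pos zero_less_power) auto
  then have 1: "- ((4 * L / \<delta>) / (1 + s / \<delta>)\<^sup>2) \<le> - (L / \<delta>)" by simp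
  have q2: "1 - s / R \<ge> 1/2" using sR by linarith
  then have "(1/2)\<^sup>2 \<le> (1 - s / R)\<^sup>2" by (intro power_mono) auto
  moreover have "0 < (1 - s / R)\<^sup>2" using q2 by (intro zero_less_power) linarith
  ultimately have "(L / R) / (1 - s / R)\<^sup>2 \<le> (L / R) / (1/2)\<^sup>2"
    using L2 R0 by (intro divide_left_mono mult_pos_pos) auto
  then have 2: "(L / R) / (1 - s / R)\<^sup>2 \<le> 4 * L / R" by (simp add: power2_eq_square mult.commute)
  have "psi2 s \<le> - (L / \<delta>) + 4 * L / R" using 1 2 by (simp add: psi2_def)
  then have "d * psi2 s \<le> d * (- (L / \<delta>) + 4 * L / R)" using d0 by (intro mult_left_mono) auto
  also have "\<dots> = - L / \<eta> + 4 * d * L / R" using d0 eta0 by (simp add: \<delta>_def field_simps)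
  also have "4 * d * L / R \<le> L / (2 * \<eta>)"
  proof -
    have "8 * \<eta> * d * L \<le> R * L" using dR L2 by (intro mult_right_mono) auto
    then show ?thesis using R0 eta0 by (simp add: field_simps)
  qed
  finally show "d * psi2 s \<le> - L / (2 * \<eta>)" by (simp add: field_simps)
qed

text \<open>The weighted distance with the exponent \<open>K\<close> and the function \<open>h\<close> of the context.\<close>
definition "\<rho> x y = rho K h x y"

lemma rho_bounds:
  assumes "x \<in> closure \<Omega>" "y \<in> closure \<Omega>"
  shows "norm (x - y) \<le> \<rho> x y" "\<rho> x y \<le> E * norm (x - y)" "\<rho> x y \<ge> 0"
proof -
  have "0 \<le> h x + h y" "h x + h y \<le> Hm + Hm"
    by (intro add_nonneg_nonneg add_mono h_nonneg h_le assms)+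
  then have "0 \<le> K * (h x + h y)" "K * (h x + h y) \<le> K * (Hm + Hm)"
    using K0 by (auto intro: mult_left_mono simp del: mult_2)
  then have e: "1 \<le> exp (K * (h x + h y))" "exp (K * (h x + h y)) \<le> E"
    by (auto simp: E_def mult.assoc mult.commute[of 2] simp flip: mult_2_right)
  show "norm (x - y) \<le> \<rho> x y" using mult_left_mono[OF e(1) norm_ge_zero[of "x - y"]] by (simp add: \<rho>_def rho_def)
  show "\<rho> x y \<le> E * norm (x - y)" using mult_left_mono[OF e(2) norm_ge_zero[of "x - y"]]
    by (simp add: \<rho>_def rho_def mult.commute)
  show "\<rho> x y \<ge> 0" by (simp add: \<rho>_def rho_def)
qed

text \<open>
  The function of two points and two indices that will be shown to be nonpositive for \<open>\<rho> x y < R\<close>.  The term with \<open>d\<close> makes the boundary inequalities strict.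
\<close>
definition "Phi i j x y = W i x - W j y - (psi (\<rho> x y) + d * (h x + h y))"

text \<open>
  At a boundary point \<open>x\<close> the normal derivative of the test function is positive: the convexity defect \<open>- Q\<close> of the distance is compensated by
  the normal derivative of the weight, which is at least \<open>K\<close>.  This contradicts the Neumann condition.
\<close>
lemma frontier_excluded:
  assumes x: "x \<in> frontier \<Omega>" and y: "y \<in> closure \<Omega>" and xy: "x \<noteq> y" and r: "\<rho> x y < R" and e: "e > 0"
    and f: "(f has_derivative (\<lambda>v. g \<bullet> v)) (at x within closure \<Omega>)" and g0: "g \<bullet> \<nu> x = 0"
    and mx: "\<And>z. z \<in> closure \<Omega> \<Longrightarrow> z \<in> ball x e \<Longrightarrow>
        f z - (psi (\<rho> z y) + d * (h z + h y)) \<le> f x - (psi (\<rho> x y) + d * (h x + h y))"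
  shows False
proof -
  have xc: "x \<in> closure \<Omega>" using x by (rule frontier_cl)
  let ?w = "\<lambda>v. (x - y) \<bullet> v / (norm (x - y))\<^sup>2 + K * (gh x \<bullet> v)"
  have "norm (x - y) > 0" using xy by simp
  then have rp: "\<rho> x y > 0" using rho_bounds(1)[OF xc y] by linarith
  have p: "psi1 (\<rho> x y) > 0" using psi1_ge(2)[of "\<rho> x y"] rp r L2 by linarith
  have "((\<lambda>z. \<rho> z y) has_derivative (\<lambda>v. \<rho> x y * ?w v)) (at x within closure \<Omega>)"
    unfolding \<rho>_def by (rule has_derivative_rho[where gh = gh and h = h, OF h_deriv xy])
  moreover have "(psi has_derivative (\<lambda>s. psi1 (\<rho> x y) * s)) (at (\<rho> x y))"
    using psi_deriv[of "\<rho> x y"] rp r delta0 by (simp add: has_field_derivative_def)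
  ultimately have "((\<lambda>z. psi (\<rho> z y)) has_derivative (\<lambda>v. psi1 (\<rho> x y) * (\<rho> x y * ?w v))) (at x within closure \<Omega>)"
    by (rule has_derivative_compose)
  moreover have "((\<lambda>z. d * (h z + h y)) has_derivative (\<lambda>v. d * (gh x \<bullet> v))) (at x within closure \<Omega>)"
    by (intro has_derivative_mult_right) (auto intro!: derivative_eq_intros h_deriv)
  ultimately have "((\<lambda>z. f z - (psi (\<rho> z y) + d * (h z + h y))) has_derivative
     (\<lambda>v. g \<bullet> v - (psi1 (\<rho> x y) * (\<rho> x y * ?w v) + d * (gh x \<bullet> v)))) (at x within closure \<Omega>)"
    by (intro has_derivative_diff has_derivative_add f)
  from frontier_max[OF x this e mx]
  have "psi1 (\<rho> x y) * (\<rho> x y * ?w (\<nu> x)) + d * (gh x \<bullet> \<nu> x) \<le> 0" using g0 by simp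
  moreover have "?w (\<nu> x) \<ge> 0"
  proof -
    have "(x - y) \<bullet> \<nu> x / (norm (x - y))\<^sup>2 \<ge> - Q"
      using nu_curv[OF x y] xy by (simp add: le_divide_eq)
    moreover have "K * (gh x \<bullet> \<nu> x) \<ge> K * 1" using gh_nu[OF x] K0 by (intro mult_left_mono)
    ultimately show ?thesis using KQ by linarith
  qed
  then have "psi1 (\<rho> x y) * (\<rho> x y * ?w (\<nu> x)) \<ge> 0" using p rp by simp
  moreover have "d * (gh x \<bullet> \<nu> x) > 0" using gh_nu[OF x] d0 by (intro mult_pos_pos) auto
  ultimately show False by linarith
qed

lemma K_G_r: assumes "0 < r" "r \<le> R" shows "K * G \<le> 1 / (4 * r)"
proof -
  have "4 * (K * G) * r \<le> 4 * (K * G) * R" using assms K0 G_nonneg by (intro mult_left_mono) auto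
  also have "\<dots> \<le> 1" using KGR by simp
  finally show ?thesis using assms by (simp add: field_simps)
qed

text \<open>
  Within the radius \<open>R\<close> the gradient of the logarithm of the weight is small compared with that of the logarithm of the distance.
\<close>
lemma sigma_bounds:
  assumes z: "z \<in> closure \<Omega>" and xy: "x \<noteq> y" and r: "norm (x - y) \<le> R"
  defines "r \<equiv> norm (x - y)"
  shows "1 / (2 * r) \<le> norm ((x - y) /\<^sub>R r\<^sup>2 + K *\<^sub>R gh z)" "norm ((x - y) /\<^sub>R r\<^sup>2 + K *\<^sub>R gh z) \<le> 2 / r"
    "norm ((x - y) /\<^sub>R r\<^sup>2 - K *\<^sub>R gh z) \<le> 2 / r"
proof -
  have r0: "r > 0" using xy by (simp add: r_def)
  have "norm ((x - y) /\<^sub>R r\<^sup>2) = inverse (r\<^sup>2) * r" by (simp only: norm_scaleR r_def[symmetric]) simp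
  then have 1: "norm ((x - y) /\<^sub>R r\<^sup>2) = 1 / r" using r0 by (simp add: power2_eq_square field_simps)
  have "norm (K *\<^sub>R gh z) \<le> K * G" using gh_le[OF z] K0 by (simp add: mult_left_mono)
  also have "\<dots> \<le> 1 / (4 * r)" using K_G_r r0 r by (simp add: r_def)
  finally have 2: "norm (K *\<^sub>R gh z) \<le> 1 / (4 * r)" .
  have 3: "1 / r - 1 / (4 * r) \<ge> 1 / (2 * r)" "1 / r + 1 / (4 * r) \<le> 2 / r" using r0 by (auto simp: field_simps)
  show "1 / (2 * r) \<le> norm ((x - y) /\<^sub>R r\<^sup>2 + K *\<^sub>R gh z)"
    using norm_triangle_ineq2[of "(x - y) /\<^sub>R r\<^sup>2" "- (K *\<^sub>R gh z)"] 1 2 3 by simp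
  show "norm ((x - y) /\<^sub>R r\<^sup>2 + K *\<^sub>R gh z) \<le> 2 / r"
    using norm_triangle_ineq[of "(x - y) /\<^sub>R r\<^sup>2" "(K *\<^sub>R gh z)"] 1 2 3 by linarith
  show "norm ((x - y) /\<^sub>R r\<^sup>2 - K *\<^sub>R gh z) \<le> 2 / r"
    using norm_triangle_ineq4[of "(x - y) /\<^sub>R r\<^sup>2" "(K *\<^sub>R gh z)"] 1 2 3 by linarith
qed

context
  fixes i j x y e
  assumes x: "x \<in> \<Omega>" and y: "y \<in> \<Omega>" and xy: "x \<noteq> y" and rR: "\<rho> x y < R" and e: "e > 0"
    and mx: "\<And>x' y'. x' \<in> ball x e \<Longrightarrow> y' \<in> ball y e \<Longrightarrow> Phi i j x' y' \<le> Phi i j x y"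
begin

text \<open>
  At a maximum of \<open>Phi i j\<close> over interior points \<open>x \<noteq> y\<close>: the derivative of \<open>psi \<circ> \<rho>\<close> in \<open>x\<close> is \<open>S\<close> times \<open>\<sigma>\<close>, and \<open>\<tau>\<close> is the
  counterpart of \<open>\<sigma>\<close> for mirrored displacements of the two points.
\<close>
definition "S = psi1 (\<rho> x y) * \<rho> x y"
definition "r = norm (x - y)"
definition "\<sigma> = (x - y) /\<^sub>R r\<^sup>2 + K *\<^sub>R gh x"
definition "\<tau> = (2 / r\<^sup>2) *\<^sub>R (x - y) + K *\<^sub>R (gh x + refl_along (x - y) (gh y))"

lemma xc: "x \<in> closure \<Omega>" and yc: "y \<in> closure \<Omega>" using x y in_cl by auto

lemma r0: "r > 0" using xy by (simp add: r_def)
lemma r_rho: "r \<le> \<rho> x y" "\<rho> x y \<le> E * r" using rho_bounds[OF xc yc] by (auto simp: r_def)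
lemma rleR: "r \<le> R" using r_rho rR by linarith
lemma rho0: "\<rho> x y > 0" using r0 r_rho by linarith
lemma S0: "S > 0" unfolding S_def using rho0 psi1_ge(2)[of "\<rho> x y"] rR L2 by (intro mult_pos_pos) auto

lemma interior_trace:
  shows "gW i x = S *\<^sub>R \<sigma> + d *\<^sub>R gh x"
    and "gW j y = S *\<^sub>R ((x - y) /\<^sub>R r\<^sup>2 - K *\<^sub>R gh y) - d *\<^sub>R gh y"
    and "tr (HW i x) \<le> psi2 (\<rho> x y) * (\<rho> x y)\<^sup>2 * (norm \<sigma>)\<^sup>2
      + S * ((norm \<sigma>)\<^sup>2 + (real CARD('n) - 2) / r\<^sup>2 + K * tr (Hh x)) + d * tr (Hh x)"
    and "tr (HW i x) - tr (HW j y) \<le> psi2 (\<rho> x y) * (\<rho> x y)\<^sup>2 * (norm \<tau>)\<^sup>2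
      + S * ((norm \<tau>)\<^sup>2 - 4 / r\<^sup>2 + K * (tr (Hh x) + tr (Hh y))) + d * (tr (Hh x) + tr (Hh y))"
proof -
  have "\<forall>\<^sub>F s in nhds (\<rho> x y). s \<in> {- \<delta> <..< R}"
    using rho0 delta0 rR by (intro eventually_nhds_in_open) auto
  then have 1: "\<forall>\<^sub>F s in nhds (rho K h x y). (psi has_real_derivative psi1 s) (at s)"
    unfolding \<rho>_def by eventually_elim (auto intro: psi_deriv)
  have 2: "(psi1 has_real_derivative psi2 (\<rho> x y)) (at (rho K h x y))"
    using psi1_deriv[of "\<rho> x y"] rho0 delta0 rR by (simp add: \<rho>_def)
  note t = two_point_trace[OF W2[OF x] W2[OF y] h2 h2 xy 1 2 e mx[unfolded Phi_def \<rho>_def],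
      folded \<rho>_def, folded r_def, folded S_def, folded \<sigma>_def, folded \<tau>_def]
  show "gW i x = S *\<^sub>R \<sigma> + d *\<^sub>R gh x" by (rule t(1))
  show "gW j y = S *\<^sub>R ((x - y) /\<^sub>R r\<^sup>2 - K *\<^sub>R gh y) - d *\<^sub>R gh y" by (rule t(2))
  show "tr (HW i x) \<le> psi2 (\<rho> x y) * (\<rho> x y)\<^sup>2 * (norm \<sigma>)\<^sup>2
      + S * ((norm \<sigma>)\<^sup>2 + (real CARD('n) - 2) / r\<^sup>2 + K * tr (Hh x)) + d * tr (Hh x)" by (rule t(3))
  show "tr (HW i x) - tr (HW j y) \<le> psi2 (\<rho> x y) * (\<rho> x y)\<^sup>2 * (norm \<tau>)\<^sup>2
      + S * ((norm \<tau>)\<^sup>2 - 4 / r\<^sup>2 + K * (tr (Hh x) + tr (Hh y))) + d * (tr (Hh x) + tr (Hh y))" by (rule t(4))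
qed

lemma sigma_b: "1 / (2 * r) \<le> norm \<sigma>" "norm \<sigma> \<le> 2 / r"
  using sigma_bounds[OF xc xy] rleR by (auto simp: r_def \<sigma>_def)

text \<open>
  At distances of at least \<open>\<delta>\<close> the equation at \<open>x\<close> alone excludes a maximum.  The gradient there is \<open>S *\<^sub>R \<sigma>\<close> up to a bounded term, and
  the norm \<open>P\<close> of \<open>S *\<^sub>R \<sigma>\<close> is at least \<open>L / 2\<close>; by the equation \<open>d * tr (HW i x)\<close> is at least \<open>P\<^sup>2\<close> up to terms linear in \<open>P\<close>, while the second-order condition bounds it by
  \<open>P\<^sup>2 / 2\<close> up to such terms.
\<close>

lemma no_far_maximum:
  assumes far: "\<delta> \<le> \<rho> x y"
  shows False
proof -
  define N where "N = real CARD('n)"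
  define P where "P = S * norm \<sigma>"
  have N1: "N \<ge> 1" by (simp add: N_def Suc_leI)
  have "0 < 1 / (2 * r)" using r0 by simp
  then have s0: "norm \<sigma> > 0" using sigma_b(1) by (rule less_le_trans)
  have PL: "P \<ge> L / 2"
  proof -
    have "L * r \<le> S"
      unfolding S_def using psi1_ge(2)[of "\<rho> x y"] rho0 rR r_rho r0 L2 by (intro mult_mono) auto
    then have "(L * r) * (1 / (2 * r)) \<le> P"
      unfolding P_def using sigma_b(1) r0 S0 by (intro mult_mono) auto
    then show ?thesis using r0 by simp
  qed
  have P0: "P > 0" using PL L2 by linarith
  let ?p = "gW i x"
  have p: "?p = S *\<^sub>R \<sigma> + d *\<^sub>R gh x" by (rule interior_trace(1))
  have dg: "norm (d *\<^sub>R gh x) \<le> G" using gh_le[OF xc] d0 d1 mult_mono[of d 1 "norm (gh x)" G] by simp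
  have np: "norm ?p \<le> P + G"
    using norm_triangle_ineq[of "S *\<^sub>R \<sigma>" "d *\<^sub>R gh x"] dg S0 by (simp add: p P_def)
  have pp: "?p \<bullet> ?p \<ge> P\<^sup>2 - 2 * P * G"
  proof -
    have "(u + v) \<bullet> (u + v) = u \<bullet> u + 2 * (u \<bullet> v) + v \<bullet> v" for u v :: "real^'n"
      by (simp add: inner_add_left inner_add_right inner_commute)
    then have "?p \<bullet> ?p = (S *\<^sub>R \<sigma>) \<bullet> (S *\<^sub>R \<sigma>) + 2 * ((S *\<^sub>R \<sigma>) \<bullet> (d *\<^sub>R gh x)) + (d *\<^sub>R gh x) \<bullet> (d *\<^sub>R gh x)"
      unfolding p by blast
    moreover have "(S *\<^sub>R \<sigma>) \<bullet> (S *\<^sub>R \<sigma>) = P\<^sup>2"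
      unfolding dot_square_norm by (simp add: P_def power_mult_distrib)
    moreover have "\<bar>(S *\<^sub>R \<sigma>) \<bullet> (d *\<^sub>R gh x)\<bar> \<le> P * G"
    proof -
      have "\<bar>(S *\<^sub>R \<sigma>) \<bullet> (d *\<^sub>R gh x)\<bar> \<le> norm (S *\<^sub>R \<sigma>) * norm (d *\<^sub>R gh x)" by (rule Cauchy_Schwarz_ineq2)
      also have "\<dots> \<le> P * G" using dg S0 by (intro mult_mono) (auto simp: P_def)
      finally show ?thesis .
    qed
    moreover have "0 \<le> (d *\<^sub>R gh x) \<bullet> (d *\<^sub>R gh x)" by (rule inner_ge_zero)
    ultimately show ?thesis by linarith
  qed
  have bp: "b i x \<bullet> ?p \<le> B * (P + G)"
    using b_inner[OF xc, of i ?p] mult_left_mono[OF np B_nonneg] by linarith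
  have Ml: "d * (M x $ i $ i - lam) \<le> Cl"
  proof -
    have "M x $ i $ i - lam \<le> Cl" using M_le[OF xc, of i i] Cl by linarith
    then have "d * (M x $ i $ i - lam) \<le> d * Cl" using d0 by (intro mult_left_mono) auto
    also have "\<dots> \<le> 1 * Cl" using d1 Cl0 by (intro mult_right_mono) auto
    finally show ?thesis by simp
  qed
  have lower: "d * tr (HW i x) \<ge> P\<^sup>2 - 2 * P * G - B * (P + G) - Cl"
    using hj_eq'[OF x, of i] pp bp Ml coupling_nonneg[OF xc, of i] by linarith
  have t: "\<bar>tr (Hh x)\<bar> \<le> N * G" unfolding N_def by (rule tr_Hh[OF xc])
  have u1: "psi2 (\<rho> x y) * (\<rho> x y)\<^sup>2 * (norm \<sigma>)\<^sup>2 \<le> P\<^sup>2 / (L * R)"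
  proof -
    have "psi2 (\<rho> x y) * ((\<rho> x y)\<^sup>2 * (norm \<sigma>)\<^sup>2) \<le> (psi1 (\<rho> x y))\<^sup>2 / (L * R) * ((\<rho> x y)\<^sup>2 * (norm \<sigma>)\<^sup>2)"
      using psi2_le[of "\<rho> x y"] rho0 rR by (intro mult_right_mono) auto
    then show ?thesis by (simp add: P_def S_def power_mult_distrib mult.assoc)
  qed
  have u2: "(norm \<sigma>)\<^sup>2 + (N - 2) / r\<^sup>2 + K * tr (Hh x) \<le> norm \<sigma> * (5 * N / r)"
  proof -
    have "(norm \<sigma>)\<^sup>2 \<le> norm \<sigma> * (2 / r)"
      unfolding power2_eq_square using sigma_b(2) by (intro mult_left_mono) auto
    also have "\<dots> \<le> norm \<sigma> * (2 * N / r)"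
      using N1 r0 by (intro mult_left_mono divide_right_mono) auto
    finally have 1: "(norm \<sigma>)\<^sup>2 \<le> norm \<sigma> * (2 * N / r)" .
    have "(N - 2) / r\<^sup>2 \<le> 1 / (2 * r) * (2 * N / r)"
      using r0 by (simp add: power2_eq_square divide_right_mono)
    also have "\<dots> \<le> norm \<sigma> * (2 * N / r)"
      using sigma_b(1) N1 r0 by (intro mult_right_mono) auto
    finally have 2: "(N - 2) / r\<^sup>2 \<le> norm \<sigma> * (2 * N / r)" .
    have "K * tr (Hh x) \<le> K * (N * G)" using t K0 by (intro mult_left_mono) auto
    also have "\<dots> = (K * G) * N" by simp
    also have "\<dots> \<le> 1 / (4 * r) * N" using K_G_r[OF r0 rleR] N1 by (intro mult_right_mono) auto
    also have "\<dots> \<le> 1 / (2 * r) * (N / r)"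
    proof -
      have "1 / (4 * r) \<le> 1 / (2 * r) * (1 / r)"
        using r0 rleR R1 by (simp add: field_simps)
      then have "1 / (4 * r) * N \<le> 1 / (2 * r) * (1 / r) * N" using N1 by (intro mult_right_mono) auto
      then show ?thesis by simp
    qed
    also have "\<dots> \<le> norm \<sigma> * (N / r)"
      using sigma_b(1) N1 r0 by (intro mult_right_mono) auto
    finally have 3: "K * tr (Hh x) \<le> norm \<sigma> * (N / r)" .
    have "norm \<sigma> * (5 * N / r) = norm \<sigma> * (2 * N / r) + norm \<sigma> * (2 * N / r) + norm \<sigma> * (N / r)"
      using r0 by (simp add: field_simps)
    then show ?thesis using add_mono[OF add_mono[OF 1 2] 3] by (simp only:)
  qed
  have "S * ((norm \<sigma>)\<^sup>2 + (N - 2) / r\<^sup>2 + K * tr (Hh x)) \<le> S * (norm \<sigma> * (5 * N / r))"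
    using u2 S0 by (intro mult_left_mono) auto
  moreover have "d * tr (Hh x) \<le> d * (N * G)" using t d0 by (intro mult_left_mono) auto
  ultimately have "tr (HW i x) \<le> P\<^sup>2 / (L * R) + S * (norm \<sigma> * (5 * N / r)) + d * (N * G)"
    using order_trans[OF interior_trace(3)[folded N_def] add_mono[OF add_mono[OF u1]]] by blast
  then have "tr (HW i x) \<le> P\<^sup>2 / (L * R) + P * (5 * N / r) + d * (N * G)"
    by (simp only: P_def mult.assoc)
  then have "d * tr (HW i x) \<le> d * (P\<^sup>2 / (L * R) + P * (5 * N / r) + d * (N * G))"
    using d0 by (intro mult_left_mono) auto
  also have "\<dots> = d / (L * R) * P\<^sup>2 + P * (5 * N) * (d / r) + d * d * (N * G)"
    by (simp add: algebra_simps)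
  also have "\<dots> \<le> 1 / 2 * P\<^sup>2 + P * (5 * N) * (E / \<eta>) + 1 * (N * G)"
  proof (intro add_mono mult_right_mono mult_left_mono)
    show "d / (L * R) \<le> 1 / 2" using dLR L2 R0 by (simp add: field_simps)
    have "\<eta> * d \<le> E * r" using far r_rho(2) by (simp add: \<delta>_def)
    then show "d / r \<le> E / \<eta>" using r0 eta0 by (simp add: field_simps)
    show "d * d \<le> 1" using d0 d1 by (simp add: mult_le_one)
  qed (use P0 N1 G_nonneg in auto)
  finally have "P\<^sup>2 - 2 * P * G - B * (P + G) - Cl \<le> 1 / 2 * P\<^sup>2 + P * (5 * N) * (E / \<eta>) + 1 * (N * G)"
    using lower by linarith
  then have "P * (P / 2) \<le> P * (2 * G + B + 5 * N * E / \<eta>) + (B * G + Cl + N * G)"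
    by (simp add: power2_eq_square field_simps)
  also have "\<dots> \<le> P * (2 * G + B + 5 * N * E / \<eta>) + P * (B * G + Cl + N * G)"
  proof -
    have "0 \<le> B * G + Cl + N * G" using B_nonneg G_nonneg Cl0 N1 by simp
    then show ?thesis using PL L2 mult_right_mono[of 1 P "B * G + Cl + N * G"] by simp
  qed
  also have "\<dots> = P * (2 * G + B + 5 * N * E / \<eta> + (B * G + Cl + N * G))" by (simp add: algebra_simps)
  finally have "P / 2 \<le> 2 * G + B + 5 * N * E / \<eta> + (B * G + Cl + N * G)" using P0 by simp
  moreover have False if "u / 2 \<le> s + t + v + (w + y + z)" "l / 2 \<le> u" "4 * (s + t + v + w + y + z) + 2 \<le> l"
    for u s t v w y z l :: real using that by (simp add: field_simps)
  ultimately show False using PL L1[folded N_def] by blast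
qed

text \<open>
  At shorter distances the two equations are subtracted.  The gradients at \<open>x\<close> and \<open>y\<close> are bounded and differ by terms of order \<open>d\<close>, so that
  the difference of the right-hand sides is bounded below by a constant, whereas the concavity of \<open>psi\<close> bounds the difference of the
  left-hand sides above by \<open>- L / \<eta>\<close> up to small terms.
\<close>

lemma no_near_maximum:
  assumes near: "\<rho> x y \<le> \<delta>" and opt: "\<And>l. W j y \<le> W l y"
  shows False
proof -
  define N where "N = real CARD('n)"
  define \<Gamma> where "\<Gamma> = 12 * L * E + G"
  have N1: "N \<ge> 1" by (simp add: N_def Suc_leI)
  have r1: "r \<le> 1" using rleR R1 by linarith
  have KG: "K * G \<le> 1 / (4 * r)" by (rule K_G_r[OF r0 rleR])
  have KG0: "0 \<le> K * G" using K0 G_nonneg by simp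
  have Srho: "S \<le> 6 * L * \<rho> x y"
    unfolding S_def using near_bounds(1)[OF less_imp_le[OF rho0] near] rho0 by (intro mult_right_mono) auto
  also have "\<dots> \<le> 6 * L * (E * r)" using r_rho L2 by (intro mult_left_mono) auto
  finally have Sr: "S \<le> 6 * L * E * r" by simp
  have "6 * L * \<rho> x y \<le> 6 * L * \<delta>" using near L2 by (intro mult_left_mono) auto
  then have Sd: "S \<le> 6 * L * \<eta> * d" using Srho by (simp add: \<delta>_def)
  define q where "q = gh x + refl_along (x - y) (gh y)"
  have nq: "norm q \<le> 2 * G"
    unfolding q_def using gh_le[OF xc] gh_le[OF yc] norm_triangle_ineq[of "gh x" "refl_along (x - y) (gh y)"]
    by (simp add: norm_refl_along)
  have tau2: "(norm \<tau>)\<^sup>2 = 4 / r\<^sup>2 + 4 * K / r\<^sup>2 * ((x - y) \<bullet> q) + K\<^sup>2 * (norm q)\<^sup>2"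
  proof -
    have w2: "(x - y) \<bullet> (x - y) = r\<^sup>2" by (simp add: r_def dot_square_norm)
    have "(norm \<tau>)\<^sup>2 = ((2 / r\<^sup>2) *\<^sub>R (x - y) + K *\<^sub>R q) \<bullet> ((2 / r\<^sup>2) *\<^sub>R (x - y) + K *\<^sub>R q)"
      by (simp only: \<tau>_def q_def dot_square_norm)
    also have "\<dots> = (2 / r\<^sup>2) * (2 / r\<^sup>2) * ((x - y) \<bullet> (x - y)) + 2 * (2 / r\<^sup>2 * K * ((x - y) \<bullet> q)) + K * K * (q \<bullet> q)"
    proof -
      have "(u + v) \<bullet> (u + v) = u \<bullet> u + 2 * (u \<bullet> v) + v \<bullet> v" for u v :: "real^'n"
        by (simp add: inner_add_left inner_add_right inner_commute)
      then show ?thesis by (simp only: inner_scaleR_left inner_scaleR_right mult_ac)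
    qed
    also have "\<dots> = 4 / r\<^sup>2 + 4 * K / r\<^sup>2 * ((x - y) \<bullet> q) + K\<^sup>2 * (norm q)\<^sup>2"
      unfolding w2 dot_square_norm[of q] using r0 by (simp add: power2_eq_square)
    finally show ?thesis .
  qed
  have cr: "\<bar>4 * K / r\<^sup>2 * ((x - y) \<bullet> q)\<bar> \<le> 8 * (K * G) / r"
  proof -
    have "\<bar>(x - y) \<bullet> q\<bar> \<le> r * (2 * G)"
      using Cauchy_Schwarz_ineq2[of "x - y" q] mult_left_mono[OF nq less_imp_le[OF r0]] by (simp add: r_def)
    then have "4 * K / r\<^sup>2 * \<bar>(x - y) \<bullet> q\<bar> \<le> 4 * K / r\<^sup>2 * (r * (2 * G))"
      using K0 by (intro mult_left_mono) auto
    also have "\<dots> = 8 * (K * G) / r" using r0 by (simp add: power2_eq_square)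
    finally show ?thesis using K0 by (simp add: abs_mult)
  qed
  have tau_lower: "(norm \<tau>)\<^sup>2 \<ge> 2 / r\<^sup>2"
  proof -
    have "8 * (K * G) / r \<le> 8 * (1 / (4 * r)) / r" using KG r0 by (intro divide_right_mono mult_left_mono) auto
    also have "\<dots> = 2 / r\<^sup>2" by (simp add: power2_eq_square)
    finally have "8 * (K * G) / r \<le> 2 / r\<^sup>2" .
    moreover have "4 / r\<^sup>2 = 2 / r\<^sup>2 + 2 / r\<^sup>2" by simp
    moreover have "0 \<le> K\<^sup>2 * (norm q)\<^sup>2" by simp
    ultimately show ?thesis using cr tau2 by linarith
  qed
  have tau_upper: "(norm \<tau>)\<^sup>2 - 4 / r\<^sup>2 \<le> 9 * (K * G) / r"
  proof -
    have "K\<^sup>2 * (norm q)\<^sup>2 \<le> K\<^sup>2 * (2 * G)\<^sup>2" using nq by (intro mult_left_mono power_mono) auto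
    also have "\<dots> = 4 * (K * G) * (K * G)" by (simp add: power2_eq_square)
    also have "\<dots> \<le> 4 * (K * G) * (1 / (4 * r))" using KG KG0 by (intro mult_left_mono) auto
    also have "\<dots> = (K * G) / r" by simp
    finally have "K\<^sup>2 * (norm q)\<^sup>2 \<le> (K * G) / r" .
    moreover have "9 * (K * G) / r = 8 * (K * G) / r + (K * G) / r" by (simp add: add_divide_distrib[symmetric])
    moreover have "a - f \<le> w" if "a = f + t + s" "\<bar>t\<bar> \<le> u" "s \<le> v" "w = u + v" for a f t s u v w :: real
      using that by linarith
    ultimately show ?thesis using cr tau2 by blast
  qed
  have t: "tr (Hh x) + tr (Hh y) \<le> 2 * (N * G)"
    using tr_Hh[OF xc] tr_Hh[OF yc] unfolding N_def by linarith
  have concave: "d * (psi2 (\<rho> x y) * (\<rho> x y)\<^sup>2 * (norm \<tau>)\<^sup>2) \<le> - L / \<eta>"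
  proof -
    have "2 = r\<^sup>2 * (2 / r\<^sup>2)" using r0 by simp
    also have "\<dots> \<le> (\<rho> x y)\<^sup>2 * (norm \<tau>)\<^sup>2"
      using tau_lower r_rho(1) r0 by (intro mult_mono power_mono) auto
    finally have 2: "2 \<le> (\<rho> x y)\<^sup>2 * (norm \<tau>)\<^sup>2" .
    have "d * psi2 (\<rho> x y) * ((\<rho> x y)\<^sup>2 * (norm \<tau>)\<^sup>2) \<le> - L / (2 * \<eta>) * ((\<rho> x y)\<^sup>2 * (norm \<tau>)\<^sup>2)"
      using near_bounds(2)[OF less_imp_le[OF rho0] near] by (intro mult_right_mono) auto
    also have "\<dots> \<le> - L / (2 * \<eta>) * 2"
      using 2 L2 eta0 by (intro mult_left_mono_neg) (auto simp: divide_nonpos_pos)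
    also have "\<dots> = - L / \<eta>" by simp
    finally show ?thesis by (simp add: mult.assoc)
  qed
  have err: "S * ((norm \<tau>)\<^sup>2 - 4 / r\<^sup>2 + K * (tr (Hh x) + tr (Hh y))) \<le> 66 * L * E * K * N * G"
  proof -
    have "K * (tr (Hh x) + tr (Hh y)) \<le> K * (2 * (N * G))" using t K0 by (intro mult_left_mono) auto
    also have "\<dots> \<le> K * (2 * (N * G)) / r" using r0 r1 K0 N1 G_nonneg
      by (simp add: le_divide_eq mult_left_le)
    also have "\<dots> = 2 * (K * N * G) / r" by simp
    finally have 1: "K * (tr (Hh x) + tr (Hh y)) \<le> 2 * (K * N * G) / r" .
    have "K * G * 1 \<le> K * G * N" using KG0 N1 by (intro mult_left_mono) auto
    then have "9 * (K * G) / r \<le> 9 * (K * N * G) / r" using r0 by (intro divide_right_mono) (auto simp: mult_ac)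
    with 1 tau_upper have "(norm \<tau>)\<^sup>2 - 4 / r\<^sup>2 + K * (tr (Hh x) + tr (Hh y)) \<le> 9 * (K * N * G) / r + 2 * (K * N * G) / r"
      by linarith
    also have "\<dots> = 11 * (K * N * G) / r" by (simp add: add_divide_distrib[symmetric])
    finally have "S * ((norm \<tau>)\<^sup>2 - 4 / r\<^sup>2 + K * (tr (Hh x) + tr (Hh y))) \<le> S * (11 * (K * N * G) / r)"
      using S0 by (intro mult_left_mono) auto
    also have "\<dots> \<le> (6 * L * E * r) * (11 * (K * N * G) / r)"
      using Sr K0 N1 G_nonneg r0 by (intro mult_right_mono) auto
    also have "\<dots> = 66 * L * E * K * N * G" using r0 by simp
    finally show ?thesis .
  qed
  have "d * (tr (Hh x) + tr (Hh y)) \<le> 1 * (2 * (N * G))"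
  proof -
    have "d * (tr (Hh x) + tr (Hh y)) \<le> d * (2 * (N * G))" using t d0 by (intro mult_left_mono) auto
    also have "\<dots> \<le> 1 * (2 * (N * G))" using d1 N1 G_nonneg by (intro mult_right_mono) auto
    finally show ?thesis .
  qed
  then have "tr (HW i x) - tr (HW j y) \<le> psi2 (\<rho> x y) * (\<rho> x y)\<^sup>2 * (norm \<tau>)\<^sup>2 + (66 * L * E * K * N * G + 2 * N * G)"
    using interior_trace(4) err by linarith
  then have "d * (tr (HW i x) - tr (HW j y)) \<le> d * (psi2 (\<rho> x y) * (\<rho> x y)\<^sup>2 * (norm \<tau>)\<^sup>2 + (66 * L * E * K * N * G + 2 * N * G))"
    using d0 by (intro mult_left_mono) auto
  then have upper: "d * tr (HW i x) - d * tr (HW j y) \<le> - L / \<eta> + d * (66 * L * E * K * N * G + 2 * N * G)"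
    using concave unfolding distrib_left right_diff_distrib by linarith
  let ?p = "gW i x" and ?q = "gW j y"
  let ?s = "(x - y) /\<^sub>R r\<^sup>2 - K *\<^sub>R gh y"
  have dg: "norm (d *\<^sub>R gh z) \<le> G" if "z \<in> closure \<Omega>" for z
    using gh_le[OF that] d0 d1 mult_mono[of d 1 "norm (gh z)" G] by simp
  have S2r: "S * (2 / r) \<le> 12 * L * E"
    using mult_right_mono[OF Sr, of "2 / r"] r0 by simp
  have np: "norm ?p \<le> \<Gamma>"
  proof -
    have "norm ?p \<le> norm (S *\<^sub>R \<sigma>) + norm (d *\<^sub>R gh x)" unfolding interior_trace(1) by (rule norm_triangle_ineq)
    moreover have "norm (S *\<^sub>R \<sigma>) \<le> S * (2 / r)" using sigma_b(2) S0 by (simp add: mult_left_mono del: times_divide_eq_right)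
    ultimately show ?thesis using S2r dg[OF xc] unfolding \<Gamma>_def by linarith
  qed
  have nq': "norm ?q \<le> \<Gamma>"
  proof -
    have "norm ?q \<le> norm (S *\<^sub>R ?s) + norm (d *\<^sub>R gh y)" unfolding interior_trace(2) by (rule norm_triangle_ineq4)
    moreover have "norm ?s \<le> 2 / r" using sigma_bounds(3)[OF yc xy] rleR by (simp add: r_def)
    then have "norm (S *\<^sub>R ?s) \<le> S * (2 / r)" using S0 by (simp add: mult_left_mono del: times_divide_eq_right)
    ultimately show ?thesis using S2r dg[OF yc] unfolding \<Gamma>_def by linarith
  qed
  have npq: "norm (?p - ?q) \<le> d * (6 * L * K * \<eta> + 1) * (2 * G)"
  proof -
    have "?p - ?q = (S * K + d) *\<^sub>R (gh x + gh y)"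
      unfolding interior_trace(1,2) \<sigma>_def by (simp add: algebra_simps)
    then have "norm (?p - ?q) = (S * K + d) * norm (gh x + gh y)" using S0 K0 d0 by simp
    also have "\<dots> \<le> (6 * L * \<eta> * d * K + d) * (2 * G)"
    proof (intro mult_mono)
      show "S * K + d \<le> 6 * L * \<eta> * d * K + d" using mult_right_mono[OF Sd K0] by simp
      show "norm (gh x + gh y) \<le> 2 * G" using norm_triangle_ineq[of "gh x" "gh y"] gh_le[OF xc] gh_le[OF yc] by linarith
      show "0 \<le> 6 * L * \<eta> * d * K + d" using L2 eta0 d0 K0 by simp
    qed simp
    also have "\<dots> = d * (6 * L * K * \<eta> + 1) * (2 * G)" by (simp add: algebra_simps)
    finally show ?thesis .
  qed
  have "u \<bullet> u - v \<bullet> v = (u - v) \<bullet> (u + v)" for u v :: "real^'n"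
    by (simp add: inner_diff_left inner_add_right inner_commute[of v u])
  then have "?p \<bullet> ?p - ?q \<bullet> ?q = (?p - ?q) \<bullet> (?p + ?q)" .
  moreover have "\<bar>(?p - ?q) \<bullet> (?p + ?q)\<bar> \<le> d * (6 * L * K * \<eta> + 1) * (2 * G) * (2 * \<Gamma>)"
  proof -
    have "\<bar>(?p - ?q) \<bullet> (?p + ?q)\<bar> \<le> norm (?p - ?q) * norm (?p + ?q)" by (rule Cauchy_Schwarz_ineq2)
    also have "\<dots> \<le> (d * (6 * L * K * \<eta> + 1) * (2 * G)) * (2 * \<Gamma>)"
    proof (intro mult_mono npq)
      show "norm (?p + ?q) \<le> 2 * \<Gamma>" using norm_triangle_ineq[of ?p ?q] np nq' by linarith
      show "0 \<le> d * (6 * L * K * \<eta> + 1) * (2 * G)" using npq norm_ge_zero order_trans by blast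
    qed simp
    finally show ?thesis by simp
  qed
  ultimately have e1: "?p \<bullet> ?p - ?q \<bullet> ?q \<ge> - (d * (4 * G * (6 * L * K * \<eta> + 1) * \<Gamma>))"
    by (simp add: algebra_simps)
  have e2: "b i x \<bullet> ?p \<le> B * \<Gamma>" "- (b j y \<bullet> ?q) \<le> B * \<Gamma>"
    using b_inner[OF xc, of i ?p] b_inner[OF yc, of j ?q] mult_left_mono[OF np B_nonneg] mult_left_mono[OF nq' B_nonneg]
    by linarith+
  have e3: "coupling i x \<ge> 0" "coupling j y \<le> d * (real CARD('m) * Mb)"
    using coupling_nonneg[OF xc] coupling_le[OF yc] opt by auto
  have "M x $ i $ i - M y $ j $ j \<le> 2 * Mb" using M_le[OF xc, of i i] M_le[OF yc, of j j] by linarith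
  then have e4: "d * (M x $ i $ i - M y $ j $ j) \<le> d * (2 * Mb)" using d0 by (intro mult_left_mono) auto
  have "d * tr (HW i x) - d * tr (HW j y) \<ge> - (d * (4 * G * (6 * L * K * \<eta> + 1) * \<Gamma>)) - 2 * (B * \<Gamma>)
      - d * (real CARD('m) * Mb) - d * (2 * Mb)"
    using hj_eq'[OF x, of i] hj_eq'[OF y, of j] e1 e2 e3 e4 unfolding right_diff_distrib by linarith
  with upper have "L / \<eta> \<le> 2 * (B * \<Gamma>) + d * (66 * L * E * K * N * G + 2 * N * G
        + 4 * G * (6 * L * K * \<eta> + 1) * \<Gamma> + (real CARD('m) + 2) * Mb)"
    by (simp add: algebra_simps)
  also have "\<dots> \<le> 2 * (B * \<Gamma>) + 1" using d2 unfolding N_def \<Gamma>_def by (simp add: algebra_simps)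
  also have "\<dots> = 24 * B * L * E + 2 * B * G + 1" by (simp add: \<Gamma>_def algebra_simps)
  finally have 1: "L / \<eta> \<le> 24 * B * L * E + 2 * B * G + 1" .
  have "L * (24 * B * E + 2 * B * G + 2) \<le> L * (1 / \<eta>)" using eta1 L2 by (intro mult_left_mono) auto
  moreover have "2 * B * G \<le> L * (2 * B * G)" using L2 B_nonneg G_nonneg mult_right_mono[of 1 L "2 * B * G"] by simp
  ultimately have "24 * B * L * E + 2 * B * G + 2 * L \<le> L / \<eta>" by (simp add: algebra_simps)
  with 1 L2 show False by linarith
qed

end

text \<open>
  On the diagonal the weighted distance is not differentiable, and only displacements of both points by the same vector are used for the second-order
  condition.  The gradients are bounded because \<open>psi \<circ> \<rho>\<close> is Lipschitz, and since the gap between the two components is at least \<open>sqrt d\<close>, the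
  coupling of the \<open>i\<close>-th equation exceeds everything else.
\<close>

lemma no_diagonal_maximum:
  assumes z: "z \<in> \<Omega>" and e: "e > 0" and pos: "Phi i j z z > 0"
    and mx: "\<And>x' y'. x' \<in> ball z e \<Longrightarrow> y' \<in> ball z e \<Longrightarrow> Phi i j x' y' \<le> Phi i j z z"
    and opt: "\<And>l. W j z \<le> W l z"
  shows False
proof -
  define N where "N = real CARD('n)"
  define \<Gamma> where "\<Gamma> = 6 * L * E + G"
  have N1: "N \<ge> 1" by (simp add: N_def Suc_leI)
  have zc: "z \<in> closure \<Omega>" using z in_cl by auto
  have rz: "\<rho> y y = 0" for y by (simp add: \<rho>_def rho_def)
  have p0: "psi 0 = sqrt d" by (simp add: psi_def)
  have gap: "W i z - W j z \<ge> sqrt d"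
  proof -
    have "0 \<le> d * (h z + h z)" using h_nonneg[OF zc] d0 by simp
    then show ?thesis using pos by (simp add: Phi_def rz p0)
  qed
  then have ij: "i \<noteq> j" using d0 by (auto simp: not_le)
  have td: "twice_diff_at (\<lambda>y. W i y + (-1) * W j y) (\<lambda>y. gW i y + (-1) *\<^sub>R gW j y) (\<lambda>y v. HW i y v + (-1) *\<^sub>R HW j y v) z"
    by (intro twice_diff_at_add twice_diff_at_cmult W2 z)
  have "W i y + (-1) * W j y - (2 * d) * h y \<le> W i z + (-1) * W j z - (2 * d) * h z" if "y \<in> ball z e" for y
    using mx[OF that that] by (simp add: Phi_def rz algebra_simps)
  from one_point_max(2)[OF td twice_diff_at_cmult[OF h2] e this]
  have "tr (HW i z) - tr (HW j z) \<le> 2 * d * tr (Hh z)"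
    using tr_scaleR[of "-1" "HW j z"] unfolding tr_add tr_scaleR by simp
  also have "\<dots> \<le> 2 * d * (N * G)" using tr_Hh[OF zc] d0 unfolding N_def by (intro mult_left_mono) auto
  also have "\<dots> \<le> 2 * 1 * (N * G)" using d1 N1 G_nonneg by (intro mult_right_mono) auto
  finally have "tr (HW i z) - tr (HW j z) \<le> 2 * N * G" by simp
  then have "d * (tr (HW i z) - tr (HW j z)) \<le> d * (2 * N * G)" using d0 by (intro mult_left_mono) auto
  also have "\<dots> \<le> 1 * (2 * N * G)" using d1 N1 G_nonneg by (intro mult_right_mono) auto
  finally have upper: "d * tr (HW i z) - d * tr (HW j z) \<le> 2 * N * G" by (simp add: right_diff_distrib)
  obtain e' where e': "e' > 0" "e' \<le> e" "ball z e' \<subseteq> \<Omega>" "E * e' \<le> R / 2"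
  proof -
    obtain e1 where e1: "e1 > 0" "ball z e1 \<subseteq> \<Omega>" using open_dom z open_contains_ball by blast
    show thesis
    proof (rule that[of "min e (min e1 (R / (2 * E)))"])
      have "E * min e (min e1 (R / (2 * E))) \<le> E * (R / (2 * E))"
        using E1 by (intro mult_left_mono) auto
      then show "E * min e (min e1 (R / (2 * E))) \<le> R / 2" using E1 by simp
      show "ball z (min e (min e1 (R / (2 * E)))) \<subseteq> \<Omega>" using e1(2) by auto
    qed (use e e1 R0 E1 in auto)
  qed
  have psi_small: "psi (\<rho> y z) \<le> sqrt d + 6 * L * E * norm (y - z)" if "y \<in> ball z e'" for y
  proof -
    have yc: "y \<in> closure \<Omega>" using that e'(3) in_cl by auto
    have "norm (y - z) \<le> e'" using that by (simp add: dist_norm norm_minus_commute)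
    then have "E * norm (y - z) \<le> E * e'" using E1 by (intro mult_left_mono) auto
    then have "\<rho> y z \<le> R / 2" using rho_bounds(2)[OF yc zc] e'(4) by linarith
    then have "psi (\<rho> y z) \<le> sqrt d + 6 * L * \<rho> y z" using psi_upper rho_bounds(3)[OF yc zc] by blast
    also have "6 * L * \<rho> y z \<le> 6 * L * (E * norm (y - z))"
      using rho_bounds(2)[OF yc zc] L2 by (intro mult_left_mono) auto
    finally show ?thesis by simp
  qed
  have grad_bound: "norm g \<le> \<Gamma>"
    if f: "(f has_derivative (\<lambda>v. g \<bullet> v)) (at z)"
      and le: "\<And>y. y \<in> ball z e' \<Longrightarrow> f y - d * h y - 6 * L * E * norm (y - z) \<le> f z - d * h z" for f g
  proof -
    \<comment> \<open>The derivative of \<open>f - d h\<close> along its gradient \<open>?k\<close> is \<open>?k \<bullet> ?k\<close>.\<close>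
    let ?k = "g - d *\<^sub>R gh z"
    have D: "((\<lambda>y. f y - d * h y) has_derivative (\<lambda>v. ?k \<bullet> v)) (at z)"
      using has_derivative_diff[OF f has_derivative_mult_right[OF twice_diff_at_DERIV[OF h2]], of d]
      by (simp add: inner_diff_left)
    have "?k \<bullet> ?k \<le> 6 * L * E * norm ?k"
    proof (rule ccontr)
      assume neg: "\<not> ?thesis"
      define F where "F t = f (z + t *\<^sub>R ?k) - d * h (z + t *\<^sub>R ?k) - t * (6 * L * E * norm ?k)" for t
      have D': "((\<lambda>y. f y - d * h y) has_derivative (\<lambda>v. ?k \<bullet> v)) (at (z + 0 *\<^sub>R ?k))" using D by simp
      have "((\<lambda>t. z + t *\<^sub>R ?k) has_derivative (\<lambda>s. s *\<^sub>R ?k)) (at 0)"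
        by (auto intro!: derivative_eq_intros)
      from has_derivative_compose[OF this D']
      have "((\<lambda>t. f (z + t *\<^sub>R ?k) - d * h (z + t *\<^sub>R ?k)) has_real_derivative ?k \<bullet> ?k) (at 0)"
        by (simp add: has_field_derivative_def mult_commute_abs)
      from DERIV_diff[OF this DERIV_cmult_right[OF DERIV_ident]]
      have "(F has_real_derivative (?k \<bullet> ?k - 1 * (6 * L * E * norm ?k))) (at 0)"
        unfolding F_def[abs_def] .
      from DERIV_pos_inc_right[OF this] neg
      obtain r where r: "r > 0" "\<And>t. 0 < t \<Longrightarrow> t < r \<Longrightarrow> F 0 < F t" by auto
      define t where "t = min r (e' / (norm ?k + 1)) / 2"
      have kk: "norm ?k + 1 > 0" by (simp add: add_nonneg_pos)
      have t0: "t > 0" "t < r" using r e' kk by (auto simp: t_def)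
      have "t \<le> e' / (norm ?k + 1) / 2" unfolding t_def by (intro divide_right_mono) auto
      moreover have "0 < e' / (norm ?k + 1)" using e' kk by simp
      moreover have "u < X" if "u \<le> X / 2" "0 < X" for u X :: real using that by linarith
      ultimately have "t < e' / (norm ?k + 1)" by blast
      then have "t * (norm ?k + 1) < e'" using kk by (simp add: less_divide_eq)
      then have "t * norm ?k < e'" using t0 by (simp add: algebra_simps)
      then have b: "z + t *\<^sub>R ?k \<in> ball z e'" using t0 by (simp add: dist_norm)
      have "F t \<le> F 0" using le[OF b] t0 by (simp add: F_def mult_ac)
      then show False using r(2)[OF t0] by simp
    qed
    then have "norm ?k * norm ?k \<le> 6 * L * E * norm ?k" by (simp add: dot_square_norm power2_eq_square)
    then have "norm ?k \<le> 6 * L * E" using L2 E1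
      by (cases "norm ?k = 0") (auto dest: mult_right_le_imp_le)
    moreover have "norm g \<le> norm ?k + norm (d *\<^sub>R gh z)" using norm_triangle_ineq[of ?k "d *\<^sub>R gh z"] by simp
    moreover have "norm (d *\<^sub>R gh z) \<le> G" using gh_le[OF zc] d0 d1 mult_mono[of d 1 "norm (gh z)" G] by simp
    ultimately show ?thesis unfolding \<Gamma>_def by linarith
  qed
  have gi: "norm (gW i z) \<le> \<Gamma>"
  proof (rule grad_bound)
    show "(W i has_derivative (\<lambda>v. gW i z \<bullet> v)) (at z)" by (rule twice_diff_at_DERIV[OF W2[OF z]])
    fix y assume y: "y \<in> ball z e'"
    have "Phi i j y z \<le> Phi i j z z" using y e' e by (intro mx) auto
    then show "W i y - d * h y - 6 * L * E * norm (y - z) \<le> W i z - d * h z"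
      using psi_small[OF y] by (simp add: Phi_def rz p0 algebra_simps)
  qed
  have gj: "norm (- gW j z) \<le> \<Gamma>"
  proof (rule grad_bound)
    show "((\<lambda>y. - W j y) has_derivative (\<lambda>v. (- gW j z) \<bullet> v)) (at z)"
      using has_derivative_minus[OF twice_diff_at_DERIV[OF W2[OF z]]] by simp
    fix y assume y: "y \<in> ball z e'"
    have "Phi i j z y \<le> Phi i j z z" using y e' e by (intro mx) auto
    moreover have "\<rho> z y = \<rho> y z" unfolding \<rho>_def by (rule rho_commute)
    ultimately show "- W j y - d * h y - 6 * L * E * norm (y - z) \<le> - W j z - d * h z"
      using psi_small[OF y] by (simp add: Phi_def rz p0 algebra_simps)
  qed
  have gj': "norm (gW j z) \<le> \<Gamma>" using gj by simp
  have e1: "gW j z \<bullet> gW j z \<le> \<Gamma>\<^sup>2" using gj' by (simp add: dot_square_norm power_mono)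
  have e2: "b i z \<bullet> gW i z \<le> B * \<Gamma>" "- (b j z \<bullet> gW j z) \<le> B * \<Gamma>"
    using b_inner[OF zc, of i "gW i z"] b_inner[OF zc, of j "gW j z"]
      mult_left_mono[OF gi B_nonneg] mult_left_mono[OF gj' B_nonneg] by linarith+
  have e3: "coupling j z \<le> d * (real CARD('m) * Mb)" using coupling_le[OF zc] opt by auto
  have "d * (real CARD('m) * Mb) \<le> 1 * (real CARD('m) * Mb)" using d1 Mb_nonneg by (intro mult_right_mono) auto
  with e3 have e3: "coupling j z \<le> real CARD('m) * Mb" by linarith
  have "M z $ i $ i - M z $ j $ j \<le> 2 * Mb" using M_le[OF zc, of i i] M_le[OF zc, of j j] by linarith
  then have "d * (M z $ i $ i - M z $ j $ j) \<le> d * (2 * Mb)" using d0 by (intro mult_left_mono) auto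
  also have "\<dots> \<le> 1 * (2 * Mb)" using d1 Mb_nonneg by (intro mult_right_mono) auto
  finally have e4: "d * (M z $ i $ i) - d * (M z $ j $ j) \<le> 2 * Mb" by (simp add: right_diff_distrib)
  have "1 / sqrt d = sqrt d / d" using d0 by (simp add: real_div_sqrt field_simps)
  also have "\<dots> \<le> (W i z - W j z) / d" using gap d0 by (intro divide_right_mono) auto
  finally have "d * (c * exp (1 / sqrt d)) \<le> d * (c * exp ((W i z - W j z) / d))"
    using d0 c0 by (intro mult_left_mono) auto
  also have "\<dots> \<le> coupling i z" by (rule coupling_ge[OF zc ij])
  finally have e5: "d * c * exp (1 / sqrt d) \<le> coupling i z" by simp
  have "0 \<le> gW i z \<bullet> gW i z" by simp
  then have "d * c * exp (1 / sqrt d) \<le> \<Gamma>\<^sup>2 + 2 * (B * \<Gamma>) + real CARD('m) * Mb + 2 * Mb + 2 * N * G"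
    using hj_eq'[OF z, of i] hj_eq'[OF z, of j] e1 e2 e3 e4 e5 upper unfolding right_diff_distrib by linarith
  then show False using d3 unfolding N_def \<Gamma>_def by linarith
qed

theorem two_point_estimate:
  assumes x0: "x0 \<in> closure \<Omega>" and y0: "y0 \<in> closure \<Omega>" and r: "\<rho> x0 y0 < R"
  shows "W i0 x0 - W j0 y0 \<le> psi (\<rho> x0 y0) + d * (h x0 + h y0)"
proof (rule ccontr)
  assume "\<not> ?thesis"
  then have pos0: "Phi i0 j0 x0 y0 > 0" by (simp add: Phi_def)
  obtain V where V: "V > 0" "\<And>i j x y. x \<in> closure \<Omega> \<Longrightarrow> y \<in> closure \<Omega> \<Longrightarrow> W i x - W j y \<le> V"
  proof -
    have "\<exists>C. \<forall>x\<in>closure \<Omega>. \<bar>W i x\<bar> \<le> C" for i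
      using compact_imp_bounded[OF compact_continuous_image[OF W_cont compact_cl, of i]]
      by (auto simp: bounded_iff)
    then obtain C where C: "\<And>i x. x \<in> closure \<Omega> \<Longrightarrow> \<bar>W i x\<bar> \<le> C i" by metis
    have "C i \<le> Max (range C)" for i by simp
    then have "\<bar>W i x\<bar> \<le> Max (range C)" if "x \<in> closure \<Omega>" for i x using C[OF that] order_trans by blast
    then have *: "\<bar>W i x\<bar> \<le> \<bar>Max (range C)\<bar>" if "x \<in> closure \<Omega>" for i x using that order_trans abs_ge_self by blast
    show thesis
    proof (rule that[of "2 * \<bar>Max (range C)\<bar> + 1"])
      fix i j x y assume "x \<in> closure \<Omega>" "y \<in> closure \<Omega>"
      then show "W i x - W j y \<le> 2 * \<bar>Max (range C)\<bar> + 1" using *[of x i] *[of y j] by linarith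
    qed auto
  qed
  \<comment> \<open>Beyond this radius \<open>psi\<close> is at least as large as all differences \<open>W i x - W j y\<close>, so that a positive maximum
    lies at a smaller weighted distance.\<close>
  define R' where "R' = R * (1 - exp (- V / (L * R)))"
  have LR: "L * R > 0" using L2 R0 by simp
  have ex: "exp (- V / (L * R)) < 1" using V LR by simp
  have R': "0 < R'" "R' < R" using ex R0 by (auto simp: R'_def)
  have outer: "W i x - W j y \<le> psi (\<rho> x y)"
    if "x \<in> closure \<Omega>" "y \<in> closure \<Omega>" "R' \<le> \<rho> x y" "\<rho> x y < R" for i j x y
  proof -
    have "1 - \<rho> x y / R \<le> exp (- V / (L * R))" using that(3) R0 by (simp add: R'_def field_simps)
    moreover have p: "0 < 1 - \<rho> x y / R" using that(4) R0 by simp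
    ultimately have "ln (1 - \<rho> x y / R) \<le> - V / (L * R)" by (metis exp_gt_zero ln_exp ln_le_cancel_iff)
    then have "L * R * ln (1 - \<rho> x y / R) \<le> L * R * (- V / (L * R))" using LR by (intro mult_left_mono) auto
    moreover have "L * R * (- V / (L * R)) = - V" using L2 R0 by simp
    ultimately have "V \<le> - (L * R * ln (1 - \<rho> x y / R))" by linarith
    moreover have "0 \<le> sqrt d" using d0 by simp
    ultimately have "V \<le> psi (\<rho> x y)"
      using psi_lower(1)[OF rho_bounds(3)[OF that(1,2)] that(4)] by linarith
    then show ?thesis using V(2)[OF that(1,2), of i j] by linarith
  qed
  have dh: "0 \<le> d * (h x + h y)" if "x \<in> closure \<Omega>" "y \<in> closure \<Omega>" for x y
    using that h_nonneg d0 by simp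
  let ?C = "{z \<in> closure \<Omega> \<times> closure \<Omega>. \<rho> (fst z) (snd z) \<le> R'}"
  have crho: "continuous_on T (\<lambda>z. \<rho> (fst z) (snd z))" for T
    unfolding \<rho>_def rho_def
    by (intro continuous_intros continuous_on_compose2[OF h_cont[of UNIV]]) auto
  have cC: "compact ?C"
  proof -
    have "closed ((\<lambda>z. \<rho> (fst z) (snd z)) -` {..R'})"
      using crho[of UNIV] by (intro closed_vimage) (auto simp: continuous_on_eq_continuous_at)
    then have "compact ((closure \<Omega> \<times> closure \<Omega>) \<inter> ((\<lambda>z. \<rho> (fst z) (snd z)) -` {..R'}))"
      using compact_cl by (intro compact_Int_closed compact_Times)
    moreover have "?C = (closure \<Omega> \<times> closure \<Omega>) \<inter> ((\<lambda>z. \<rho> (fst z) (snd z)) -` {..R'})" by auto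
    ultimately show ?thesis by simp
  qed
  have in0: "(x0, y0) \<in> ?C"
  proof (rule ccontr)
    assume "(x0, y0) \<notin> ?C"
    then have "R' \<le> \<rho> x0 y0" using x0 y0 by auto
    from outer[OF x0 y0 this r, of i0 j0] dh[OF x0 y0] pos0 show False by (simp add: Phi_def)
  qed
  have cPhi: "continuous_on ?C (\<lambda>z. Phi (fst k) (snd k) (fst z) (snd z))" for k
  proof -
    have cpsi: "continuous_on {- \<delta> <..< R} psi"
      using psi_deriv by (intro continuous_at_imp_continuous_on ballI DERIV_isCont) auto
    have "continuous_on ?C (\<lambda>z. psi (\<rho> (fst z) (snd z)))"
    proof (rule continuous_on_compose2[OF cpsi crho])
      show "(\<lambda>z. \<rho> (fst z) (snd z)) ` ?C \<subseteq> {- \<delta> <..< R}"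
      proof
        fix s assume "s \<in> (\<lambda>z. \<rho> (fst z) (snd z)) ` ?C"
        then obtain x y where "x \<in> closure \<Omega>" "y \<in> closure \<Omega>" "s = \<rho> x y" "\<rho> x y \<le> R'" by auto
        then show "s \<in> {- \<delta> <..< R}" using rho_bounds(3)[of x y] R' delta0 by auto
      qed
    qed
    then show ?thesis unfolding Phi_def
      by (intro continuous_intros continuous_on_compose2[OF W_cont] continuous_on_compose2[OF h_cont[of UNIV]]) auto
  qed
  have Cne: "?C \<noteq> {}" using in0 by blast
  have "\<exists>k\<in>UNIV. \<exists>z\<in>?C. \<forall>k'\<in>UNIV. \<forall>z'\<in>?C.
      Phi (fst k') (snd k') (fst z') (snd z') \<le> Phi (fst k) (snd k) (fst z) (snd z)"
    using finite_family_attains_sup[OF finite UNIV_not_empty cC Cne cPhi, of "\<lambda>k. k"] by simp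
  then obtain i j x y where C: "(x, y) \<in> ?C"
    and M: "\<And>k l x' y'. (x', y') \<in> ?C \<Longrightarrow> Phi k l x' y' \<le> Phi i j x y"
    by (metis (no_types, lifting) UNIV_I fst_conv prod.collapse snd_conv)
  have xc: "x \<in> closure \<Omega>" and yc: "y \<in> closure \<Omega>" using C by auto
  have pos: "Phi i j x y > 0" using M[OF in0, of i0 j0] pos0 by linarith
  have rR': "\<rho> x y < R'"
  proof (rule ccontr)
    assume "\<not> ?thesis"
    then have "R' \<le> \<rho> x y" "\<rho> x y < R" using C R' by auto
    from outer[OF xc yc this, of i j] dh[OF xc yc] pos show False by (simp add: Phi_def)
  qed
  then have rR: "\<rho> x y < R" using R' by linarith
  obtain e where e: "e > 0" "\<And>x' y'. x' \<in> ball x e \<Longrightarrow> y' \<in> ball y e \<Longrightarrow> \<rho> x' y' < R'"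
  proof -
    have "open ((\<lambda>z. \<rho> (fst z) (snd z)) -` {..<R'})"
      using crho[of UNIV] by (intro open_vimage) (auto simp: continuous_on_eq_continuous_at)
    then obtain A A' where "open A" "open A'" "x \<in> A" "y \<in> A'"
      and sub: "A \<times> A' \<subseteq> (\<lambda>z. \<rho> (fst z) (snd z)) -` {..<R'}"
      using rR' by (auto elim!: open_prod_elim[of _ "(x, y)"])
    obtain e1 where e1: "e1 > 0" "ball x e1 \<subseteq> A" using \<open>open A\<close> \<open>x \<in> A\<close> open_contains_ball by blast
    obtain e2 where e2: "e2 > 0" "ball y e2 \<subseteq> A'" using \<open>open A'\<close> \<open>y \<in> A'\<close> open_contains_ball by blast
    show thesis
    proof (rule that[of "min e1 e2"])
      fix x' y' assume "x' \<in> ball x (min e1 e2)" "y' \<in> ball y (min e1 e2)"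
      then have "(x', y') \<in> A \<times> A'" using e1 e2 by auto
      with sub have "(x', y') \<in> (\<lambda>z. \<rho> (fst z) (snd z)) -` {..<R'}" by (rule subsetD)
      then show "\<rho> x' y' < R'" by simp
    qed (use e1 e2 in simp)
  qed
  have mx: "Phi i j x' y' \<le> Phi i j x y"
    if "x' \<in> closure \<Omega>" "y' \<in> closure \<Omega>" "x' \<in> ball x e" "y' \<in> ball y e" for x' y'
    using M[of x' y' i j] e(2)[of x' y'] that by auto
  \<comment> \<open>Maximality over the second index.\<close>
  have opt: "W j y \<le> W l y" for l using M[OF C, of i l] by (simp add: Phi_def)
  have xO: "x \<in> \<Omega>" if "x \<noteq> y"
  proof (rule ccontr)
    assume "x \<notin> \<Omega>"
    then have xf: "x \<in> frontier \<Omega>" using cl_cases xc by auto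
    show False
    proof (rule frontier_excluded[OF xf yc that rR e(1) W1[OF xc] neumann[OF xf], of i])
      fix z assume "z \<in> closure \<Omega>" "z \<in> ball x e"
      then have "Phi i j z y \<le> Phi i j x y" using yc e(1) by (intro mx) auto
      then show "W i z - (psi (\<rho> z y) + d * (h z + h y)) \<le> W i x - (psi (\<rho> x y) + d * (h x + h y))"
        by (simp add: Phi_def)
    qed
  qed
  have yO: "y \<in> \<Omega>" if "x \<noteq> y"
  proof (rule ccontr)
    assume "y \<notin> \<Omega>"
    then have yf: "y \<in> frontier \<Omega>" using cl_cases yc by auto
    have sw: "\<rho> z x = \<rho> x z" for z unfolding \<rho>_def by (rule rho_commute)
    have D: "((\<lambda>z. - W j z) has_derivative (\<lambda>v. (- gW j y) \<bullet> v)) (at y within closure \<Omega>)"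
      using has_derivative_minus[OF W1[OF yc, of j]] by simp
    have n0: "(- gW j y) \<bullet> \<nu> y = 0" using neumann[OF yf] by simp
    show False
    proof (rule frontier_excluded[OF yf xc that[symmetric] _ e(1) D n0])
      show "\<rho> y x < R" using rR by (simp add: sw)
      fix z assume "z \<in> closure \<Omega>" "z \<in> ball y e"
      then have "Phi i j x z \<le> Phi i j x y" using xc e(1) by (intro mx) auto
      then show "- W j z - (psi (\<rho> z x) + d * (h z + h x)) \<le> - W j y - (psi (\<rho> y x) + d * (h y + h x))"
        by (simp add: Phi_def sw algebra_simps)
    qed
  qed
  show False
  proof (cases "x = y")
    case False
    note O = xO[OF False] yO[OF False]
    obtain e' where e': "e' > 0" "e' \<le> e" "ball x e' \<subseteq> \<Omega>" "ball y e' \<subseteq> \<Omega>"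
    proof -
      obtain e1 where "e1 > 0" "ball x e1 \<subseteq> \<Omega>" using open_dom O open_contains_ball by blast
      moreover obtain e2 where "e2 > 0" "ball y e2 \<subseteq> \<Omega>" using open_dom O open_contains_ball by blast
      ultimately show thesis using e(1) by (intro that[of "min e (min e1 e2)"]) auto
    qed
    have mx': "Phi i j x' y' \<le> Phi i j x y" if "x' \<in> ball x e'" "y' \<in> ball y e'" for x' y'
      using that e' in_cl by (intro mx) auto
    show False
    proof (cases "\<delta> \<le> \<rho> x y")
      case True
      from no_far_maximum[OF O False rR e'(1) mx' True] show False by blast
    next
      case near: False
      from no_near_maximum[OF O False rR e'(1) mx' _ opt] near show False by fastforce
    qed
  next
    case True
    have zO: "x \<in> \<Omega>"
    proof (rule ccontr)
      assume "x \<notin> \<Omega>"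
      then have xf: "x \<in> frontier \<Omega>" using cl_cases xc by auto
      have D: "((\<lambda>z. W i z - W j z - 2 * d * h z) has_derivative
          (\<lambda>v. gW i x \<bullet> v - gW j x \<bullet> v - 2 * d * (gh x \<bullet> v))) (at x within closure \<Omega>)"
        by (intro has_derivative_diff has_derivative_mult_right W1 xc h_deriv)
      have "gW i x \<bullet> \<nu> x - gW j x \<bullet> \<nu> x - 2 * d * (gh x \<bullet> \<nu> x) \<ge> 0"
      proof (rule frontier_max[OF xf D e(1)])
        fix z assume "z \<in> closure \<Omega>" "z \<in> ball x e"
        then have "Phi i j z z \<le> Phi i j x x" using mx[of z z] True by simp
        then show "W i z - W j z - 2 * d * h z \<le> W i x - W j x - 2 * d * h x"
          by (simp add: Phi_def \<rho>_def rho_def algebra_simps)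
      qed
      then have "2 * d * (gh x \<bullet> \<nu> x) \<le> 0" using neumann[OF xf] by simp
      moreover have "2 * d * (gh x \<bullet> \<nu> x) > 0" using gh_nu[OF xf] d0 by (intro mult_pos_pos) auto
      ultimately show False by simp
    qed
    obtain e' where e': "e' > 0" "e' \<le> e" "ball x e' \<subseteq> \<Omega>"
    proof -
      obtain e1 where "e1 > 0" "ball x e1 \<subseteq> \<Omega>" using open_dom zO open_contains_ball by blast
      then show thesis using e(1) by (intro that[of "min e e1"]) auto
    qed
    show False
    proof (rule no_diagonal_maximum[OF zO e'(1), of i j])
      show "Phi i j x x > 0" using pos True by simp
      show "Phi i j x' y' \<le> Phi i j x x" if "x' \<in> ball x e'" "y' \<in> ball x e'" for x' y'
      proof -
        have "x' \<in> \<Omega>" "y' \<in> \<Omega>" using that e'(3) by auto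
        then show ?thesis using that e'(2) in_cl True mx[of x' y'] by auto
      qed
      show "W j x \<le> W l x" for l using opt True by simp
    qed
  qed
qed

corollary local_lipschitz_estimate:
  assumes x: "x \<in> closure \<Omega>" and y: "y \<in> closure \<Omega>" and r: "E * norm (x - y) \<le> R / 2"
  shows "W i x - W j y \<le> sqrt d + 2 * d * Hm + 6 * L * E * norm (x - y)"
proof -
  have rho: "\<rho> x y \<le> R / 2" using rho_bounds(2)[OF x y] r by linarith
  then have "W i x - W j y \<le> psi (\<rho> x y) + d * (h x + h y)"
    using R0 by (intro two_point_estimate x y) auto
  moreover have "psi (\<rho> x y) \<le> sqrt d + 6 * L * \<rho> x y" by (rule psi_upper[OF rho_bounds(3)[OF x y] rho])
  moreover have "6 * L * \<rho> x y \<le> 6 * L * (E * norm (x - y))"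
    using rho_bounds(2)[OF x y] L2 by (intro mult_left_mono) auto
  moreover have "d * (h x + h y) \<le> d * (Hm + Hm)" using h_le x y d0 by (intro mult_left_mono add_mono) auto
  ultimately show ?thesis by (simp add: algebra_simps)
qed

end

section \<open>Weak-star limits and Lipschitz functions in $W^{1,\infty}$\<close>

text \<open>
  Tychonoff's theorem for uniformly bounded set functions.  The product need not be metrizable, so that the convergence is along a filter finer
  than the sequential one instead of a subsequence.
\<close>
lemma bounded_set_functions_cluster:
  fixes \<Lambda> :: "nat \<Rightarrow> 'a \<Rightarrow> real"
  assumes "\<And>n A. \<Lambda> n A \<in> {0..c A}"
  obtains F lm where "F \<noteq> bot" "F \<le> sequentially" "\<And>A. ((\<lambda>n. \<Lambda> n A) \<longlongrightarrow> lm A) F"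
proof -
  let ?K = "PiE UNIV (\<lambda>A. {0..c A})"
  have "compactin (product_topology (\<lambda>_. euclidean) UNIV) ?K"
    by (simp add: compactin_PiE)
  then have K: "compact ?K" by (simp add: euclidean_product_topology)
  let ?F = "filtermap \<Lambda> sequentially"
  have "?F \<noteq> bot" by (simp add: filtermap_bot_iff)
  moreover have "eventually (\<lambda>x. x \<in> ?K) ?F" using assms by (simp add: eventually_filtermap PiE_def Pi_def)
  ultimately obtain lm where l: "inf (nhds lm) ?F \<noteq> bot" using K unfolding compact_filter by blast
  define F where "F = inf (filtercomap \<Lambda> (nhds lm)) sequentially"
  have "F \<noteq> bot"
  proof
    assume "F = bot"
    then have "eventually (\<lambda>_. False) F" by simp
    then obtain P Q where PQ: "eventually P (filtercomap \<Lambda> (nhds lm))" "eventually Q sequentially" "\<And>x. P x \<Longrightarrow> Q x \<Longrightarrow> False"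
      unfolding F_def eventually_inf by auto
    then obtain P' where P': "eventually P' (nhds lm)" "\<And>n. P' (\<Lambda> n) \<Longrightarrow> P n"
      by (auto simp: eventually_filtercomap)
    have "eventually (\<lambda>x. \<not> P' x) ?F" unfolding eventually_filtermap
      using PQ(2) by eventually_elim (use PQ(3) P'(2) in blast)
    with P'(1) have "eventually (\<lambda>_. False) (inf (nhds lm) ?F)"
      unfolding eventually_inf by (intro exI conjI) auto
    with l show False by (simp add: trivial_limit_def)
  qed
  moreover have "((\<lambda>n. \<Lambda> n A) \<longlongrightarrow> lm A) F" for A
  proof -
    have "filterlim \<Lambda> (nhds lm) F" unfolding F_def
      by (rule filterlim_mono[OF filterlim_filtercomap order_refl inf.cobounded1])
    moreover have "continuous_on UNIV (\<lambda>x::'a \<Rightarrow> real. x A)"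
      by (rule continuous_on_product_coordinates)
    then have "((\<lambda>x. x A) \<longlongrightarrow> lm A) (at lm)"
      unfolding continuous_on_def by auto
    then have "((\<lambda>x. x A) \<longlongrightarrow> lm A) (nhds lm)"
      using tendsto_at_iff_tendsto_nhds[of "\<lambda>x. x A" lm] by blast
    ultimately show ?thesis by (rule filterlim_compose[rotated])
  qed
  ultimately show thesis by (intro that[of F lm]) (auto simp: F_def)
qed

lemma (in finite_measure) integrable_bounded:
  fixes f :: "'a \<Rightarrow> real"
  assumes "f \<in> borel_measurable M" "\<And>x. x \<in> space M \<Longrightarrow> \<bar>f x\<bar> \<le> C"
  shows "integrable M f"
  by (rule integrable_const_bound[of _ C]) (use assms in auto)

lemma (in finite_measure) integral_abs_bound:
  fixes f :: "'a \<Rightarrow> real"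
  assumes "f \<in> borel_measurable M" "\<And>x. x \<in> space M \<Longrightarrow> \<bar>f x\<bar> \<le> C"
  shows "\<bar>\<integral>x. f x \<partial>M\<bar> \<le> C * measure M (space M)"
proof -
  have "\<bar>\<integral>x. f x \<partial>M\<bar> \<le> (\<integral>x. \<bar>f x\<bar> \<partial>M)" by (rule integral_abs_bound)
  also have "\<dots> \<le> (\<integral>x. C \<partial>M)"
    using integrable_bounded[OF assms] assms by (intro integral_mono) auto
  finally show ?thesis by (simp add: mult.commute)
qed

text \<open>
  A bounded measurable function is uniformly approximated by the simple function \<open>e * \<lfloor>\<eta> / e\<rfloor>\<close>.
\<close>
lemma (in finite_measure) bounded_uniform_simple:
  fixes \<eta> :: "'a \<Rightarrow> real" and e :: real
  assumes m: "\<eta> \<in> borel_measurable M" and b: "\<And>x. x \<in> space M \<Longrightarrow> \<bar>\<eta> x\<bar> \<le> B" and e: "e > 0"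
  obtains N :: "int set" and A :: "int \<Rightarrow> 'a set" where "finite N" "\<And>k. A k \<in> sets M"
    "\<And>x. x \<in> space M \<Longrightarrow> \<bar>\<eta> x - (\<Sum>k\<in>N. e * k * indicator (A k) x)\<bar> \<le> e"
proof -
  define A where "A k = {x \<in> space M. \<lfloor>\<eta> x / e\<rfloor> = k}" for k
  define N where "N = {- \<lceil>B / e\<rceil> - 1 .. \<lceil>B / e\<rceil> + 1}"
  show thesis
  proof (rule that[of N A])
    show "finite N" by (simp add: N_def)
    show "A k \<in> sets M" for k unfolding A_def using m by measurable
    fix x assume x: "x \<in> space M"
    let ?k = "\<lfloor>\<eta> x / e\<rfloor>"
    have "\<eta> x / e \<le> B / e" "(- B) / e \<le> \<eta> x / e"
      using b[OF x] e by (intro divide_right_mono; linarith)+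
    then have "?k \<in> N" unfolding N_def atLeastAtMost_iff by (simp add: le_floor_iff) linarith
    moreover have "e * k * indicator (A k) x = (if k = ?k then e * k else 0)" for k
      using x by (auto simp: A_def)
    ultimately have "(\<Sum>k\<in>N. e * k * indicator (A k) x) = e * ?k"
      by (simp add: N_def)
    moreover have "e * ?k \<le> \<eta> x" "\<eta> x \<le> e * ?k + e"
    proof -
      have "?k \<le> \<eta> x / e" "\<eta> x / e \<le> ?k + 1" by linarith+
      then have "?k * e \<le> \<eta> x" "\<eta> x \<le> (?k + 1) * e"
        by (simp_all only: pos_le_divide_eq[OF e] pos_divide_le_eq[OF e])
      then show "e * ?k \<le> \<eta> x" "\<eta> x \<le> e * ?k + e" by (simp_all add: algebra_simps)
    qed
    ultimately show "\<bar>\<eta> x - (\<Sum>k\<in>N. e * k * indicator (A k) x)\<bar> \<le> e" by simp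
  qed
qed

text \<open>
  The limit set function of the integrals \<open>\<integral>\<^sub>A f n\<close> is additive and is dominated by a multiple of the measure, hence it is countably additive and
  has a bounded Radon--Nikodym density.
\<close>
lemma (in finite_measure) weak_star_cluster_nonneg:
  fixes f :: "nat \<Rightarrow> 'a \<Rightarrow> real"
  assumes m[measurable]: "\<And>n. f n \<in> borel_measurable M"
    and b: "\<And>n x. x \<in> space M \<Longrightarrow> 0 \<le> f n x" "\<And>n x. x \<in> space M \<Longrightarrow> f n x \<le> C" and C: "C \<ge> 0"
  obtains F g where "F \<noteq> bot" "F \<le> sequentially" "g \<in> borel_measurable M" "\<And>x. 0 \<le> g x" "\<And>x. g x \<le> C"
    "\<And>\<eta> B. \<eta> \<in> borel_measurable M \<Longrightarrow> (\<And>x. x \<in> space M \<Longrightarrow> \<bar>\<eta> x\<bar> \<le> B) \<Longrightarrow>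
      ((\<lambda>n. \<integral>x. f n x * \<eta> x \<partial>M) \<longlongrightarrow> (\<integral>x. g x * \<eta> x \<partial>M)) F"
proof -
  define \<Lambda> where "\<Lambda> n A = (if A \<in> sets M then \<integral>x. f n x * indicator A x \<partial>M else 0)" for n A
  have int: "integrable M (\<lambda>x. f n x * indicator A x)" if "A \<in> sets M" for n A
    by (rule integrable_bounded[of _ C]) (use that b C in \<open>auto simp: indicator_def\<close>)
  have L: "\<Lambda> n A \<in> {0..C * measure M A}" for n A
  proof (cases "A \<in> sets M")
    case True
    have "(\<integral>x. f n x * indicator A x \<partial>M) \<le> (\<integral>x. C * indicator A x \<partial>M)"
    proof (rule integral_mono[OF int[OF True]])
      show "integrable M (\<lambda>x. C * indicator A x)"
        by (rule integrable_bounded[of _ C]) (use True C in \<open>auto simp: indicator_def\<close>)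
    qed (use b in \<open>auto simp: indicator_def\<close>)
    moreover have "0 \<le> (\<integral>x. f n x * indicator A x \<partial>M)"
      using b by (intro integral_nonneg_AE AE_I2) auto
    ultimately show ?thesis using True by (simp add: \<Lambda>_def)
  qed (use C in \<open>simp add: \<Lambda>_def\<close>)
  obtain F lm where F: "F \<noteq> bot" "F \<le> sequentially" and lim: "\<And>A. ((\<lambda>n. \<Lambda> n A) \<longlongrightarrow> lm A) F"
    using bounded_set_functions_cluster[of \<Lambda> "\<lambda>A. C * measure M A"] L by metis
  have lb: "0 \<le> lm A" "lm A \<le> C * measure M A" for A
    using tendsto_lowerbound[OF lim _ F(1)] tendsto_upperbound[OF lim _ F(1)] L by (auto simp: always_eventually)
  have add: "lm (A \<union> A') = lm A + lm A'" if "A \<in> sets M" "A' \<in> sets M" "A \<inter> A' = {}" for A A'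
  proof -
    have "\<Lambda> n (A \<union> A') = \<Lambda> n A + \<Lambda> n A'" for n
    proof -
      have "(\<integral>x. f n x * indicator (A \<union> A') x \<partial>M) = (\<integral>x. f n x * indicator A x + f n x * indicator A' x \<partial>M)"
        using that(3) by (intro Bochner_Integration.integral_cong refl) (auto simp: indicator_def)
      then show ?thesis using that int by (simp add: \<Lambda>_def)
    qed
    then have "((\<lambda>n. \<Lambda> n (A \<union> A')) \<longlongrightarrow> lm A + lm A') F" by (simp add: tendsto_add lim)
    then show ?thesis using tendsto_unique[OF F(1) lim] by blast
  qed
  define N where "N = measure_of (space M) (sets M) (\<lambda>A. ennreal (lm A))"
  have l0: "lm {} = 0" using lb[of "{}"] by simp
  have "countably_additive (sets M) (\<lambda>A. ennreal (lm A))"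
  proof (rule sets.empty_continuous_imp_countably_additive)
    show "positive (sets M) (\<lambda>A. ennreal (lm A))" by (simp add: positive_def l0)
    show "additive (sets M) (\<lambda>A. ennreal (lm A))"
      using add lb by (simp add: additive_def ennreal_plus[symmetric] del: ennreal_plus)
    show "\<forall>A\<in>sets M. ennreal (lm A) \<noteq> \<infinity>" by simp
    fix A :: "nat \<Rightarrow> 'a set" assume A: "range A \<subseteq> sets M" "decseq A" "(\<Inter>i. A i) = {}"
    have "(\<lambda>i. measure M (A i)) \<longlonglongrightarrow> measure M (\<Inter>i. A i)"
      by (rule finite_Lim_measure_decseq[OF A(1,2)])
    then have "(\<lambda>i. C * measure M (A i)) \<longlonglongrightarrow> C * 0" unfolding A(3) by (intro tendsto_intros) simp
    then have "(\<lambda>i. C * measure M (A i)) \<longlonglongrightarrow> 0" by simp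
    note up = this
    have "(\<lambda>i. lm (A i)) \<longlonglongrightarrow> 0"
      by (rule tendsto_sandwich[OF always_eventually always_eventually tendsto_const up]) (use lb in auto)
    then show "(\<lambda>i. ennreal (lm (A i))) \<longlonglongrightarrow> 0" using tendsto_ennrealI by fastforce
  qed
  then have eN: "emeasure N A = ennreal (lm A)" if "A \<in> sets M" for A
    unfolding N_def using that
    by (intro emeasure_measure_of_sigma) (auto simp: positive_def l0 sets.sigma_algebra_axioms)
  have sN: "sets N = sets M" by (simp add: N_def)
  have "absolutely_continuous M N"
  proof (unfold absolutely_continuous_def, rule subsetI)
    fix A assume "A \<in> null_sets M"
    then have A: "A \<in> sets M" "measure M A = 0" by (auto simp: measure_def)
    then have "lm A = 0" using lb[of A] by simp
    then show "A \<in> null_sets N" using A sN by (simp add: null_sets_def eN)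
  qed
  from Radon_Nikodym[OF this sN] obtain g0 where g0[measurable]: "g0 \<in> borel_measurable M" and dN: "density M g0 = N" by auto
  have g0A: "(\<integral>\<^sup>+x. g0 x * indicator A x \<partial>M) = ennreal (lm A)" if "A \<in> sets M" for A
    using that eN dN by (metis emeasure_density g0)
  have "AE x in M. g0 x \<le> ennreal C"
  proof -
    let ?A = "{x \<in> space M. ennreal C < g0 x}"
    have A: "?A \<in> sets M" by measurable
    have "(\<integral>\<^sup>+x. (g0 x - ennreal C) * indicator ?A x \<partial>M)
        = (\<integral>\<^sup>+x. g0 x * indicator ?A x - ennreal C * indicator ?A x \<partial>M)"
      by (intro nn_integral_cong) (auto simp: indicator_def)
    also have "\<dots> = (\<integral>\<^sup>+x. g0 x * indicator ?A x \<partial>M) - (\<integral>\<^sup>+x. ennreal C * indicator ?A x \<partial>M)"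
    proof (rule nn_integral_diff)
      show "(\<integral>\<^sup>+x. ennreal C * indicator ?A x \<partial>M) \<noteq> \<infinity>"
        unfolding nn_integral_cmult_indicator[OF A] by (simp add: ennreal_mult_eq_top_iff emeasure_eq_measure)
    qed (use A in \<open>auto simp: indicator_def\<close>)
    also have "\<dots> = ennreal (lm ?A) - ennreal C * emeasure M ?A"
      using A by (simp add: g0A nn_integral_cmult_indicator)
    also have "\<dots> = ennreal (lm ?A) - ennreal (C * measure M ?A)"
      using C by (simp add: emeasure_eq_measure ennreal_mult)
    also have "\<dots> = 0" using lb(2)[of ?A] C by (subst ennreal_minus) (auto intro!: ennreal_neg)
    finally have "AE x in M. (g0 x - ennreal C) * indicator ?A x = 0"
      using A by (subst (asm) nn_integral_0_iff_AE) auto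
    then show ?thesis
    proof (rule AE_mp, intro AE_I2 impI)
      fix x assume x: "x \<in> space M" "(g0 x - ennreal C) * indicator ?A x = 0"
      show "g0 x \<le> ennreal C"
      proof (rule ccontr)
        assume n: "\<not> ?thesis"
        then have "x \<in> ?A" using x by auto
        with x have "g0 x - ennreal C = 0" by simp
        with n show False by (simp add: diff_eq_0_iff_ennreal)
      qed
    qed
  qed
  define g where "g x = min C (enn2real (g0 x))" for x
  have gm[measurable]: "g \<in> borel_measurable M" unfolding g_def by measurable
  have gb: "0 \<le> g x" "g x \<le> C" for x using C by (auto simp: g_def)
  have gg0: "AE x in M. ennreal (g x) = g0 x"
    using \<open>AE x in M. g0 x \<le> ennreal C\<close>
  proof (rule AE_mp, intro AE_I2 impI)
    fix x assume le: "g0 x \<le> ennreal C"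
    then have fin: "g0 x < top" by (metis ennreal_less_top le_less_trans)
    have "enn2real (g0 x) \<le> C" using le C by (metis enn2real_ennreal enn2real_mono ennreal_less_top)
    then show "ennreal (g x) = g0 x" using fin by (simp add: g_def min_def)
  qed
  have gA: "(\<integral>x. g x * indicator A x \<partial>M) = lm A" if A: "A \<in> sets M" for A
  proof (rule integral_eq_nn_integral[THEN trans])
    have "(\<integral>\<^sup>+x. ennreal (g x * indicator A x) \<partial>M) = (\<integral>\<^sup>+x. g0 x * indicator A x \<partial>M)"
      using gg0 by (intro nn_integral_cong_AE) (auto simp: indicator_def)
    then show "enn2real (\<integral>\<^sup>+x. ennreal (g x * indicator A x) \<partial>M) = lm A" using lb by (simp add: g0A[OF A])
  qed (use A gb in auto)
  show thesis
  proof (rule that[OF F gm gb])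
    fix \<eta> :: "'a \<Rightarrow> real" and B assume em[measurable]: "\<eta> \<in> borel_measurable M" and eb: "\<And>x. x \<in> space M \<Longrightarrow> \<bar>\<eta> x\<bar> \<le> B"
    define V where "V = measure M (space M)"
    show "((\<lambda>n. \<integral>x. f n x * \<eta> x \<partial>M) \<longlongrightarrow> (\<integral>x. g x * \<eta> x \<partial>M)) F"
    proof (rule tendstoI)
      fix e :: real assume e: "e > 0"
      define e' where "e' = e / (4 * (C * V + 1))"
      have V0: "V \<ge> 0" "C * V \<ge> 0" using C by (auto simp: V_def)
      then have e': "e' > 0" using e by (simp add: e'_def add_nonneg_pos)
      have small: "C * e' * V < e / 3"
      proof -
        have "C * e' * V = e * ((C * V) / (4 * (C * V + 1)))" by (simp add: e'_def)
        also have "\<dots> \<le> e * (1 / 4)" using e V0 by (intro mult_left_mono) (auto simp: divide_le_eq add_nonneg_pos)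
        also have "\<dots> < e / 3" using e by simp
        finally show ?thesis .
      qed
      obtain N :: "int set" and A where N: "finite N" and A: "\<And>k. A k \<in> sets M"
        and ap: "\<And>x. x \<in> space M \<Longrightarrow> \<bar>\<eta> x - (\<Sum>k\<in>N. e' * k * indicator (A k) x)\<bar> \<le> e'"
        by (rule bounded_uniform_simple[OF em eb e']) (assumption, rule that)
      define s where "s x = (\<Sum>k\<in>N. e' * k * indicator (A k) x)" for x
      have sm[measurable]: "s \<in> borel_measurable M" unfolding s_def using A by measurable
      have ap': "\<bar>\<eta> x - s x\<bar> \<le> e'" if "x \<in> space M" for x using ap[OF that] by (simp add: s_def)
      have sb: "\<bar>s x\<bar> \<le> B + e'" if "x \<in> space M" for x using ap[OF that] eb[OF that] unfolding s_def by linarith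
      have close: "\<bar>(\<integral>x. q x * \<eta> x \<partial>M) - (\<integral>x. q x * s x \<partial>M)\<bar> \<le> C * e' * V"
        if qm[measurable]: "q \<in> borel_measurable M" and qb: "\<And>x. x \<in> space M \<Longrightarrow> \<bar>q x\<bar> \<le> C" for q
      proof -
        have i1: "integrable M (\<lambda>x. q x * \<eta> x)"
          by (rule integrable_bounded[of _ "C * B"]) (use qb eb C in \<open>auto simp: abs_mult intro!: mult_mono\<close>)
        have i2: "integrable M (\<lambda>x. q x * s x)"
          by (rule integrable_bounded[of _ "C * (B + e')"]) (use qb sb C in \<open>auto simp: abs_mult intro!: mult_mono\<close>)
        have "(\<integral>x. q x * \<eta> x \<partial>M) - (\<integral>x. q x * s x \<partial>M) = (\<integral>x. q x * (\<eta> x - s x) \<partial>M)"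
          using i1 i2 by (simp add: right_diff_distrib)
        also have "\<bar>\<dots>\<bar> \<le> (C * e') * V" unfolding V_def
          by (rule integral_abs_bound) (use qb ap' C in \<open>auto simp: abs_mult intro!: mult_mono\<close>)
        finally show ?thesis .
      qed
      have simp_int: "(\<integral>x. q x * s x \<partial>M) = (\<Sum>k\<in>N. e' * k * (\<integral>x. q x * indicator (A k) x \<partial>M))"
        if qm[measurable]: "q \<in> borel_measurable M" and qb: "\<And>x. x \<in> space M \<Longrightarrow> \<bar>q x\<bar> \<le> C" for q
      proof -
        have i: "integrable M (\<lambda>x. q x * indicator (A k) x)" for k
          by (rule integrable_bounded[of _ C]) (use qb A C in \<open>auto simp: indicator_def\<close>)
        have "(\<integral>x. q x * s x \<partial>M) = (\<integral>x. (\<Sum>k\<in>N. e' * k * (q x * indicator (A k) x)) \<partial>M)"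
          by (intro Bochner_Integration.integral_cong refl) (simp add: s_def sum_distrib_left mult_ac)
        also have "\<dots> = (\<Sum>k\<in>N. (\<integral>x. e' * k * (q x * indicator (A k) x) \<partial>M))"
          using i by (intro Bochner_Integration.integral_sum integrable_mult_right)
        finally show ?thesis by simp
      qed
      have fb: "\<bar>f n x\<bar> \<le> C" if "x \<in> space M" for n x using b[OF that, of n] by simp
      have gb': "\<bar>g x\<bar> \<le> C" for x using gb[of x] by simp
      have "((\<lambda>n. \<Sum>k\<in>N. e' * k * \<Lambda> n (A k)) \<longlongrightarrow> (\<Sum>k\<in>N. e' * k * lm (A k))) F"
        by (intro tendsto_intros lim)
      then have "((\<lambda>n. \<integral>x. f n x * s x \<partial>M) \<longlongrightarrow> (\<integral>x. g x * s x \<partial>M)) F"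
        using A by (simp add: simp_int[OF m fb] simp_int[OF gm gb'] gA \<Lambda>_def)
      from tendstoD[OF this, of "e / 3"] e
      have "\<forall>\<^sub>F n in F. dist (\<integral>x. f n x * s x \<partial>M) (\<integral>x. g x * s x \<partial>M) < e / 3" by simp
      then show "\<forall>\<^sub>F n in F. dist (\<integral>x. f n x * \<eta> x \<partial>M) (\<integral>x. g x * \<eta> x \<partial>M) < e"
      proof eventually_elim
        case (elim n)
        show ?case using elim close[OF m fb, of n] close[OF gm gb'] small unfolding dist_real_def by linarith
      qed
    qed
  qed
qed

text \<open>
  A weak-star cluster point of a bounded sequence, in a form that does not mention filters: integrals which converge along the whole
  sequence converge to the integral of the cluster point.
\<close>
lemma (in finite_measure) weak_star_cluster:
  fixes f :: "nat \<Rightarrow> 'a \<Rightarrow> real"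
  assumes m[measurable]: "\<And>n. f n \<in> borel_measurable M"
    and b: "\<And>n x. x \<in> space M \<Longrightarrow> \<bar>f n x\<bar> \<le> C" and C: "C \<ge> 0"
  obtains g where "g \<in> borel_measurable M" "\<And>x. \<bar>g x\<bar> \<le> C"
    "\<And>\<eta> B l. \<eta> \<in> borel_measurable M \<Longrightarrow> (\<And>x. x \<in> space M \<Longrightarrow> \<bar>\<eta> x\<bar> \<le> B) \<Longrightarrow>
      (\<lambda>n. \<integral>x. f n x * \<eta> x \<partial>M) \<longlonglongrightarrow> l \<Longrightarrow> (\<integral>x. g x * \<eta> x \<partial>M) = l"
proof -
  obtain F g where F: "F \<noteq> bot" "F \<le> sequentially" and gm[measurable]: "g \<in> borel_measurable M"
    and gb: "\<And>x. 0 \<le> g x" "\<And>x. g x \<le> 2 * C"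
    and lim: "\<And>\<eta> B. \<eta> \<in> borel_measurable M \<Longrightarrow> (\<And>x. x \<in> space M \<Longrightarrow> \<bar>\<eta> x\<bar> \<le> B) \<Longrightarrow>
      ((\<lambda>n. \<integral>x. (f n x + C) * \<eta> x \<partial>M) \<longlongrightarrow> (\<integral>x. g x * \<eta> x \<partial>M)) F"
  proof (rule weak_star_cluster_nonneg[of "\<lambda>n x. f n x + C" "2 * C"])
    show "(\<lambda>x. f n x + C) \<in> borel_measurable M" for n by measurable
    show "0 \<le> f n x + C" "f n x + C \<le> 2 * C" if "x \<in> space M" for n x using b[OF that, of n] by auto
  qed (use C in auto)
  show thesis
  proof (rule that[of "\<lambda>x. g x - C"])
    show "(\<lambda>x. g x - C) \<in> borel_measurable M" by measurable
    show "\<bar>g x - C\<bar> \<le> C" for x using gb[of x] by auto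
    fix \<eta> :: "'a \<Rightarrow> real" and B l assume em[measurable]: "\<eta> \<in> borel_measurable M" and eb: "\<And>x. x \<in> space M \<Longrightarrow> \<bar>\<eta> x\<bar> \<le> B"
      and l: "(\<lambda>n. \<integral>x. f n x * \<eta> x \<partial>M) \<longlonglongrightarrow> l"
    have ie: "integrable M \<eta>" by (rule integrable_bounded[OF em eb])
    have i1: "integrable M (\<lambda>x. f n x * \<eta> x)" for n
      by (rule integrable_bounded[of _ "C * B"]) (use b eb C in \<open>auto simp: abs_mult intro!: mult_mono\<close>)
    have i2: "integrable M (\<lambda>x. g x * \<eta> x)"
    proof (rule integrable_bounded[of _ "2 * C * B"])
      show "\<bar>g x * \<eta> x\<bar> \<le> 2 * C * B" if "x \<in> space M" for x
        unfolding abs_mult using gb[of x] eb[OF that] C by (intro mult_mono) auto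
    qed measurable
    have "((\<lambda>n. (\<integral>x. f n x * \<eta> x \<partial>M) + C * (\<integral>x. \<eta> x \<partial>M)) \<longlongrightarrow> l + C * (\<integral>x. \<eta> x \<partial>M)) F"
      by (intro tendsto_add tendsto_const tendsto_mono[OF F(2) l])
    moreover have "(\<integral>x. (f n x + C) * \<eta> x \<partial>M) = (\<integral>x. f n x * \<eta> x \<partial>M) + C * (\<integral>x. \<eta> x \<partial>M)" for n
      using i1 ie by (simp add: distrib_right)
    ultimately have "((\<lambda>n. \<integral>x. (f n x + C) * \<eta> x \<partial>M) \<longlongrightarrow> l + C * (\<integral>x. \<eta> x \<partial>M)) F" by simp
    from tendsto_unique[OF F(1) this lim[OF em eb]]
    have "(\<integral>x. g x * \<eta> x \<partial>M) = l + C * (\<integral>x. \<eta> x \<partial>M)" by simp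
    then show "(\<integral>x. (g x - C) * \<eta> x \<partial>M) = l" using i2 ie by (simp add: left_diff_distrib)
  qed
qed

lemma lborel_integral_translate:
  fixes f :: "'a::euclidean_space \<Rightarrow> real"
  assumes [measurable]: "f \<in> borel_measurable borel"
  shows "(\<integral>x. f (c + x) \<partial>lborel) = (\<integral>x. f x \<partial>lborel)"
proof -
  have "(\<integral>x. f x \<partial>lborel) = (\<integral>x. f x \<partial>distr lborel borel ((+) c))" by (simp add: lborel_distr_plus)
  also have "\<dots> = (\<integral>x. f (c + x) \<partial>lborel)" by (rule integral_distr) auto
  finally show ?thesis by simp
qed

lemma lborel_integrable_bounded_support:
  fixes f :: "'a::euclidean_space \<Rightarrow> real"
  assumes [measurable]: "f \<in> borel_measurable borel" and b: "\<And>x. \<bar>f x\<bar> \<le> C"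
    and s: "\<And>x. x \<notin> cball 0 R \<Longrightarrow> f x = 0"
  shows "integrable lborel f"
proof (rule Bochner_Integration.integrable_bound)
  show "integrable lborel (\<lambda>x. C * indicator (cball (0::'a) R) x :: real)"
    using emeasure_bounded_finite[OF bounded_cball[of "0::'a" R]] by (intro integrable_mult_right integrable_real_indicator) auto
  show "AE x in lborel. norm (f x) \<le> norm (C * indicator (cball 0 R) x :: real)"
  proof (rule AE_I2)
    fix x show "norm (f x) \<le> norm (C * indicator (cball 0 R) x :: real)"
      using b[of x] s[of x] by (cases "x \<in> cball 0 R") auto
  qed
qed auto

lemma C1_line:
  assumes "Ck_on 1 UNIV \<eta>"
  shows "((\<lambda>t. \<eta> (y + t *\<^sub>R axis k 1)) has_real_derivative pd UNIV k \<eta> (y + t *\<^sub>R axis k 1)) (at t)"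
proof -
  have d: "(\<eta> has_derivative frechet_derivative \<eta> (at z)) (at z)" for z
    using assms by (simp add: frechet_derivative_works[symmetric] differentiable_on_def)
  have "((\<lambda>t. y + t *\<^sub>R axis k 1) has_derivative (\<lambda>s. s *\<^sub>R axis k 1)) (at t)"
    by (auto intro!: derivative_eq_intros)
  from has_derivative_compose[OF this d]
  have "((\<lambda>t. \<eta> (y + t *\<^sub>R axis k 1)) has_derivative
      (\<lambda>s. frechet_derivative \<eta> (at (y + t *\<^sub>R axis k 1)) (s *\<^sub>R axis k 1))) (at t)" .
  then show ?thesis unfolding has_field_derivative_def
    by (rule has_derivative_eq_rhs)
      (simp add: fun_eq_iff pd_def linear_cmul[OF has_derivative_linear[OF d]] mult.commute)
qed

text \<open>The difference quotients of a Lipschitz function are bounded, and any weak-star limit of them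
  is a weak derivative.\<close>

lemma lipschitz_W1_infinity:
  fixes \<Omega> :: "(real^'n::finite) set" and W :: "real^'n \<Rightarrow> real"
  assumes O: "open \<Omega>" "bounded \<Omega>" and Wb: "\<And>x. x \<in> \<Omega> \<Longrightarrow> \<bar>W x\<bar> \<le> B" and B0: "B \<ge> 0"
    and lip: "\<And>x y. x \<in> \<Omega> \<Longrightarrow> y \<in> \<Omega> \<Longrightarrow> \<bar>W x - W y\<bar> \<le> C * norm (x - y)" and C0: "C \<ge> 0"
  shows "W1_infinity \<Omega> W"
proof -
  have Wc: "continuous_on \<Omega> W"
  proof (rule continuous_onI)
    fix x e assume x: "x \<in> \<Omega>" and e: "(e::real) > 0"
    have "dist (W y) (W x) \<le> e" if "y \<in> \<Omega>" "dist y x < e / (C + 1)" for y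
    proof -
      have "\<bar>W y - W x\<bar> \<le> C * norm (y - x)" using lip that x by blast
      also have "\<dots> \<le> (C + 1) * norm (y - x)" by (intro mult_right_mono) auto
      also have "\<dots> \<le> (C + 1) * (e / (C + 1))" using that C0 by (intro mult_left_mono) (auto simp: dist_norm)
      also have "\<dots> = e" using C0 by simp
      finally show ?thesis by (simp add: dist_real_def)
    qed
    then show "\<exists>d>0. \<forall>y\<in>\<Omega>. dist y x < d \<longrightarrow> dist (W y) (W x) \<le> e"
      using e C0 by (intro exI[of _ "e / (C + 1)"]) auto
  qed
  have Ob: "\<Omega> \<in> sets borel" and Ol: "\<Omega> \<in> sets lebesgue" using O by auto
  define W0 where "W0 x = indicator \<Omega> x * W x" for x
  have W0m[measurable]: "W0 \<in> borel_measurable borel"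
    using borel_measurable_continuous_on_indicator[OF Ob Wc] by (simp add: W0_def[abs_def])
  have W0b: "\<bar>W0 x\<bar> \<le> B" for x using Wb[of x] B0 by (simp add: W0_def indicator_def)
  obtain R where "\<forall>x\<in>\<Omega>. norm x \<le> R" using O(2) by (auto simp: bounded_iff)
  then have R: "\<Omega> \<subseteq> cball 0 R" by auto
  interpret fm: finite_measure "lebesgue_on \<Omega>"
  proof
    have "emeasure lborel \<Omega> < \<infinity>" by (rule emeasure_bounded_finite[OF O(2)])
    then show "emeasure (lebesgue_on \<Omega>) (space (lebesgue_on \<Omega>)) \<noteq> \<infinity>"
      using Ob Ol by (simp add: emeasure_restrict_space)
  qed
  have meas: "f \<in> borel_measurable (lebesgue_on \<Omega>)" if "f \<in> borel_measurable borel" for f :: "real^'n \<Rightarrow> real"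
    using that by (intro measurable_restrict_space1) (simp add: measurable_completion)
  have int_eq: "(\<integral>x. f x \<partial>lebesgue_on \<Omega>) = (\<integral>x. f x \<partial>lborel)"
    if "f \<in> borel_measurable borel" "\<And>x. x \<notin> \<Omega> \<Longrightarrow> f x = 0" for f :: "real^'n \<Rightarrow> real"
  proof -
    have "(\<integral>x. f x \<partial>lebesgue_on \<Omega>) = (\<integral>x. indicator \<Omega> x *\<^sub>R f x \<partial>lebesgue)"
      using Ol by (intro integral_restrict_space) auto
    also have "(\<lambda>x. indicator \<Omega> x *\<^sub>R f x) = f" using that(2) by (auto simp: fun_eq_iff indicator_def)
    also have "(\<integral>x. f x \<partial>lebesgue) = (\<integral>x. f x \<partial>lborel)"
      using that(1) by (intro integral_completion) auto
    finally show ?thesis .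
  qed
  have Wm: "W \<in> borel_measurable (lebesgue_on \<Omega>)" by (rule continuous_imp_measurable_on_sets_lebesgue[OF Wc Ol])
  have "L_infinity \<Omega> W" unfolding L_infinity_def using Wm Wb by (auto intro!: exI[of _ B] AE_I2)
  moreover have "\<exists>g. L_infinity \<Omega> g \<and> weak_pd \<Omega> k W g" for k
  proof -
    define u where "u n = (1 / real (Suc n)) *\<^sub>R (axis k 1 :: real^'n)" for n
    have nu: "norm (u n) = 1 / real (Suc n)" for n by (simp add: u_def)
    \<comment> \<open>The difference quotient, cut off where the translate leaves the domain.\<close>
    define D where "D n x = indicator \<Omega> x * indicator \<Omega> (u n + x) * (real (Suc n) * (W0 (u n + x) - W0 x))" for n x
    have ind: "(indicator \<Omega> :: real^'n \<Rightarrow> real) \<in> borel_measurable borel" using Ob by simp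
    have Dm[measurable]: "D n \<in> borel_measurable borel" for n
      unfolding D_def using ind measurable_compose[OF _ ind, of "\<lambda>x. u n + x" borel]
        measurable_compose[OF _ W0m, of "\<lambda>x. u n + x" borel] by measurable
    have Db: "\<bar>D n x\<bar> \<le> C" for n x
    proof (cases "x \<in> \<Omega> \<and> u n + x \<in> \<Omega>")
      case True
      then have "\<bar>W (u n + x) - W x\<bar> \<le> C * (1 / real (Suc n))" using lip[of "u n + x" x] nu[of n] by simp
      then have "real (Suc n) * \<bar>W (u n + x) - W x\<bar> \<le> real (Suc n) * (C * (1 / real (Suc n)))"
        by (intro mult_left_mono) auto
      also have "\<dots> = C" by simp
      finally show ?thesis using True by (simp add: D_def W0_def abs_mult)
    qed (use C0 in \<open>auto simp: D_def\<close>)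
    obtain g where g: "g \<in> borel_measurable (lebesgue_on \<Omega>)" "\<And>x. \<bar>g x\<bar> \<le> C"
      and lim: "\<And>\<eta> B l. \<eta> \<in> borel_measurable (lebesgue_on \<Omega>) \<Longrightarrow> (\<And>x. x \<in> space (lebesgue_on \<Omega>) \<Longrightarrow> \<bar>\<eta> x\<bar> \<le> B) \<Longrightarrow>
      (\<lambda>n. \<integral>x. D n x * \<eta> x \<partial>lebesgue_on \<Omega>) \<longlonglongrightarrow> l \<Longrightarrow> (\<integral>x. g x * \<eta> x \<partial>lebesgue_on \<Omega>) = l"
      by (rule fm.weak_star_cluster[of D, OF meas[OF Dm] Db C0]) blast
    have "weak_pd \<Omega> k W g" unfolding weak_pd_def
    proof (intro allI impI)
      fix \<eta> assume t: "test_function \<Omega> \<eta>"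
      obtain K where K: "compact K" "K \<subseteq> \<Omega>" "\<And>x. x \<notin> K \<Longrightarrow> \<eta> x = 0"
        using t by (auto simp: test_function_def)
      have C1: "Ck_on 1 UNIV \<eta>" using t by (simp add: test_function_def)
      then have cpd: "continuous_on UNIV (pd UNIV k \<eta>)" and ce: "continuous_on UNIV \<eta>"
        by (auto intro: differentiable_imp_continuous_on)
      have em[measurable]: "\<eta> \<in> borel_measurable borel" "pd UNIV k \<eta> \<in> borel_measurable borel"
        using borel_measurable_continuous_onI cpd ce by auto
      obtain E where E: "\<And>x. x \<in> cball 0 (R + 1) \<Longrightarrow> \<bar>pd UNIV k \<eta> x\<bar> \<le> E"
        using compact_imp_bounded[OF compact_continuous_image[OF continuous_on_subset[OF cpd subset_UNIV] compact_cball[of 0 "R + 1"]]]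
        by (force simp: bounded_iff)
      obtain E0 where E0: "\<And>x. \<bar>\<eta> x\<bar> \<le> E0" "E0 \<ge> 0"
      proof -
        obtain E1 where E1: "\<And>x. x \<in> K \<Longrightarrow> \<bar>\<eta> x\<bar> \<le> E1"
          using compact_imp_bounded[OF compact_continuous_image[OF continuous_on_subset[OF ce subset_UNIV] K(1)]]
          by (force simp: bounded_iff)
        have "\<bar>\<eta> x\<bar> \<le> \<bar>E1\<bar>" for x using E1[of x] K(3)[of x] by (cases "x \<in> K") auto
        then show thesis using that[of "\<bar>E1\<bar>"] by auto
      qed
      \<comment> \<open>The difference quotient transferred to the test function by translation invariance.\<close>
      define q where "q n y = W0 y * (real (Suc n) * (\<eta> (- u n + y) - \<eta> y))" for n y
      have qlim: "(\<lambda>n. \<integral>y. q n y \<partial>lborel) \<longlonglongrightarrow> (\<integral>y. W0 y * - pd UNIV k \<eta> y \<partial>lborel)"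
      proof (rule integral_dominated_convergence)
        show "(\<lambda>y. W0 y * - pd UNIV k \<eta> y) \<in> borel_measurable lborel" by measurable
        show "q n \<in> borel_measurable lborel" for n
          unfolding q_def using measurable_compose[OF _ em(1), of "\<lambda>x. - u n + x" borel] by measurable
        show "integrable lborel (\<lambda>y. B * E * indicator (cball (0::real^'n) R) y)"
          using emeasure_bounded_finite[OF bounded_cball[of "0::real^'n" R]] by (intro integrable_mult_right integrable_real_indicator) auto
        have lder: "((\<lambda>t. \<eta> (y + t *\<^sub>R axis k 1)) has_real_derivative pd UNIV k \<eta> y) (at 0)" for y
          using C1_line[OF C1, of y k 0] by simp
        show "AE y in lborel. (\<lambda>n. q n y) \<longlonglongrightarrow> W0 y * - pd UNIV k \<eta> y"
        proof (rule AE_I2)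
          fix y
          have "((\<lambda>h. (\<eta> (y + h *\<^sub>R axis k 1) - \<eta> y) / h) \<longlongrightarrow> pd UNIV k \<eta> y) (at 0)"
            using lder[of y] by (simp add: DERIV_def)
          moreover have "filterlim (\<lambda>n. - (1 / real (Suc n))) (at 0) sequentially"
          proof (rule filterlim_atI)
            show "(\<lambda>n. - (1 / real (Suc n))) \<longlonglongrightarrow> 0"
              using tendsto_minus[OF LIMSEQ_inverse_real_of_nat] by (simp add: inverse_eq_divide)
          qed auto
          ultimately have "(\<lambda>n. (\<eta> (y + (- (1 / real (Suc n))) *\<^sub>R axis k 1) - \<eta> y) / (- (1 / real (Suc n)))) \<longlonglongrightarrow> pd UNIV k \<eta> y"
            by (rule filterlim_compose)
          from tendsto_mult[OF tendsto_const[of "W0 y"] tendsto_minus[OF this]]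
          show "(\<lambda>n. q n y) \<longlonglongrightarrow> W0 y * - pd UNIV k \<eta> y"
            by (simp add: q_def u_def mult.commute add.commute)
        qed
        show "AE y in lborel. norm (q n y) \<le> B * E * indicator (cball 0 R) y" for n
        proof (rule AE_I2)
          fix y
          show "norm (q n y) \<le> B * E * indicator (cball 0 R) y"
          proof (cases "y \<in> \<Omega>")
            case True
            then have yR: "y \<in> cball 0 R" using R by auto
            let ?h = "1 / real (Suc n)"
            have h: "0 < ?h" "?h \<le> 1" by auto
            have "\<exists>z. - ?h < z \<and> z < 0 \<and> \<eta> (y + 0 *\<^sub>R axis k 1) - \<eta> (y + (- ?h) *\<^sub>R axis k 1)
                = (0 - (- ?h)) * pd UNIV k \<eta> (y + z *\<^sub>R axis k 1)"
              using h by (intro MVT2[where f = "\<lambda>t. \<eta> (y + t *\<^sub>R axis k 1)"] C1_line[OF C1]) auto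
            then obtain z where z: "- ?h < z" "z < 0" "\<eta> y - \<eta> (y + (- ?h) *\<^sub>R axis k 1) = ?h * pd UNIV k \<eta> (y + z *\<^sub>R axis k 1)"
              by auto
            have "-1 \<le> z" using z(1) h(2) by linarith
            then have "norm (z *\<^sub>R (axis k 1 :: real^'n)) \<le> 1" using z(2) by simp
            moreover have "norm y \<le> R" using yR by simp
            ultimately have "norm (y + z *\<^sub>R axis k 1) \<le> R + 1"
              using norm_triangle_ineq[of y "z *\<^sub>R axis k 1"] by linarith
            then have pb: "\<bar>pd UNIV k \<eta> (y + z *\<^sub>R axis k 1)\<bar> \<le> E" by (intro E) simp
            have "real (Suc n) * (\<eta> (- u n + y) - \<eta> y) = - (real (Suc n) * (?h * pd UNIV k \<eta> (y + z *\<^sub>R axis k 1)))"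
              unfolding z(3)[symmetric] by (simp add: u_def algebra_simps)
            also have "\<dots> = - pd UNIV k \<eta> (y + z *\<^sub>R axis k 1)" by simp
            finally have "\<bar>real (Suc n) * (\<eta> (- u n + y) - \<eta> y)\<bar> \<le> E" using pb by simp
            then have "\<bar>q n y\<bar> \<le> B * E" unfolding q_def abs_mult[of "W0 y"] using W0b[of y] B0 by (intro mult_mono) auto
            then show ?thesis using yR by simp
          next
            case False
            have "E \<ge> 0" if "y \<in> cball 0 R"
            proof -
              have "y \<in> cball 0 (R + 1)" using that by simp
              from E[OF this] show ?thesis by (rule order_trans[OF abs_ge_zero])
            qed
            then show ?thesis using False B0 by (auto simp: q_def W0_def indicator_def)
          qed
        qed
      qed
      obtain n0 where n0: "\<And>n x. n \<ge> n0 \<Longrightarrow> x \<in> K \<Longrightarrow> u n + x \<in> \<Omega>"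
      proof -
        obtain \<epsilon> where \<epsilon>: "\<epsilon> > 0" "(\<Union>x\<in>K. ball x \<epsilon>) \<subseteq> \<Omega>"
          using compact_subset_open_imp_ball_epsilon_subset[OF K(1) O(1) K(2)] by blast
        obtain n0 where n0: "1 / real (Suc n0) < \<epsilon>" using \<epsilon>(1) nat_approx_posE by blast
        show thesis
        proof (rule that[of n0])
          fix n x assume "n \<ge> n0" "x \<in> K"
          have "1 / real (Suc n) \<le> 1 / real (Suc n0)" using \<open>n \<ge> n0\<close> by (intro divide_left_mono) auto
          then have "norm (u n) < \<epsilon>" using n0 nu[of n] by linarith
          then have "u n + x \<in> ball x \<epsilon>" by (simp add: dist_norm)
          then show "u n + x \<in> \<Omega>" using \<epsilon>(2) \<open>x \<in> K\<close> by blast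
        qed
      qed
      \<comment> \<open>The cut-off of the difference quotients is invisible once the translates of the support of \<open>\<eta>\<close> stay in the
        domain.\<close>
      have Deq: "(\<integral>x. D n x * \<eta> x \<partial>lebesgue_on \<Omega>) = (\<integral>y. q n y \<partial>lborel)" if n: "n \<ge> n0" for n
      proof -
        let ?N = "real (Suc n)"
        have m1[measurable]: "(\<lambda>x. W0 (u n + x)) \<in> borel_measurable borel"
          by (rule measurable_compose[OF _ W0m]) measurable
        have m2[measurable]: "(\<lambda>x. \<eta> (- u n + x)) \<in> borel_measurable borel"
          by (rule measurable_compose[OF _ em(1)]) measurable
        have e0: "\<eta> x = 0" if "x \<notin> cball 0 R" for x using that K R by blast
        have bd: "\<bar>W0 x * \<eta> y\<bar> \<le> B * E0" for x y unfolding abs_mult using W0b E0 B0 by (intro mult_mono) auto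
        have i1: "integrable lborel (\<lambda>x. W0 (u n + x) * \<eta> x)"
          by (rule lborel_integrable_bounded_support[of _ "B * E0" R]) (use bd e0 in auto)
        have i2: "integrable lborel (\<lambda>x. W0 x * \<eta> x)"
          by (rule lborel_integrable_bounded_support[of _ "B * E0" R]) (use bd e0 in auto)
        have i3: "integrable lborel (\<lambda>x. W0 x * \<eta> (- u n + x))"
        proof (rule lborel_integrable_bounded_support[of _ "B * E0" R])
          show "W0 x * \<eta> (- u n + x) = 0" if "x \<notin> cball 0 R" for x
            using that R by (auto simp: W0_def indicator_def)
        qed (use bd in auto)
        have "D n x * \<eta> x = ?N * (W0 (u n + x) * \<eta> x) - ?N * (W0 x * \<eta> x)" for x
        proof (cases "x \<in> K")
          case True
          then show ?thesis using n0[OF n True] K by (auto simp: D_def algebra_simps)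
        qed (simp add: K(3))
        then have "(\<integral>x. D n x * \<eta> x \<partial>lebesgue_on \<Omega>) = (\<integral>x. ?N * (W0 (u n + x) * \<eta> x) - ?N * (W0 x * \<eta> x) \<partial>lebesgue_on \<Omega>)"
          by simp
        also have "\<dots> = (\<integral>x. ?N * (W0 (u n + x) * \<eta> x) - ?N * (W0 x * \<eta> x) \<partial>lborel)"
        proof (rule int_eq)
          show "?N * (W0 (u n + x) * \<eta> x) - ?N * (W0 x * \<eta> x) = 0" if "x \<notin> \<Omega>" for x
          proof -
            have "\<eta> x = 0" using that K by blast
            then show ?thesis by simp
          qed
        qed measurable
        also have "\<dots> = ?N * (\<integral>x. W0 (u n + x) * \<eta> x \<partial>lborel) - ?N * (\<integral>x. W0 x * \<eta> x \<partial>lborel)"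
          using i1 i2 by simp
        also have "(\<integral>x. W0 (u n + x) * \<eta> x \<partial>lborel) = (\<integral>x. W0 x * \<eta> (- u n + x) \<partial>lborel)"
          using lborel_integral_translate[of "\<lambda>x. W0 x * \<eta> (- u n + x)" "u n"] by simp
        also have "?N * (\<integral>x. W0 x * \<eta> (- u n + x) \<partial>lborel) - ?N * (\<integral>x. W0 x * \<eta> x \<partial>lborel)
          = (\<integral>x. ?N * (W0 x * \<eta> (- u n + x)) - ?N * (W0 x * \<eta> x) \<partial>lborel)"
          using i2 i3 by simp
        also have "\<dots> = (\<integral>y. q n y \<partial>lborel)"
          by (intro Bochner_Integration.integral_cong refl) (simp add: q_def algebra_simps)
        finally show ?thesis .
      qed
      have "(\<lambda>n. \<integral>x. D n x * \<eta> x \<partial>lebesgue_on \<Omega>) \<longlonglongrightarrow> (\<integral>y. W0 y * - pd UNIV k \<eta> y \<partial>lborel)"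
        by (rule Lim_transform_eventually[OF qlim eventually_sequentiallyI[of n0]]) (simp add: Deq)
      from lim[OF meas[OF em(1)] E0(1) this]
      have "(\<integral>x. g x * \<eta> x \<partial>lebesgue_on \<Omega>) = (\<integral>y. W0 y * - pd UNIV k \<eta> y \<partial>lborel)" .
      also have "\<dots> = (\<integral>y. W0 y * - pd UNIV k \<eta> y \<partial>lebesgue_on \<Omega>)"
      proof (rule int_eq[symmetric])
        show "(\<lambda>y. W0 y * - pd UNIV k \<eta> y) \<in> borel_measurable borel" by measurable
      qed (simp add: W0_def)
      also have "\<dots> = (\<integral>y. - (W y * pd UNIV k \<eta> y) \<partial>lebesgue_on \<Omega>)"
        using Ol by (intro Bochner_Integration.integral_cong refl) (auto simp: W0_def)
      finally show "(\<integral>x. W x * pd UNIV k \<eta> x \<partial>lebesgue_on \<Omega>) = - (\<integral>x. g x * \<eta> x \<partial>lebesgue_on \<Omega>)" by simp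
    qed
    moreover have "L_infinity \<Omega> g" unfolding L_infinity_def using g by (auto intro!: exI[of _ C])
    ultimately show ?thesis by blast
  qed
  ultimately show ?thesis unfolding W1_infinity_def by blast
qed

section \<open>Passage to the limit in the viscosity sense\<close>

text \<open>
  Any two points of a compact connected set are joined by a chain of steps shorter than \<open>r\<close> whose number is bounded.  Therefore a function whose
  oscillation over such steps is at most \<open>c\<close> has total oscillation at most \<open>n * c\<close>.
\<close>
lemma connected_chain_bound:
  fixes S :: "'a::metric_space set"
  assumes S: "compact S" "connected S" and r: "r > 0"
  obtains n :: nat where "\<And>(f::'a \<Rightarrow> real) c x y. 0 \<le> c \<Longrightarrow>
      (\<And>x y. x \<in> S \<Longrightarrow> y \<in> S \<Longrightarrow> dist x y < r \<Longrightarrow> f x \<le> f y + c) \<Longrightarrow> x \<in> S \<Longrightarrow> y \<in> S \<Longrightarrow> f x \<le> f y + real n * c"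
proof -
  define ok where "ok f c \<longleftrightarrow> (0::real) \<le> c \<and> (\<forall>x\<in>S. \<forall>y\<in>S. dist x y < r \<longrightarrow> f x \<le> f y + c)"
    for f :: "'a \<Rightarrow> real" and c
  define Rel where "Rel x y \<longleftrightarrow> (\<exists>n::nat. \<forall>f c. ok f c \<longrightarrow> f x \<le> f y + real n * c \<and> f y \<le> f x + real n * c)" for x y
  have rel: "Rel a b" if ab: "a \<in> S" "b \<in> S" for a b
  proof (rule connected_equivalence_relation[OF S(2) ab])
    show "Rel y x" if "Rel x y" for x y using that unfolding Rel_def by blast
    show "Rel x z" if xy: "Rel x y" and yz: "Rel y z" for x y z
    proof -
      obtain n where n: "\<And>f c. ok f c \<Longrightarrow> f x \<le> f y + real n * c \<and> f y \<le> f x + real n * c" using xy unfolding Rel_def by blast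
      obtain m where m: "\<And>f c. ok f c \<Longrightarrow> f y \<le> f z + real m * c \<and> f z \<le> f y + real m * c" using yz unfolding Rel_def by blast
      have "f x \<le> f z + real (n + m) * c \<and> f z \<le> f x + real (n + m) * c" if "ok f c" for f c
        using n[OF that] m[OF that] by (simp add: distrib_right)
      then show ?thesis unfolding Rel_def by blast
    qed
    fix a assume a: "a \<in> S"
    show "\<exists>T. openin (top_of_set S) T \<and> a \<in> T \<and> (\<forall>x\<in>T. Rel a x)"
    proof (intro exI conjI ballI)
      show "openin (top_of_set S) (S \<inter> ball a r)" by (simp add: openin_open_Int)
      show "a \<in> S \<inter> ball a r" using a r by simp
      fix x assume x: "x \<in> S \<inter> ball a r"
      have "f a \<le> f x + real 1 * c \<and> f x \<le> f a + real 1 * c" if "ok f c" for f c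
        using that a x unfolding ok_def by (auto simp: dist_commute)
      then show "Rel a x" unfolding Rel_def by blast
    qed
  qed
  obtain P where P: "P \<subseteq> S" "finite P" "S \<subseteq> (\<Union>p\<in>P. ball p r)"
    using compactE_image[OF S(1), of S "\<lambda>p. ball p r"] r by force
  have "\<exists>n::nat. \<forall>f c. ok f c \<longrightarrow> f p \<le> f q + real n * c" if "p \<in> P" "q \<in> P" for p q
  proof -
    have "Rel p q" using rel that P(1) by auto
    then show ?thesis unfolding Rel_def by metis
  qed
  then obtain N where N: "\<And>p q f c. p \<in> P \<Longrightarrow> q \<in> P \<Longrightarrow> ok f c \<Longrightarrow> f p \<le> f q + real (N p q :: nat) * c" by metis
  define n where "n = Max (insert 0 ((\<lambda>(p, q). N p q) ` (P \<times> P))) + 2"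
  show thesis
  proof (rule that[of n])
    fix f :: "'a \<Rightarrow> real" and c x y
    assume c: "0 \<le> c" and h: "\<And>x y. x \<in> S \<Longrightarrow> y \<in> S \<Longrightarrow> dist x y < r \<Longrightarrow> f x \<le> f y + c" and x: "x \<in> S" and y: "y \<in> S"
    have ok: "ok f c" using c h by (auto simp: ok_def)
    obtain p where p: "p \<in> P" "dist p x < r" using P(3) x by auto
    obtain q where q: "q \<in> P" "dist q y < r" using P(3) y by auto
    have "f x \<le> f p + c" using h[of x p] p P(1) x by (auto simp: dist_commute)
    moreover have "f q \<le> f y + c" using h[of q y] q P(1) y by auto
    moreover have "f p \<le> f q + real (N p q) * c" by (rule N[OF p(1) q(1) ok])
    moreover have "N p q + 2 \<le> n" unfolding n_def using p q P(2) by (auto intro!: Max_ge)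
    then have "real (N p q + 2) * c \<le> real n * c" using c by (intro mult_right_mono) auto
    ultimately show "f x \<le> f y + real n * c" by (simp add: distrib_right)
  qed
qed

text \<open>
  Stability of maxima under uniform convergence.  Subtracting the squared distance to \<open>x0\<close> makes the maximum at \<open>x0\<close> strict, so that the perturbed
  functions have local maxima close to \<open>x0\<close>.  The maximum is also taken over the indices in \<open>I\<close>.
\<close>
lemma perturbed_max:
  fixes U :: "nat \<Rightarrow> 'i \<Rightarrow> 'a::euclidean_space \<Rightarrow> real"
  assumes S: "compact S" and I: "finite I" "I \<noteq> {}"
    and Uc: "\<And>k i. i \<in> I \<Longrightarrow> continuous_on S (U k i)"
    and Ul: "\<And>i. i \<in> I \<Longrightarrow> uniform_limit S (\<lambda>k. U k i) V sequentially"
    and pc: "continuous_on S \<phi>" and x0: "x0 \<in> S"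
    and mx: "local_max_on S (\<lambda>y. V y - \<phi> y) x0" and rpos: "r > 0"
  shows "\<forall>\<^sub>F k in sequentially. \<exists>i\<in>I. \<exists>x\<in>S. dist x x0 < r \<and> (\<exists>e>0. \<forall>y\<in>S. y \<in> ball x e \<longrightarrow>
      U k i y - (\<phi> y + (y - x0) \<bullet> (y - x0)) \<le> U k i x - (\<phi> x + (x - x0) \<bullet> (x - x0))) \<and> (\<forall>j\<in>I. U k j x \<le> U k i x)"
proof -
  obtain \<delta> where \<delta>: "\<delta> > 0" "\<And>y. y \<in> S \<Longrightarrow> dist y x0 < \<delta> \<Longrightarrow> V y - \<phi> y \<le> V x0 - \<phi> x0"
    using mx by (auto simp: local_max_on_def)
  define s where "s = min \<delta> r / 2"
  have s: "s > 0" "s < \<delta>" "s < r" using \<delta>(1) rpos by (auto simp: s_def)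
  have "\<forall>\<^sub>F k in sequentially. \<forall>i\<in>I. \<forall>y\<in>S. dist (U k i y) (V y) < s\<^sup>2 / 4"
    unfolding eventually_ball_finite_distrib[OF I(1)]
    using uniform_limitD[OF Ul, of _ "s\<^sup>2 / 4"] s by auto
  then show ?thesis
  proof eventually_elim
    case (elim k)
    have S': "compact (S \<inter> cball x0 s)" "S \<inter> cball x0 s \<noteq> {}" using S x0 s by (auto intro: compact_Int_closed)
    have c: "continuous_on (S \<inter> cball x0 s) (\<lambda>y. U k i y - (\<phi> y + (y - x0) \<bullet> (y - x0)))" if "i \<in> I" for i
      using Uc[OF that, of k] pc by (intro continuous_intros) (auto intro: continuous_on_subset)
    obtain i x where i: "i \<in> I" and x: "x \<in> S" "dist x x0 \<le> s"
      and m: "\<And>j y. j \<in> I \<Longrightarrow> y \<in> S \<Longrightarrow> dist y x0 \<le> s \<Longrightarrow>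
         U k j y - (\<phi> y + (y - x0) \<bullet> (y - x0)) \<le> U k i x - (\<phi> x + (x - x0) \<bullet> (x - x0))"
      using finite_family_attains_sup[OF I S' c, of "\<lambda>i. i"] by (auto simp: dist_commute)
    have "U k i x0 - \<phi> x0 \<le> U k i x - (\<phi> x + (x - x0) \<bullet> (x - x0))" using m[OF i x0] s by simp
    moreover have "V x - \<phi> x \<le> V x0 - \<phi> x0" using \<delta>(2)[OF x(1)] x(2) s by auto
    moreover have "4 * \<bar>U k i x - V x\<bar> < s\<^sup>2" "4 * \<bar>U k i x0 - V x0\<bar> < s\<^sup>2"
      using elim i x(1) x0 by (auto simp: dist_real_def mult.commute)
    moreover have "0 < s\<^sup>2" using s by simp
    moreover have "q < t" if "a0 - p0 \<le> a - (p + q)" "v - p \<le> v0 - p0" "4 * \<bar>a - v\<bar> < t" "4 * \<bar>a0 - v0\<bar> < t" "0 < t"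
      for q t a a0 v v0 p p0 :: real
    proof -
      have "a - v \<le> \<bar>a - v\<bar>" "v0 - a0 \<le> \<bar>a0 - v0\<bar>" by linarith+
      then show ?thesis using that by argo
    qed
    ultimately have "(x - x0) \<bullet> (x - x0) < s\<^sup>2" by blast
    then have "(norm (x - x0))\<^sup>2 < s\<^sup>2" by (simp add: dot_square_norm)
    then have dx: "dist x x0 < s" using s by (simp add: dist_norm power2_less_imp_less)
    show ?case
    proof (rule bexI[OF _ i], rule bexI[OF _ x(1)], intro conjI ballI exI[of _ "s - dist x x0"] impI)
      show "dist x x0 < r" using dx s by simp
      show "s - dist x x0 > 0" using dx by simp
      fix y assume y: "y \<in> S" "y \<in> ball x (s - dist x x0)"
      have "dist y x0 \<le> s" using y dist_triangle[of y x0 x] by (simp add: dist_commute)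
      then show "U k i y - (\<phi> y + (y - x0) \<bullet> (y - x0)) \<le> U k i x - (\<phi> x + (x - x0) \<bullet> (x - x0))"
        by (rule m[OF i y(1)])
    next
      fix j assume "j \<in> I"
      from m[OF this x] show "U k j x \<le> U k i x" by simp
    qed
  qed
qed

lemma continuous_on_near:
  fixes f :: "'a::metric_space \<Rightarrow> real"
  assumes "continuous_on S f" "x \<in> S" "f x > a"
  obtains r where "r > 0" "\<And>y. y \<in> S \<Longrightarrow> dist y x < r \<Longrightarrow> f y > a"
proof -
  obtain r where r: "r > 0" "\<And>y. y \<in> S \<Longrightarrow> dist y x < r \<Longrightarrow> dist (f y) (f x) < f x - a"
    using assms unfolding continuous_on_iff by (metis diff_gt_0_iff_gt)
  show thesis
  proof (rule that[OF r(1)])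
    fix y assume "y \<in> S" "dist y x < r"
    from r(2)[OF this] show "f y > a" by (auto simp: dist_real_def abs_if split: if_splits)
  qed
qed

lemma twice_diff_at_sqdist:
  "twice_diff_at (\<lambda>y. (y - x0) \<bullet> (y - x0)) (\<lambda>y. 2 *\<^sub>R (y - x0)) (\<lambda>y v. 2 *\<^sub>R v) (x :: real^'n::finite)"
proof -
  have d: "((\<lambda>y. y - x0) has_derivative (\<lambda>v. v)) (at y)" for y :: "real^'n"
    by (auto intro!: derivative_eq_intros)
  have "((\<lambda>y. (y - x0) \<bullet> (y - x0)) has_derivative (\<lambda>v. (2 *\<^sub>R (y - x0)) \<bullet> v)) (at y)" for y
    by (rule has_derivative_eq_rhs[OF has_derivative_inner[OF d d]])
      (intro ext, simp only: inner_scaleR_left inner_commute[of _ "y - x0"] mult_2)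
  moreover have "((\<lambda>y. 2 *\<^sub>R (y - x0)) has_derivative (\<lambda>v. 2 *\<^sub>R v)) (at x)"
    by (rule has_derivative_scaleR_right[OF d])
  ultimately show ?thesis unfolding twice_diff_at_def by (simp only: eventually_True simp_thms)
qed

lemma tr_id: "tr (\<lambda>v::real^'n::finite. v) = real CARD('n)"
  by (simp add: tr_def)

lemma Ck2_closure:
  assumes "Ck_on 2 S (\<phi> :: real^'n::finite \<Rightarrow> real)" "compact S"
  shows "continuous_on S \<phi>" "continuous_on S (grad S \<phi>)"
    "\<exists>C. \<forall>x\<in>S. \<bar>laplacian S \<phi> x\<bar> \<le> C"
    "\<And>x. x \<in> S \<Longrightarrow> (\<phi> has_derivative (\<lambda>v. grad S \<phi> x \<bullet> v)) (at x within S)"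
proof -
  have d: "\<phi> differentiable_on S" "\<And>k. pd S k \<phi> differentiable_on S" "\<And>k l. continuous_on S (pd S l (pd S k \<phi>))"
    using assms(1) by (auto simp: numeral_2_eq_2)
  show "continuous_on S \<phi>" using d(1) by (rule differentiable_imp_continuous_on)
  show "continuous_on S (grad S \<phi>)" unfolding grad_def[abs_def]
    by (intro continuous_on_vec_lambda differentiable_imp_continuous_on d(2))
  have "continuous_on S (laplacian S \<phi>)" unfolding laplacian_def[abs_def] by (intro continuous_intros d(3))
  from compact_imp_bounded[OF compact_continuous_image[OF this assms(2)]]
  show "\<exists>C. \<forall>x\<in>S. \<bar>laplacian S \<phi> x\<bar> \<le> C" by (auto simp: bounded_iff)
  show "(\<phi> has_derivative (\<lambda>v. grad S \<phi> x \<bullet> v)) (at x within S)" if "x \<in> S" for x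
    using has_derivative_grad d(1) that by (auto simp: differentiable_on_def)
qed

lemma has_derivative_sqdist:
  "((\<lambda>y. (y - x0) \<bullet> (y - x0)) has_derivative (\<lambda>v. (2 *\<^sub>R (x - x0)) \<bullet> v)) (at (x::real^'n::finite) within S)"
  by (rule has_derivative_at_withinI[OF twice_diff_at_DERIV[OF twice_diff_at_sqdist]])

text \<open>
  Solutions of the system for a sequence \<open>d k\<close> tending to zero, with common bounds for the coefficients and a common uniform limit \<open>V\<close> of all components.
\<close>
locale hj_sequence = neumann_geometry \<Omega> \<nu> h gh Hh Hm G Q
  for \<Omega> :: "(real^'n::finite) set" and \<nu> h gh Hh Hm G Q +
  fixes b :: "'m::finite \<Rightarrow> real^'n \<Rightarrow> real^'n" and M :: "real^'n \<Rightarrow> real^'m^'m"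
    and W :: "nat \<Rightarrow> 'm \<Rightarrow> real^'n \<Rightarrow> real" and gW HW and d lam :: "nat \<Rightarrow> real" and B Mb c :: real
    and V :: "real^'n \<Rightarrow> real"
  assumes sys: "\<And>k. hj_system \<Omega> \<nu> h gh Hh Hm G Q b M (W k) (gW k) (HW k) (d k) (lam k) B Mb c"
    and d_lim: "d \<longlonglongrightarrow> 0"
    and unif: "\<And>i. uniform_limit (closure \<Omega>) (\<lambda>k. W k i) V sequentially"
    and b_cont: "\<And>i. continuous_on (closure \<Omega>) (b i)"
    and gh_par: "\<And>x. x \<in> frontier \<Omega> \<Longrightarrow> \<exists>\<sigma>\<ge>1. gh x = \<sigma> *\<^sub>R \<nu> x"
    and V_cont: "continuous_on (closure \<Omega>) V"
begin

text \<open>A bound for the absolute values of all eigenvalues \<open>lam k\<close>.\<close>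
definition "\<Lambda> = Mb + real CARD('n) * G + G\<^sup>2 + B * G + real CARD('m) * Mb"

lemma diagonal_minus_eigenvalue_bound: assumes "x \<in> closure \<Omega>" shows "\<bar>M x $ i $ i - lam k\<bar> \<le> Mb + \<Lambda>"
proof -
  interpret s: hj_system \<Omega> \<nu> h gh Hh Hm G Q b M "W k" "gW k" "HW k" "d k" "lam k" B Mb c by (rule sys)
  have "0 \<le> G\<^sup>2" "0 \<le> real CARD('m) * Mb" using s.Mb_nonneg by simp_all
  then have "lam k \<le> \<Lambda>" using s.lam_upper unfolding \<Lambda>_def by linarith
  moreover have "- lam k \<le> \<Lambda>" using s.lam_lower unfolding \<Lambda>_def .
  ultimately show ?thesis using s.M_le[OF assms, of i i] by linarith
qed

lemma gh_cont: "continuous_on S gh"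
proof (intro continuous_at_imp_continuous_on ballI)
  fix x show "isCont gh x" using h2[of x] by (auto simp: twice_diff_at_def intro: has_derivative_continuous)
qed

text \<open>
  If a continuous vector field points outwards at a boundary point, it does so nearby.  The normal itself is not assumed to be continuous, but it is
  a positive multiple of the continuous field \<open>gh\<close>.
\<close>

lemma outward_near:
  assumes P: "continuous_on (closure \<Omega>) P" and x: "x \<in> closure \<Omega>"
    and o: "x \<in> frontier \<Omega> \<Longrightarrow> P x \<bullet> \<nu> x > 0"
  obtains r where "r > 0" "\<And>y. y \<in> frontier \<Omega> \<Longrightarrow> dist y x < r \<Longrightarrow> P y \<bullet> \<nu> y > 0"
proof (cases "x \<in> \<Omega>")
  case True
  then obtain r where "r > 0" "ball x r \<subseteq> \<Omega>" using open_dom open_contains_ball by blast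
  moreover have "y \<notin> frontier \<Omega>" if "y \<in> \<Omega>" for y using that open_dom by (auto simp: frontier_def interior_open)
  ultimately show ?thesis by (intro that[of r]) (auto simp: dist_commute subset_eq)
next
  case False
  then have xf: "x \<in> frontier \<Omega>" using cl_cases x by auto
  obtain \<sigma> where s: "\<sigma> \<ge> 1" "gh x = \<sigma> *\<^sub>R \<nu> x" using gh_par[OF xf] by auto
  have "P x \<bullet> gh x > 0" using s o[OF xf] by simp
  then have pos: "(\<lambda>y. P y \<bullet> gh y) x > 0" .
  have c: "continuous_on (closure \<Omega>) (\<lambda>y. P y \<bullet> gh y)" by (intro continuous_intros P gh_cont)
  obtain r where r: "r > 0" "\<And>y. y \<in> closure \<Omega> \<Longrightarrow> dist y x < r \<Longrightarrow> P y \<bullet> gh y > 0"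
    by (rule continuous_on_near[OF c x pos]) blast
  show ?thesis
  proof (rule that[OF r(1)])
    fix y assume y: "y \<in> frontier \<Omega>" "dist y x < r"
    obtain \<sigma> where "\<sigma> \<ge> 1" "gh y = \<sigma> *\<^sub>R \<nu> y" using gh_par[OF y(1)] by auto
    then show "P y \<bullet> \<nu> y > 0" using r(2)[OF frontier_cl[OF y(1)] y(2)] by (auto simp: zero_less_mult_iff)
  qed
qed

lemma d_small: assumes "\<mu> > 0" shows "\<forall>\<^sub>F k in sequentially. d k * C < \<mu>"
proof -
  have "(\<lambda>k. d k * C) \<longlonglongrightarrow> 0 * C" by (intro tendsto_intros d_lim)
  then show ?thesis using assms by (intro order_tendstoD(2)) auto
qed

text \<open>
  It suffices to consider the component \<open>i\<close> at which the maximum in the Hamiltonian is attained.  If the Hamiltonian were positive, then, the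
  coupling term being nonnegative, the equation would bound \<open>d k * tr (HW k i z)\<close> away from zero at the maximum points \<open>z\<close>.
\<close>
lemma limit_subsolution: "viscosity_subsolution \<Omega> \<nu> b V"
  unfolding viscosity_subsolution_def
proof (intro conjI V_cont allI impI)
  fix \<phi> x
  assume A: "Ck_on 2 (closure \<Omega>) \<phi> \<and> x \<in> closure \<Omega> \<and> local_max_on (closure \<Omega>) (\<lambda>y. V y - \<phi> y) x"
  note phi = Ck2_closure[OF conjunct1[OF A] compact_cl]
  have x: "x \<in> closure \<Omega>" and mx: "local_max_on (closure \<Omega>) (\<lambda>y. V y - \<phi> y) x" using A by auto
  have "hamiltonian b x (grad (closure \<Omega>) \<phi> x) \<le> 0 \<or> x \<in> frontier \<Omega> \<and> normal_deriv \<Omega> \<nu> \<phi> x \<le> 0"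
  proof (rule ccontr)
    assume neg: "\<not> ?thesis"
    then have H: "hamiltonian b x (grad (closure \<Omega>) \<phi> x) > 0" and nd: "x \<in> frontier \<Omega> \<Longrightarrow> normal_deriv \<Omega> \<nu> \<phi> x > 0"
      by auto
    define P where "P y = grad (closure \<Omega>) \<phi> y + 2 *\<^sub>R (y - x)" for y
    have Pc: "continuous_on (closure \<Omega>) P" unfolding P_def[abs_def] by (intro continuous_intros phi(2))
    have "Max (range (\<lambda>i. (norm (grad (closure \<Omega>) \<phi> x))\<^sup>2 - b i x \<bullet> grad (closure \<Omega>) \<phi> x))
        \<in> range (\<lambda>i. (norm (grad (closure \<Omega>) \<phi> x))\<^sup>2 - b i x \<bullet> grad (closure \<Omega>) \<phi> x)"
      by (intro Max_in) auto
    then obtain i where i: "hamiltonian b x (grad (closure \<Omega>) \<phi> x)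
        = (norm (grad (closure \<Omega>) \<phi> x))\<^sup>2 - b i x \<bullet> grad (closure \<Omega>) \<phi> x"
      unfolding hamiltonian_def by (rule rangeE)
    define \<theta> where "\<theta> y = P y \<bullet> P y - b i y \<bullet> P y" for y
    have tc: "continuous_on (closure \<Omega>) \<theta>" unfolding \<theta>_def[abs_def] by (intro continuous_intros Pc b_cont)
    have t0: "\<theta> x > 0" using H i by (simp add: \<theta>_def P_def dot_square_norm)
    define \<mu> where "\<mu> = \<theta> x / 2"
    have mu: "\<mu> > 0" "\<theta> x > \<mu>" using t0 by (auto simp: \<mu>_def)
    obtain r1 where r1: "r1 > 0" "\<And>y. y \<in> closure \<Omega> \<Longrightarrow> dist y x < r1 \<Longrightarrow> \<theta> y > \<mu>"
      by (rule continuous_on_near[OF tc x mu(2)]) blast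
    have "x \<in> frontier \<Omega> \<Longrightarrow> P x \<bullet> \<nu> x > 0" using nd by (simp add: P_def normal_deriv_grad)
    from outward_near[OF Pc x this]
    obtain r2 where r2: "r2 > 0" "\<And>y. y \<in> frontier \<Omega> \<Longrightarrow> dist y x < r2 \<Longrightarrow> P y \<bullet> \<nu> y > 0" by metis
    obtain Lb where Lb: "\<And>y. y \<in> closure \<Omega> \<Longrightarrow> \<bar>laplacian (closure \<Omega>) \<phi> y\<bar> \<le> Lb" using phi(3) by auto
    have Wc: "continuous_on (closure \<Omega>) (W k j)" for k j
      by (rule hj_system.W_cont[OF sys])
    have "\<forall>\<^sub>F k in sequentially. \<exists>i'\<in>{i}. \<exists>z\<in>closure \<Omega>. dist z x < min r1 r2 \<and> (\<exists>e>0. \<forall>y\<in>closure \<Omega>. y \<in> ball z e \<longrightarrow>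
      W k i' y - (\<phi> y + (y - x) \<bullet> (y - x)) \<le> W k i' z - (\<phi> z + (z - x) \<bullet> (z - x))) \<and> (\<forall>j\<in>{i}. W k j z \<le> W k i' z)"
      by (rule perturbed_max[OF compact_cl _ _ Wc unif phi(1) x mx]) (use r1 r2 in auto)
    moreover have "\<forall>\<^sub>F k in sequentially. d k * (Lb + 2 * real CARD('n) + (Mb + \<Lambda>)) < \<mu>" by (rule d_small[OF mu(1)])
    ultimately have "\<forall>\<^sub>F k in sequentially. False"
    proof eventually_elim
      case (elim k)
      interpret s: hj_system \<Omega> \<nu> h gh Hh Hm G Q b M "W k" "gW k" "HW k" "d k" "lam k" B Mb c by (rule sys)
      obtain z e where z: "z \<in> closure \<Omega>" "dist z x < r1" "dist z x < r2" and e: "e > 0"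
        and m: "\<And>y. y \<in> closure \<Omega> \<Longrightarrow> y \<in> ball z e \<Longrightarrow>
           W k i y - (\<phi> y + (y - x) \<bullet> (y - x)) \<le> W k i z - (\<phi> z + (z - x) \<bullet> (z - x))"
        using elim(1) by auto
      have zO: "z \<in> \<Omega>"
      proof (rule ccontr)
        assume "z \<notin> \<Omega>"
        then have zf: "z \<in> frontier \<Omega>" using cl_cases z by auto
        have "((\<lambda>y. W k i y - (\<phi> y + (y - x) \<bullet> (y - x))) has_derivative
            (\<lambda>v. gW k i z \<bullet> v - (grad (closure \<Omega>) \<phi> z \<bullet> v + (2 *\<^sub>R (z - x)) \<bullet> v))) (at z within closure \<Omega>)"
          by (intro has_derivative_diff has_derivative_add s.W1 phi(4) z(1) has_derivative_sqdist)
        from frontier_max[OF zf this e m] have "P z \<bullet> \<nu> z \<le> 0"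
          using s.neumann[OF zf, of i] by (simp add: P_def inner_add_left)
        with r2(2)[OF zf z(3)] show False by simp
      qed
      obtain e' where e': "e' > 0" "e' \<le> e" "ball z e' \<subseteq> \<Omega>"
      proof -
        obtain e1 where "e1 > 0" "ball z e1 \<subseteq> \<Omega>" using open_dom zO open_contains_ball by blast
        then show thesis using e by (intro that[of "min e e1"]) auto
      qed
      have zi: "z \<in> interior (closure \<Omega>)" using zO open_dom interior_maximal[OF closure_subset] by blast
      have td: "twice_diff_at (\<lambda>y. \<phi> y + (y - x) \<bullet> (y - x)) P (\<lambda>y v. hess (closure \<Omega>) \<phi> y v + 2 *\<^sub>R v) z"
        unfolding P_def[abs_def]
        by (intro twice_diff_at_add Ck2_twice_diff_at[OF conjunct1[OF A] zi] twice_diff_at_sqdist)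
      have m': "W k i y - (\<phi> y + (y - x) \<bullet> (y - x)) \<le> W k i z - (\<phi> z + (z - x) \<bullet> (z - x))" if "y \<in> ball z e'" for y
        using m[of y] e' in_cl that by auto
      have gP: "gW k i z = P z" and tP: "tr (HW k i z) \<le> laplacian (closure \<Omega>) \<phi> z + 2 * real CARD('n)"
        using one_point_max[OF s.W2[OF zO, of i] td e'(1) m'] by (simp_all add: tr_add tr_scaleR tr_id tr_hess)
      have "tr (HW k i z) \<le> Lb + 2 * real CARD('n)" using tP Lb[OF z(1)] by linarith
      then have up: "d k * tr (HW k i z) \<le> d k * (Lb + 2 * real CARD('n))" using s.d0 by (intro mult_left_mono) auto
      have "M z $ i $ i - lam k \<le> Mb + \<Lambda>" using diagonal_minus_eigenvalue_bound[OF z(1), of i k] by linarith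
      then have ml: "d k * (M z $ i $ i - lam k) \<le> d k * (Mb + \<Lambda>)" using s.d0 by (intro mult_left_mono) auto
      have "d k * tr (HW k i z) = \<theta> z + s.coupling i z - d k * (M z $ i $ i - lam k)"
        using s.hj_eq'[OF zO, of i] by (simp add: gP \<theta>_def)
      then show False
        using up ml s.coupling_nonneg[OF z(1), of i] r1(2)[OF z(1,2)] elim(2) unfolding distrib_left by linarith
    qed
    then show False by simp
  qed
  moreover have "x \<notin> frontier \<Omega>" if "x \<in> \<Omega>" using that open_dom by (auto simp: frontier_def interior_open)
  ultimately have fin: "x \<in> \<Omega> \<longrightarrow> hamiltonian b x (grad (closure \<Omega>) \<phi> x) \<le> 0"
     "x \<in> frontier \<Omega> \<longrightarrow> min (hamiltonian b x (grad (closure \<Omega>) \<phi> x)) (normal_deriv \<Omega> \<nu> \<phi> x) \<le> 0" by auto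
  show "hamiltonian b x (grad (closure \<Omega>) \<phi> x) \<le> 0" if "x \<in> \<Omega>" using fin that by blast
  show "min (hamiltonian b x (grad (closure \<Omega>) \<phi> x)) (normal_deriv \<Omega> \<nu> \<phi> x) \<le> 0" if "x \<in> frontier \<Omega>"
    using fin that by blast
qed

text \<open>
  Here the index varies with \<open>k\<close>: it is the one whose component is the least at the minimum point of the perturbed functions.
\<close>
lemma limit_supersolution: "viscosity_supersolution \<Omega> \<nu> b V"
  unfolding viscosity_supersolution_def
proof (intro conjI V_cont allI impI)
  fix \<phi> x
  assume A: "Ck_on 2 (closure \<Omega>) \<phi> \<and> x \<in> closure \<Omega> \<and> local_min_on (closure \<Omega>) (\<lambda>y. V y - \<phi> y) x"
  note phi = Ck2_closure[OF conjunct1[OF A] compact_cl]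
  have x: "x \<in> closure \<Omega>" using A by blast
  have mx: "local_max_on (closure \<Omega>) (\<lambda>y. - V y - (- \<phi> y)) x"
  proof -
    obtain \<delta> where \<delta>: "\<delta> > 0" "\<And>y. y \<in> closure \<Omega> \<Longrightarrow> dist y x < \<delta> \<Longrightarrow> V x - \<phi> x \<le> V y - \<phi> y"
      using A by (auto simp: local_min_on_def)
    have "- V y - (- \<phi> y) \<le> - V x - (- \<phi> x)" if "y \<in> closure \<Omega>" "dist y x < \<delta>" for y
      using \<delta>(2)[OF that] by simp
    with \<delta>(1) show ?thesis unfolding local_max_on_def by blast
  qed
  have "hamiltonian b x (grad (closure \<Omega>) \<phi> x) \<ge> 0 \<or> x \<in> frontier \<Omega> \<and> normal_deriv \<Omega> \<nu> \<phi> x \<ge> 0"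
  proof (rule ccontr)
    assume neg: "\<not> ?thesis"
    then have H: "hamiltonian b x (grad (closure \<Omega>) \<phi> x) < 0" and nd: "x \<in> frontier \<Omega> \<Longrightarrow> normal_deriv \<Omega> \<nu> \<phi> x < 0"
      by auto
    define P where "P y = grad (closure \<Omega>) \<phi> y - 2 *\<^sub>R (y - x)" for y
    have Pc: "continuous_on (closure \<Omega>) P" unfolding P_def[abs_def] by (intro continuous_intros phi(2))
    define \<theta> where "\<theta> i y = P y \<bullet> P y - b i y \<bullet> P y" for i y
    have tc: "continuous_on (closure \<Omega>) (\<lambda>y. - \<theta> i y)" for i unfolding \<theta>_def[abs_def] by (intro continuous_intros Pc b_cont)
    define \<mu> where "\<mu> = - hamiltonian b x (grad (closure \<Omega>) \<phi> x) / 2"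
    have mu: "\<mu> > 0" using H by (simp add: \<mu>_def)
    have t0: "- \<theta> i x > \<mu>" for i
    proof -
      have "(norm (grad (closure \<Omega>) \<phi> x))\<^sup>2 - b i x \<bullet> grad (closure \<Omega>) \<phi> x \<le> hamiltonian b x (grad (closure \<Omega>) \<phi> x)"
        unfolding hamiltonian_def by (intro Max_ge) auto
      then have "\<theta> i x \<le> hamiltonian b x (grad (closure \<Omega>) \<phi> x)" by (simp add: \<theta>_def P_def dot_square_norm)
      then show ?thesis using H by (simp add: \<mu>_def field_simps)
    qed
    have "\<exists>r>0. \<forall>y\<in>closure \<Omega>. dist y x < r \<longrightarrow> - \<theta> i y > \<mu>" for i
      using continuous_on_near[OF tc x t0] by metis
    then obtain r0 where r0: "\<And>i. r0 i > 0" "\<And>i y. y \<in> closure \<Omega> \<Longrightarrow> dist y x < r0 i \<Longrightarrow> - \<theta> i y > \<mu>" by metis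
    define r1 where "r1 = Min (range r0)"
    have r1: "r1 > 0" "\<And>i. r1 \<le> r0 i" using r0(1) by (auto simp: r1_def)
    have mPc: "continuous_on (closure \<Omega>) (\<lambda>y. - P y)" by (intro continuous_intros Pc)
    have "x \<in> frontier \<Omega> \<Longrightarrow> (- P x) \<bullet> \<nu> x > 0" using nd by (simp add: P_def normal_deriv_grad)
    from outward_near[OF mPc x this]
    obtain r2 where r2: "r2 > 0" "\<And>y. y \<in> frontier \<Omega> \<Longrightarrow> dist y x < r2 \<Longrightarrow> (- P y) \<bullet> \<nu> y > 0" by metis
    obtain Lb where Lb: "\<And>y. y \<in> closure \<Omega> \<Longrightarrow> \<bar>laplacian (closure \<Omega>) \<phi> y\<bar> \<le> Lb" using phi(3) by auto
    have Wc: "continuous_on (closure \<Omega>) (\<lambda>y. - W k j y)" for k j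
      by (intro continuous_on_minus hj_system.W_cont[OF sys])
    have Wu: "uniform_limit (closure \<Omega>) (\<lambda>k y. - W k j y) (\<lambda>y. - V y) sequentially" for j
      by (rule uniform_limit_uminus[OF unif])
    have mpc: "continuous_on (closure \<Omega>) (\<lambda>y. - \<phi> y)" by (intro continuous_intros phi(1))
    have "\<forall>\<^sub>F k in sequentially. \<exists>i\<in>UNIV. \<exists>z\<in>closure \<Omega>. dist z x < min r1 r2 \<and> (\<exists>e>0. \<forall>y\<in>closure \<Omega>. y \<in> ball z e \<longrightarrow>
      - W k i y - (- \<phi> y + (y - x) \<bullet> (y - x)) \<le> - W k i z - (- \<phi> z + (z - x) \<bullet> (z - x))) \<and> (\<forall>j\<in>UNIV. - W k j z \<le> - W k i z)"
      by (rule perturbed_max[OF compact_cl _ _ Wc Wu mpc x mx]) (use r1 r2 in auto)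
    moreover have "\<forall>\<^sub>F k in sequentially. d k * (Lb + 2 * real CARD('n) + (Mb + \<Lambda>) + real CARD('m) * Mb) < \<mu>" by (rule d_small[OF mu(1)])
    ultimately have "\<forall>\<^sub>F k in sequentially. False"
    proof eventually_elim
      case (elim k)
      interpret s: hj_system \<Omega> \<nu> h gh Hh Hm G Q b M "W k" "gW k" "HW k" "d k" "lam k" B Mb c by (rule sys)
      from elim(1) obtain i z where z': "z \<in> closure \<Omega>" "dist z x < min r1 r2"
        and ex: "\<exists>e>0. \<forall>y\<in>closure \<Omega>. y \<in> ball z e \<longrightarrow>
           - W k i y - (- \<phi> y + (y - x) \<bullet> (y - x)) \<le> - W k i z - (- \<phi> z + (z - x) \<bullet> (z - x))"
        and opt': "\<forall>j\<in>UNIV. - W k j z \<le> - W k i z" by blast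
      from ex obtain e where e: "e > 0"
        and m: "\<And>y. y \<in> closure \<Omega> \<Longrightarrow> y \<in> ball z e \<Longrightarrow>
           - W k i y - (- \<phi> y + (y - x) \<bullet> (y - x)) \<le> - W k i z - (- \<phi> z + (z - x) \<bullet> (z - x))" by blast
      have z: "z \<in> closure \<Omega>" "dist z x < r1" "dist z x < r2" using z' by auto
      have opt: "W k i z \<le> W k j z" for j using opt' by auto
      have zO: "z \<in> \<Omega>"
      proof (rule ccontr)
        assume "z \<notin> \<Omega>"
        then have zf: "z \<in> frontier \<Omega>" using cl_cases z by auto
        have "((\<lambda>y. - W k i y - (- \<phi> y + (y - x) \<bullet> (y - x))) has_derivative
            (\<lambda>v. - (gW k i z \<bullet> v) - (- (grad (closure \<Omega>) \<phi> z \<bullet> v) + (2 *\<^sub>R (z - x)) \<bullet> v))) (at z within closure \<Omega>)"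
          by (intro has_derivative_diff has_derivative_add has_derivative_minus s.W1 phi(4) z(1) has_derivative_sqdist)
        from frontier_max[OF zf this e m] have "(- P z) \<bullet> \<nu> z \<le> 0"
          using s.neumann[OF zf, of i] by (simp add: P_def inner_diff_left)
        with r2(2)[OF zf z(3)] show False by simp
      qed
      obtain e' where e': "e' > 0" "e' \<le> e" "ball z e' \<subseteq> \<Omega>"
      proof -
        obtain e1 where "e1 > 0" "ball z e1 \<subseteq> \<Omega>" using open_dom zO open_contains_ball by blast
        then show thesis using e by (intro that[of "min e e1"]) auto
      qed
      have zi: "z \<in> interior (closure \<Omega>)" using zO open_dom interior_maximal[OF closure_subset] by blast
      have td: "twice_diff_at (\<lambda>y. \<phi> y + (-1) * ((y - x) \<bullet> (y - x)))
          (\<lambda>y. grad (closure \<Omega>) \<phi> y + (-1) *\<^sub>R (2 *\<^sub>R (y - x))) (\<lambda>y v. hess (closure \<Omega>) \<phi> y v + (-1) *\<^sub>R (2 *\<^sub>R v)) z"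
        by (intro twice_diff_at_add twice_diff_at_cmult Ck2_twice_diff_at[OF conjunct1[OF A] zi] twice_diff_at_sqdist)
      have m': "(\<phi> y + (-1) * ((y - x) \<bullet> (y - x))) - W k i y \<le> (\<phi> z + (-1) * ((z - x) \<bullet> (z - x))) - W k i z"
        if "y \<in> ball z e'" for y
        using m[of y] e' in_cl that by auto
      note op = one_point_max[OF td s.W2[OF zO, of i] e'(1) m']
      have gP: "gW k i z = P z" using op(1) by (simp add: P_def)
      have tP: "laplacian (closure \<Omega>) \<phi> z - 2 * real CARD('n) \<le> tr (HW k i z)"
        using op(2) unfolding tr_add tr_scaleR tr_id tr_hess by simp
      have "- (Lb + 2 * real CARD('n)) \<le> tr (HW k i z)" using tP Lb[OF z(1)] by linarith
      then have lo: "d k * (- (Lb + 2 * real CARD('n))) \<le> d k * tr (HW k i z)" using s.d0 by (intro mult_left_mono) auto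
      have "- (Mb + \<Lambda>) \<le> M z $ i $ i - lam k" using diagonal_minus_eigenvalue_bound[OF z(1), of i k] by linarith
      then have ml: "d k * (- (Mb + \<Lambda>)) \<le> d k * (M z $ i $ i - lam k)" using s.d0 by (intro mult_left_mono) auto
      have cp: "s.coupling i z \<le> d k * (real CARD('m) * Mb)" by (rule s.coupling_le[OF z(1) opt])
      have "- \<theta> i z > \<mu>" using r0(2)[OF z(1), of i] z(2) r1(2)[of i] by simp
      moreover have "d k * tr (HW k i z) = \<theta> i z + s.coupling i z - d k * (M z $ i $ i - lam k)"
        using s.hj_eq'[OF zO, of i] by (simp add: gP \<theta>_def)
      ultimately show False using lo ml cp elim(2) unfolding distrib_left mult_minus_right by linarith
    qed
    then show False by simp
  qed
  moreover have "x \<notin> frontier \<Omega>" if "x \<in> \<Omega>" using that open_dom by (auto simp: frontier_def interior_open)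
  ultimately have fin: "x \<in> \<Omega> \<longrightarrow> 0 \<le> hamiltonian b x (grad (closure \<Omega>) \<phi> x)"
     "x \<in> frontier \<Omega> \<longrightarrow> 0 \<le> max (hamiltonian b x (grad (closure \<Omega>) \<phi> x)) (normal_deriv \<Omega> \<nu> \<phi> x)" by auto
  show "0 \<le> hamiltonian b x (grad (closure \<Omega>) \<phi> x)" if "x \<in> \<Omega>" using fin that by blast
  show "0 \<le> max (hamiltonian b x (grad (closure \<Omega>) \<phi> x)) (normal_deriv \<Omega> \<nu> \<phi> x)" if "x \<in> frontier \<Omega>"
    using fin that by blast
qed

end

section \<open>Equicontinuity and the common limit\<close>

text \<open>
  A two-point estimate with an error \<open>\<omega> k\<close> tending to zero gives equicontinuity and, through chains of points, boundedness.  For \<open>x = y\<close> it also shows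
  that all components have the same limit.
\<close>
lemma asymptotic_lipschitz_limit:
  fixes U :: "nat \<Rightarrow> 'm::finite \<Rightarrow> 'a::euclidean_space \<Rightarrow> real"
  assumes S: "compact S" "connected S" "S \<noteq> {}"
    and cont: "\<And>k i. continuous_on S (U k i)"
    and est: "\<And>k i j x y. x \<in> S \<Longrightarrow> y \<in> S \<Longrightarrow> norm (x - y) \<le> r \<Longrightarrow> U k i x - U k j y \<le> \<omega> k + C * norm (x - y)"
    and r: "r > 0" and C: "C \<ge> 0" and om: "\<omega> \<longlonglongrightarrow> 0"
    and nn: "\<And>k i x. x \<in> S \<Longrightarrow> 0 \<le> U k i x" and zero: "\<And>k. \<exists>i. \<exists>x\<in>S. U k i x = 0"
  obtains s V L B where "strict_mono (s :: nat \<Rightarrow> nat)" "continuous_on S V"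
    "\<And>i. uniform_limit S (\<lambda>k. U (s k) i) V sequentially"
    "L \<ge> 0" "\<And>x y. x \<in> S \<Longrightarrow> y \<in> S \<Longrightarrow> \<bar>V x - V y\<bar> \<le> L * norm (x - y)"
    "B \<ge> 0" "\<And>x. x \<in> S \<Longrightarrow> \<bar>V x\<bar> \<le> B" "\<And>x. x \<in> S \<Longrightarrow> 0 \<le> V x" "\<exists>x\<in>S. V x = 0"
proof -
  obtain x00 where x00: "x00 \<in> S" using S(3) by auto
  have om0: "\<omega> k \<ge> 0" for k using est[OF x00 x00, of k undefined undefined] r by simp
  obtain \<Theta> where Th: "\<And>k. \<omega> k \<le> \<Theta>"
    using convergent_imp_Bseq[OF convergentI[OF om]] om0 unfolding Bseq_def by (auto simp: abs_of_nonneg)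
  have Th0: "\<Theta> \<ge> 0" using Th[of 0] om0[of 0] by linarith
  define i0 :: 'm where "i0 = undefined"
  obtain n :: nat where n: "\<And>(f::'a \<Rightarrow> real) c x y. 0 \<le> c \<Longrightarrow>
      (\<And>x y. x \<in> S \<Longrightarrow> y \<in> S \<Longrightarrow> dist x y < r \<Longrightarrow> f x \<le> f y + c) \<Longrightarrow> x \<in> S \<Longrightarrow> y \<in> S \<Longrightarrow> f x \<le> f y + real n * c"
    by (rule connected_chain_bound[OF S(1,2) r]) blast
  define B where "B = \<Theta> + real n * (\<Theta> + C * r)"
  have B0: "B \<ge> 0" using Th0 C r by (simp add: B_def)
  have Ub: "\<bar>U k i0 x\<bar> \<le> B" if x: "x \<in> S" for k x
  proof -
    obtain j z where z: "z \<in> S" "U k j z = 0" using zero by blast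
    have "U k i0 x \<le> U k i0 z + real n * (\<Theta> + C * r)"
    proof (rule n[OF _ _ x z(1)])
      show "0 \<le> \<Theta> + C * r" using Th0 C r by simp
      fix u v assume uv: "u \<in> S" "v \<in> S" "dist u v < r"
      then have "U k i0 u - U k i0 v \<le> \<omega> k + C * norm (u - v)" by (intro est) (auto simp: dist_norm)
      moreover have "C * norm (u - v) \<le> C * r" using uv C by (intro mult_left_mono) (auto simp: dist_norm)
      ultimately show "U k i0 u \<le> U k i0 v + (\<Theta> + C * r)" using Th[of k] by linarith
    qed
    moreover have "U k i0 z - U k j z \<le> \<omega> k + C * norm (z - z)" using z r by (intro est) auto
    ultimately show ?thesis using z(2) nn[OF x, of k i0] Th[of k] unfolding B_def by simp
  qed
  have eq: "\<exists>\<delta>. 0 < \<delta> \<and> (\<forall>k y. y \<in> S \<and> norm (x - y) < \<delta> \<longrightarrow> norm (U k i0 x - U k i0 y) < e)"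
    if x: "x \<in> S" and e: "0 < e" for x e
  proof -
    obtain N where N: "\<And>k. k \<ge> N \<Longrightarrow> \<omega> k < e / 2"
      using order_tendstoD(2)[OF om, of "e / 2"] e by (auto simp: eventually_sequentially)
    have "\<forall>k. \<exists>\<delta>>0. \<forall>y\<in>S. norm (x - y) < \<delta> \<longrightarrow> norm (U k i0 x - U k i0 y) < e"
    proof
      fix k
      obtain \<delta> where "\<delta> > 0" "\<forall>y\<in>S. dist y x < \<delta> \<longrightarrow> dist (U k i0 y) (U k i0 x) < e"
        using cont[of k i0] x e unfolding continuous_on_iff by blast
      then show "\<exists>\<delta>>0. \<forall>y\<in>S. norm (x - y) < \<delta> \<longrightarrow> norm (U k i0 x - U k i0 y) < e"
        by (intro exI[of _ \<delta>]) (auto simp: dist_norm norm_minus_commute dist_real_def abs_minus_commute)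
    qed
    then obtain \<Delta> where \<Delta>: "\<And>k. \<Delta> k > 0" "\<And>k y. y \<in> S \<Longrightarrow> norm (x - y) < \<Delta> k \<Longrightarrow> norm (U k i0 x - U k i0 y) < e"
      by metis
    define \<delta> where "\<delta> = Min (insert (min r (e / (2 * (C + 1)))) (\<Delta> ` {..<N}))"
    show ?thesis
    proof (intro exI[of _ \<delta>] conjI allI impI)
      show "0 < \<delta>" unfolding \<delta>_def using \<Delta>(1) r e C by (subst Min_gr_iff) auto
      fix k y assume y: "y \<in> S \<and> norm (x - y) < \<delta>"
      show "norm (U k i0 x - U k i0 y) < e"
      proof (cases "k < N")
        case True
        then have "\<delta> \<le> \<Delta> k" unfolding \<delta>_def by (intro Min_le) auto
        then show ?thesis using \<Delta>(2)[of y k] y by auto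
      next
        case False
        have "\<delta> \<le> min r (e / (2 * (C + 1)))" unfolding \<delta>_def by (intro Min_le) auto
        then have d: "norm (x - y) \<le> r" "norm (x - y) \<le> e / (2 * (C + 1))" using y by auto
        have "C * norm (x - y) \<le> C * (e / (2 * (C + 1)))" using d C by (intro mult_left_mono) auto
        also have "\<dots> \<le> e / 2" using C e by (simp add: field_simps)
        finally have c: "C * norm (x - y) \<le> e / 2" .
        have "U k i0 x - U k i0 y \<le> \<omega> k + C * norm (x - y)" using x y d by (intro est) auto
        moreover have "U k i0 y - U k i0 x \<le> \<omega> k + C * norm (y - x)"
          using x y d by (intro est) (auto simp: norm_minus_commute)
        moreover have "\<omega> k < e / 2" using False N by simp
        ultimately have "U k i0 x - U k i0 y < e / 2 + e / 2" "U k i0 y - U k i0 x < e / 2 + e / 2"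
          using c by (auto simp only: norm_minus_commute[of y x])
        then show ?thesis by (simp add: abs_less_iff)
      qed
    qed
  qed
  obtain V s where V: "continuous_on S V" and s: "strict_mono (s :: nat \<Rightarrow> nat)"
    and lim: "\<And>e. 0 < e \<Longrightarrow> \<exists>N. \<forall>k x. k \<ge> N \<and> x \<in> S \<longrightarrow> norm (U (s k) i0 x - V x) < e"
    by (rule Arzela_Ascoli[of S "\<lambda>k. U k i0" B]) (use S(1) Ub eq in auto)
  have oms: "(\<lambda>k. \<omega> (s k)) \<longlonglongrightarrow> 0" using LIMSEQ_subseq_LIMSEQ[OF om s] by (simp add: o_def)
  have unif: "uniform_limit S (\<lambda>k. U (s k) i) V sequentially" for i
  proof (rule uniform_limitI)
    fix e :: real assume e: "e > 0"
    obtain N where N: "\<And>k x. k \<ge> N \<Longrightarrow> x \<in> S \<Longrightarrow> norm (U (s k) i0 x - V x) < e / 2" using lim[of "e / 2"] e by auto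
    have "\<forall>\<^sub>F k in sequentially. \<omega> (s k) < e / 2" using order_tendstoD(2)[OF oms, of "e / 2"] e by simp
    moreover have "\<forall>\<^sub>F k in sequentially. k \<ge> N" by (rule eventually_ge_at_top)
    ultimately show "\<forall>\<^sub>F k in sequentially. \<forall>x\<in>S. dist (U (s k) i x) (V x) < e"
    proof eventually_elim
      case (elim k)
      show ?case
      proof
        fix x assume x: "x \<in> S"
        have "U (s k) i x - U (s k) i0 x \<le> \<omega> (s k) + C * norm (x - x)" "U (s k) i0 x - U (s k) i x \<le> \<omega> (s k) + C * norm (x - x)"
          by (rule est; use x r in simp)+
        then have "\<bar>U (s k) i x - U (s k) i0 x\<bar> \<le> \<omega> (s k)" by (simp add: abs_le_iff)
        then have "\<bar>U (s k) i x - U (s k) i0 x\<bar> < e / 2" using elim(1) by (rule le_less_trans)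
        moreover have "\<bar>U (s k) i0 x - V x\<bar> < e / 2" using N[OF elim(2) x] by simp
        ultimately show "dist (U (s k) i x) (V x) < e" unfolding dist_real_def by linarith
      qed
    qed
  qed
  have pt: "(\<lambda>k. U (s k) i x) \<longlonglongrightarrow> V x" if "x \<in> S" for i x by (rule tendsto_uniform_limitI[OF unif that])
  have Vnn: "0 \<le> V x" if "x \<in> S" for x
    by (rule LIMSEQ_le_const[OF pt[OF that, of i0]]) (use nn[OF that] in auto)
  have VB: "\<bar>V x\<bar> \<le> B" if "x \<in> S" for x
    by (rule LIMSEQ_le_const2[OF tendsto_rabs[OF pt[OF that, of i0]]]) (use Ub[OF that] in auto)
  have loc: "V x - V y \<le> C * norm (x - y)" if "x \<in> S" "y \<in> S" "norm (x - y) \<le> r" for x y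
  proof -
    have u: "(\<lambda>k. \<omega> (s k) + C * norm (x - y)) \<longlonglongrightarrow> 0 + C * norm (x - y)" by (intro tendsto_intros oms)
    have l: "(\<lambda>k. U (s k) i0 x - U (s k) i0 y) \<longlonglongrightarrow> V x - V y" using that by (intro tendsto_diff pt)
    have "V x - V y \<le> 0 + C * norm (x - y)" by (rule LIMSEQ_le[OF l u]) (use est[OF that] in blast)
    then show ?thesis by simp
  qed
  define L where "L = max C (2 * B / r)"
  have lip: "\<bar>V x - V y\<bar> \<le> L * norm (x - y)" if "x \<in> S" "y \<in> S" for x y
  proof (cases "norm (x - y) \<le> r")
    case True
    then have "\<bar>V x - V y\<bar> \<le> C * norm (x - y)" using loc[OF that] loc[OF that(2,1)] by (simp add: abs_le_iff norm_minus_commute)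
    also have "\<dots> \<le> L * norm (x - y)" by (intro mult_right_mono) (auto simp: L_def)
    finally show ?thesis .
  next
    case False
    have "\<bar>V x - V y\<bar> \<le> 2 * B" using VB[OF that(1)] VB[OF that(2)] by linarith
    also have "\<dots> = 2 * B / r * r" using r by simp
    also have "\<dots> \<le> L * norm (x - y)" using False B0 r by (intro mult_mono) (auto simp: L_def le_max_iff_disj)
    finally show ?thesis .
  qed
  have L0: "L \<ge> 0" using C by (simp add: L_def)
  have V0: "\<exists>x\<in>S. V x = 0"
  proof -
    obtain z where z: "z \<in> S" "\<And>y. y \<in> S \<Longrightarrow> V z \<le> V y" using continuous_attains_inf[OF S(1,3) V] by blast
    have "V z \<le> 0"
    proof (rule field_le_epsilon)
      fix e :: real assume e: "e > 0"
      have "\<forall>\<^sub>F k in sequentially. \<forall>i\<in>UNIV. \<forall>x\<in>S. dist (U (s k) i x) (V x) < e"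
        unfolding eventually_ball_finite_distrib[OF finite] using uniform_limitD[OF unif e] by blast
      then obtain k where k: "\<forall>i\<in>UNIV. \<forall>x\<in>S. dist (U (s k) i x) (V x) < e" by (auto simp: eventually_sequentially)
      obtain i y where "y \<in> S" "U (s k) i y = 0" using zero by blast
      then have "V y < e" using k by (auto simp: dist_real_def) (metis abs_ge_self abs_minus_cancel diff_0 le_less_trans)
      then show "V z \<le> 0 + e" using z(2)[OF \<open>y \<in> S\<close>] by simp
    qed
    then show ?thesis using Vnn[OF z(1)] z(1) by (intro bexI[of _ z]) auto
  qed
  show thesis by (rule that[OF s V unif L0 _ B0]) (use lip VB Vnn V0 in auto)
qed

section \<open>The geometry of a bounded $C^2$ domain\<close>

lemma compact_continuous_bound:
  fixes f :: "'a::topological_space \<Rightarrow> 'b::real_normed_vector"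
  assumes "compact K" "continuous_on K f"
  obtains C where "\<And>x. x \<in> K \<Longrightarrow> norm (f x) \<le> C"
proof -
  have "bounded (f ` K)" using assms by (intro compact_imp_bounded compact_continuous_image)
  then obtain C where "\<forall>y\<in>f ` K. norm y \<le> C" unfolding bounded_iff by blast
  then show thesis by (intro that[of C]) auto
qed

lemma Ck2_bounds:
  fixes f :: "real^'n::finite \<Rightarrow> real"
  assumes f: "Ck_on 2 S f" and K: "compact K" "K \<subseteq> S"
  obtains G where "G \<ge> 0" "\<And>x v. x \<in> K \<Longrightarrow> norm (hess S f x v) \<le> G * norm v" "\<And>x. x \<in> K \<Longrightarrow> norm (grad S f x) \<le> G"
proof -
  have "continuous_on S (pd S l (pd S k f))" "continuous_on S (pd S k f)" for k l
    using f by (auto simp: numeral_2_eq_2 differentiable_imp_continuous_on)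
  then have c: "continuous_on K (pd S l (pd S k f))" "continuous_on K (pd S k f)" for k l
    by (blast intro: continuous_on_subset[OF _ K(2)])+
  have "continuous_on K (\<lambda>x. \<Sum>l\<in>UNIV. norm (\<chi> k. pd S l (pd S k f) x))"
    by (intro continuous_intros continuous_on_vec_lambda c)
  from compact_continuous_bound[OF K(1) this]
  obtain G1 where G1: "\<And>x. x \<in> K \<Longrightarrow> norm (\<Sum>l\<in>UNIV. norm (\<chi> k. pd S l (pd S k f) x)) \<le> G1" by metis
  have "continuous_on K (grad S f)" unfolding grad_def[abs_def] by (intro continuous_on_vec_lambda c)
  from compact_continuous_bound[OF K(1) this]
  obtain G2 where G2: "\<And>x. x \<in> K \<Longrightarrow> norm (grad S f x) \<le> G2" by metis
  show thesis
  proof (rule that[of "max 0 (max G1 G2)"])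
    fix x v assume x: "x \<in> K"
    have "norm (hess S f x v) \<le> (\<Sum>l\<in>UNIV. norm (v $ l *\<^sub>R (\<chi> k. pd S l (pd S k f) x)))"
      unfolding hess_def by (rule norm_sum)
    also have "\<dots> \<le> (\<Sum>l\<in>UNIV. norm v * norm (\<chi> k. pd S l (pd S k f) x))"
      using component_le_norm_cart[of v] by (intro sum_mono) (simp add: mult_right_mono)
    also have "\<dots> = norm v * (\<Sum>l\<in>UNIV. norm (\<chi> k. pd S l (pd S k f) x))" by (simp add: sum_distrib_left)
    also have "\<dots> \<le> norm v * max 0 (max G1 G2)" using G1[OF x] by (intro mult_left_mono) (auto simp: abs_le_iff)
    finally show "norm (hess S f x v) \<le> max 0 (max G1 G2) * norm v" by (simp add: mult.commute)
  next
    fix x assume x: "x \<in> K"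
    show "norm (grad S f x) \<le> max 0 (max G1 G2)" using G2[OF x] by simp
  qed simp
qed

text \<open>
  The defining function, shifted by a constant so as to be nonnegative.  Since it is largest on the boundary, a second-order expansion at a boundary point
  gives the inequality with the constant \<open>Q = G\<close> that measures the failure of convexity.
\<close>
lemma C2_domain_geometry:
  fixes \<Omega> :: "(real^'n::finite) set"
  assumes D: "bounded_C2_domain \<Omega>" and nu: "outward_unit_normal \<Omega> \<nu>"
  obtains h gh Hh Hm G where "neumann_geometry \<Omega> \<nu> h gh Hh Hm G G"
    "\<And>x. x \<in> frontier \<Omega> \<Longrightarrow> \<exists>\<sigma>\<ge>1. gh x = \<sigma> *\<^sub>R \<nu> x"
proof -
  have O: "open \<Omega>" "bounded \<Omega>" "\<Omega> \<noteq> {}" using D by (auto simp: bounded_C2_domain_def)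
  obtain h0 where C: "Ck_on 2 UNIV h0" and h00: "\<And>x. x \<in> frontier \<Omega> \<Longrightarrow> h0 x = 0" and h0n: "\<And>x. x \<in> closure \<Omega> \<Longrightarrow> h0 x \<le> 0"
    and par: "\<And>x. x \<in> frontier \<Omega> \<Longrightarrow> \<exists>\<sigma>\<ge>1. grad UNIV h0 x = \<sigma> *\<^sub>R \<nu> x"
    by (rule defining_function[OF D nu]) blast
  let ?gh = "grad UNIV h0" and ?Hh = "hess UNIV h0"
  have td: "twice_diff_at h0 ?gh ?Hh x" for x by (rule Ck2_twice_diff_at[OF C]) simp
  have c: "continuous_on (closure \<Omega>) h0" using Ck2_C1(2)[OF C] by (rule continuous_on_subset) simp
  obtain R where R: "\<And>x. x \<in> closure \<Omega> \<Longrightarrow> norm x \<le> R" using O(2) bounded_closure[of \<Omega>] by (auto simp: bounded_iff)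
  let ?S = "cball 0 R :: (real^'n) set"
  have clS: "closure \<Omega> \<subseteq> ?S" using R by auto
  obtain G where G0: "G \<ge> 0" and GH: "\<And>x v. x \<in> ?S \<Longrightarrow> norm (?Hh x v) \<le> G * norm v" and Gg: "\<And>x. x \<in> ?S \<Longrightarrow> norm (?gh x) \<le> G"
    by (rule Ck2_bounds[OF C compact_cball subset_UNIV]) blast
  have lipg: "norm (?gh x - ?gh y) \<le> G * norm (x - y)" if "x \<in> ?S" "y \<in> ?S" for x y
  proof (rule differentiable_bound[of ?S ?gh ?Hh])
    fix z :: "real^'n" assume z: "z \<in> ?S"
    show "(?gh has_derivative ?Hh z) (at z within ?S)"
      using td[of z] by (auto simp: twice_diff_at_def intro: has_derivative_at_withinI)
    show "onorm (?Hh z) \<le> G" by (rule onorm_bound[OF G0 GH[OF z]])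
  qed (use that in auto)
  have curv: "(x - y) \<bullet> \<nu> x \<ge> - G * (norm (x - y))\<^sup>2" if x: "x \<in> frontier \<Omega>" and y: "y \<in> closure \<Omega>" for x y
  proof -
    have xS: "x \<in> ?S" and yS: "y \<in> ?S" using clS x y by (auto simp: frontier_def)
    define w where "w = y - x"
    have der: "((\<lambda>t. h0 (x + t *\<^sub>R w)) has_real_derivative ?gh (x + t *\<^sub>R w) \<bullet> w) (at t)" for t
    proof -
      have l: "((\<lambda>t. x + t *\<^sub>R w) has_derivative (\<lambda>s. s *\<^sub>R w)) (at t)"
        by (auto intro!: derivative_eq_intros)
      from has_derivative_compose[OF l twice_diff_at_DERIV[OF td]] show ?thesis
        by (simp add: has_field_derivative_def mult_commute_abs)
    qed
    obtain t where t: "0 < t" "t < 1" "h0 (x + 1 *\<^sub>R w) - h0 (x + 0 *\<^sub>R w) = (1 - 0) * (?gh (x + t *\<^sub>R w) \<bullet> w)"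
      using MVT2[of 0 1 "\<lambda>t. h0 (x + t *\<^sub>R w)" "\<lambda>t. ?gh (x + t *\<^sub>R w) \<bullet> w"] der by auto
    then have "?gh (x + t *\<^sub>R w) \<bullet> w = h0 y - h0 x" by (simp add: w_def)
    also have "\<dots> \<le> 0" using h0n[OF y] h00[OF x] by simp
    finally have 1: "?gh (x + t *\<^sub>R w) \<bullet> w \<le> 0" .
    have "x + t *\<^sub>R w = (1 - t) *\<^sub>R x + t *\<^sub>R y" by (simp add: w_def algebra_simps)
    then have zS: "x + t *\<^sub>R w \<in> ?S" using convexD[OF convex_cball xS yS, of "1 - t" t] t by simp
    have "norm (?gh x - ?gh (x + t *\<^sub>R w)) \<le> G * norm (x - (x + t *\<^sub>R w))" by (rule lipg[OF xS zS])
    also have "\<dots> \<le> G * norm w" using t G0 by (intro mult_left_mono) (auto simp: mult_left_le_one_le)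
    finally have "norm (?gh x - ?gh (x + t *\<^sub>R w)) * norm w \<le> G * norm w * norm w" by (rule mult_right_mono) simp
    then have "(?gh x - ?gh (x + t *\<^sub>R w)) \<bullet> w \<le> G * norm w * norm w"
      using Cauchy_Schwarz_ineq2[of "?gh x - ?gh (x + t *\<^sub>R w)" w] by linarith
    then have 2: "?gh x \<bullet> w \<le> G * (norm w)\<^sup>2" using 1 by (simp add: inner_diff_left power2_eq_square mult.assoc)
    obtain \<sigma> where s: "\<sigma> \<ge> 1" "?gh x = \<sigma> *\<^sub>R \<nu> x" using par[OF x] by auto
    have 3: "\<sigma> * (\<nu> x \<bullet> w) \<le> G * (norm w)\<^sup>2" using 2 s by simp
    have "\<nu> x \<bullet> w \<le> G * (norm w)\<^sup>2"
    proof (cases "\<nu> x \<bullet> w \<le> 0")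
      case True then show ?thesis using G0 by (meson mult_nonneg_nonneg order_trans zero_le_power2)
    next
      case False
      then have "\<nu> x \<bullet> w \<le> \<sigma> * (\<nu> x \<bullet> w)" using s(1) by simp
      with 3 show ?thesis by linarith
    qed
    moreover have "(x - y) \<bullet> \<nu> x = - (\<nu> x \<bullet> w)" by (simp add: w_def inner_diff_right inner_diff_left inner_commute)
    ultimately show ?thesis by (simp add: w_def norm_minus_commute)
  qed
  obtain Hm where Hm: "\<And>x. x \<in> closure \<Omega> \<Longrightarrow> \<bar>h0 x\<bar> \<le> Hm"
    using compact_continuous_bound[OF _ c] O(2) by (metis compact_closure real_norm_def)
  have "neumann_geometry \<Omega> \<nu> (\<lambda>x. h0 x + Hm) ?gh ?Hh Hm G G"
  proof
    show "open \<Omega>" "bounded \<Omega>" "\<Omega> \<noteq> {}" using O by auto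
    show "\<forall>\<^sub>F t in at_right 0. x - t *\<^sub>R \<nu> x \<in> \<Omega>" if "x \<in> frontier \<Omega>" for x by (rule outward_normal_unit_exterior(2)[OF O(1) nu that])
    show "twice_diff_at (\<lambda>x. h0 x + Hm) ?gh ?Hh x" for x
      using td[of x] unfolding twice_diff_at_def
      by (auto elim!: eventually_mono intro!: derivative_eq_intros)
    show "0 \<le> h0 x + Hm" if "x \<in> closure \<Omega>" for x using Hm[OF that] by linarith
    show "h0 x + Hm \<le> Hm" if "x \<in> closure \<Omega>" for x using h0n[OF that] by simp
    show "norm (?gh x) \<le> G" if "x \<in> closure \<Omega>" for x using Gg clS that by blast
    show "norm (?Hh x v) \<le> G * norm v" if "x \<in> closure \<Omega>" for x v using GH clS that by blast
    show "1 \<le> ?gh x \<bullet> \<nu> x" if "x \<in> frontier \<Omega>" for x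
      using par[OF that] outward_normal_unit_exterior(1)[OF O(1) nu that] by (auto simp: dot_square_norm)
    show "- G * (norm (x - y))\<^sup>2 \<le> (x - y) \<bullet> \<nu> x" if "x \<in> frontier \<Omega>" "y \<in> closure \<Omega>" for x y by (rule curv[OF that])
    show "0 \<le> G" by (rule G0)
  qed
  then show thesis using par by (rule that)
qed

section \<open>The logarithmic transformation\<close>

lemma twice_diff_at_cong_grad:
  assumes "twice_diff_at f g H x" "\<forall>\<^sub>F y in nhds x. g y = g' y"
  shows "twice_diff_at f g' H x"
proof -
  have "\<forall>\<^sub>F y in nhds x. (f has_derivative (\<lambda>v. g y \<bullet> v)) (at y)" using assms(1) by (simp add: twice_diff_at_def)
  then have "\<forall>\<^sub>F y in nhds x. (f has_derivative (\<lambda>v. g' y \<bullet> v)) (at y)"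
    using assms(2) by eventually_elim simp
  moreover have "(g has_derivative H x) (at x)" using assms(1) by (simp add: twice_diff_at_def)
  then have "(g' has_derivative H x) (at x)"
    by (rule has_derivative_transform_eventually)
      (use assms(2) eventually_nhds_x_imp_x in \<open>auto simp: eventually_at_filter elim: eventually_mono\<close>)
  ultimately show ?thesis by (simp add: twice_diff_at_def)
qed

lemma twice_diff_at_ln:
  assumes f: "twice_diff_at f g H x" and pos: "f x > 0"
  shows "twice_diff_at (\<lambda>y. k * ln (f y)) (\<lambda>y. (k / f y) *\<^sub>R g y)
     (\<lambda>y v. (k / f y) *\<^sub>R H y v - (k * (g y \<bullet> v) / (f y)\<^sup>2) *\<^sub>R g y) x"
proof -
  have d: "(f has_derivative (\<lambda>v. g x \<bullet> v)) (at x)" by (rule twice_diff_at_DERIV[OF f])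
  have "(f \<longlongrightarrow> f x) (nhds x)"
    using has_derivative_continuous[OF d] by (simp add: continuous_at tendsto_at_iff_tendsto_nhds)
  then have p: "\<forall>\<^sub>F y in nhds x. f y > 0" using pos by (rule order_tendstoD(1))
  have "\<forall>\<^sub>F y in nhds x. (f has_derivative (\<lambda>v. g y \<bullet> v)) (at y)" using f by (simp add: twice_diff_at_def)
  with p have "\<forall>\<^sub>F y in nhds x. ((\<lambda>y. k * ln (f y)) has_derivative (\<lambda>v. ((k / f y) *\<^sub>R g y) \<bullet> v)) (at y)"
  proof eventually_elim
    case (elim y)
    have "((\<lambda>z. k * ln (f z)) has_derivative (\<lambda>v. k * (g y \<bullet> v * inverse (f y)))) (at y)"
      by (intro has_derivative_mult_right has_derivative_ln elim)
    then show ?case by (rule has_derivative_eq_rhs) (auto simp: divide_inverse)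
  qed
  moreover have "((\<lambda>y. (k / f y) *\<^sub>R g y) has_derivative
      (\<lambda>v. (k / f x) *\<^sub>R H x v - (k * (g x \<bullet> v) / (f x)\<^sup>2) *\<^sub>R g x)) (at x)"
  proof -
    have "(g has_derivative H x) (at x)" using f by (simp add: twice_diff_at_def)
    moreover have "((\<lambda>y. k / f y) has_derivative (\<lambda>v. - (k * (g x \<bullet> v) / (f x)\<^sup>2))) (at x)"
      using pos by (auto intro!: derivative_eq_intros d simp: power2_eq_square divide_inverse)
    ultimately have "((\<lambda>y. (k / f y) *\<^sub>R g y) has_derivative
      (\<lambda>v. (k / f x) *\<^sub>R H x v + (- (k * (g x \<bullet> v) / (f x)\<^sup>2)) *\<^sub>R g x)) (at x)"
      by (intro has_derivative_scaleR)
    then show ?thesis by simp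
  qed
  ultimately show ?thesis by (simp add: twice_diff_at_def)
qed

lemma tr_diff_rank_one: "tr (\<lambda>v. H v - (k * (g \<bullet> v)) *\<^sub>R g) = tr H - k * (g \<bullet> g)" for g :: "real^'n::finite"
proof -
  have "(\<Sum>l\<in>UNIV. (g \<bullet> axis l 1) * (g \<bullet> axis l 1)) = g \<bullet> g" by (rule inner_expand[symmetric])
  then show ?thesis
    by (simp add: tr_def inner_diff_left sum_subtractf mult.assoc sum_distrib_left[symmetric])
qed

text \<open>The logarithmic transformation turns the eigenvalue problem into a viscous Hamilton--Jacobi system.\<close>

lemma (in neumann_geometry) eigenfunction_hj_system:
  fixes b :: "'m::finite \<Rightarrow> real^'n \<Rightarrow> real^'n" and M :: "real^'n \<Rightarrow> real^'m^'m" and \<phi> :: "'m \<Rightarrow> real^'n \<Rightarrow> real"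
  assumes d: "0 < d" "d \<le> 1" and ef: "eigenfunction \<Omega> \<nu> b M d \<kappa> \<phi>"
    and pos: "\<And>i x. x \<in> closure \<Omega> \<Longrightarrow> 0 < \<phi> i x"
    and b_le: "\<And>i x. x \<in> closure \<Omega> \<Longrightarrow> norm (b i x) \<le> B"
    and M_le: "\<And>i j x. x \<in> closure \<Omega> \<Longrightarrow> \<bar>M x $ i $ j\<bar> \<le> Mb"
    and M_off: "\<And>i j x. x \<in> closure \<Omega> \<Longrightarrow> i \<noteq> j \<Longrightarrow> M x $ i $ j \<le> - c" and c0: "c > 0"
  shows "hj_system \<Omega> \<nu> h gh Hh Hm G Q b M (\<lambda>i x. - d * ln (\<phi> i x))
    (\<lambda>i x. (- d / \<phi> i x) *\<^sub>R grad (closure \<Omega>) (\<phi> i) x)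
    (\<lambda>i x v. (- d / \<phi> i x) *\<^sub>R hess \<Omega> (\<phi> i) x v -
        (- d * (grad (closure \<Omega>) (\<phi> i) x \<bullet> v) / (\<phi> i x)\<^sup>2) *\<^sub>R grad (closure \<Omega>) (\<phi> i) x)
    d \<kappa> B Mb c"
proof unfold_locales
  have nd: "neumann_domain \<Omega> \<nu> \<phi>" and pde: "\<And>i x. x \<in> \<Omega> \<Longrightarrow> system_op \<Omega> d b M \<phi> i x = \<kappa> * \<phi> i x"
    using ef by (auto simp: eigenfunction_def)
  have C2: "\<And>i. Ck_on 2 \<Omega> (\<phi> i)" and C1: "\<And>i. Ck_on 1 (closure \<Omega>) (\<phi> i)"
    and nm: "\<And>i x. x \<in> frontier \<Omega> \<Longrightarrow> normal_deriv \<Omega> \<nu> (\<phi> i) x = 0"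
    using nd by (auto simp: neumann_domain_def)
  have gd: "(\<phi> i has_derivative (\<lambda>v. grad (closure \<Omega>) (\<phi> i) x \<bullet> v)) (at x within closure \<Omega>)" if "x \<in> closure \<Omega>" for i x
    using has_derivative_grad[of "\<phi> i" x "closure \<Omega>"] C1[of i] that by (auto simp: differentiable_on_def)
  have int: "x \<in> interior \<Omega>" "x \<in> interior (closure \<Omega>)" if "x \<in> \<Omega>" for x
    using that open_dom interior_maximal[OF closure_subset open_dom] by (auto simp: interior_open)
  have geq: "grad \<Omega> (\<phi> i) x = grad (closure \<Omega>) (\<phi> i) x" if "x \<in> \<Omega>" for i x
    by (simp only: grad_def pd_def at_within_interior[OF int(1)[OF that]] at_within_interior[OF int(2)[OF that]])
  have td: "twice_diff_at (\<phi> i) (grad (closure \<Omega>) (\<phi> i)) (hess \<Omega> (\<phi> i)) x" if "x \<in> \<Omega>" for i x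
  proof (rule twice_diff_at_cong_grad[OF Ck2_twice_diff_at[OF C2 int(1)[OF that]]])
    show "\<forall>\<^sub>F y in nhds x. grad \<Omega> (\<phi> i) y = grad (closure \<Omega>) (\<phi> i) y"
      using eventually_nhds_in_open[OF open_dom that] by eventually_elim (rule geq)
  qed
  show "0 < d" "d \<le> 1" "0 < c" by fact+
  show "((\<lambda>x. - d * ln (\<phi> i x)) has_derivative (\<lambda>v. ((- d / \<phi> i x) *\<^sub>R grad (closure \<Omega>) (\<phi> i) x) \<bullet> v)) (at x within closure \<Omega>)"
    if x: "x \<in> closure \<Omega>" for i x
  proof -
    have "((\<lambda>z. - d * ln (\<phi> i z)) has_derivative (\<lambda>v. - d * (grad (closure \<Omega>) (\<phi> i) x \<bullet> v * inverse (\<phi> i x)))) (at x within closure \<Omega>)"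
      by (intro has_derivative_mult_right has_derivative_ln gd pos x)
    then show ?thesis by (rule has_derivative_eq_rhs) (auto simp: divide_inverse)
  qed
  show "twice_diff_at (\<lambda>x. - d * ln (\<phi> i x)) (\<lambda>x. (- d / \<phi> i x) *\<^sub>R grad (closure \<Omega>) (\<phi> i) x)
     (\<lambda>x v. (- d / \<phi> i x) *\<^sub>R hess \<Omega> (\<phi> i) x v -
        (- d * (grad (closure \<Omega>) (\<phi> i) x \<bullet> v) / (\<phi> i x)\<^sup>2) *\<^sub>R grad (closure \<Omega>) (\<phi> i) x) x" if "x \<in> \<Omega>" for i x
    by (rule twice_diff_at_ln[OF td[OF that] pos[OF in_cl[OF that]]])
  show "((- d / \<phi> i x) *\<^sub>R grad (closure \<Omega>) (\<phi> i) x) \<bullet> \<nu> x = 0" if "x \<in> frontier \<Omega>" for i x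
    using nm[OF that, of i] by (simp add: normal_deriv_grad)
  show "norm (b i x) \<le> B" if "x \<in> closure \<Omega>" for i x by (rule b_le[OF that])
  show "\<bar>M x $ i $ j\<bar> \<le> Mb" if "x \<in> closure \<Omega>" for i j x by (rule M_le[OF that])
  show "M x $ i $ j \<le> - c" if "x \<in> closure \<Omega>" "i \<noteq> j" for i j x by (rule M_off[OF that])
  fix i x assume x: "x \<in> \<Omega>"
  define f where "f = \<phi> i x"
  define g where "g = grad (closure \<Omega>) (\<phi> i) x"
  have f0: "f > 0" using pos[OF in_cl[OF x]] by (simp add: f_def)
  have pd: "pd \<Omega> k (\<phi> i) x = g $ k" for k using geq[OF x, of i] by (simp add: g_def grad_def vec_eq_iff)
  have bg: "(\<Sum>k\<in>UNIV. (b i x $ k) *\<^sub>R pd \<Omega> k (\<phi> i) x) = b i x \<bullet> g" by (simp add: pd inner_vec_def)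
  have "- (d * laplacian \<Omega> (\<phi> i) x) - b i x \<bullet> g + (\<Sum>j\<in>UNIV. M x $ i $ j * \<phi> j x) = \<kappa> * f"
    using pde[OF x, of i] unfolding system_op_def bg by (simp add: f_def)
  moreover have "(\<Sum>j\<in>UNIV. M x $ i $ j * \<phi> j x) = M x $ i $ i * f + (\<Sum>j\<in>UNIV-{i}. M x $ i $ j * \<phi> j x)"
    by (subst sum.remove[of _ i]) (auto simp: f_def)
  ultimately have e: "d * laplacian \<Omega> (\<phi> i) x = - (b i x \<bullet> g) + M x $ i $ i * f + (\<Sum>j\<in>UNIV-{i}. M x $ i $ j * \<phi> j x) - \<kappa> * f"
    by linarith
  have ex: "exp ((- d * ln (\<phi> i x) - - d * ln (\<phi> j x)) / d) = \<phi> j x / f" for j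
  proof -
    have "(- d * ln (\<phi> i x) - - d * ln (\<phi> j x)) / d = ln (\<phi> j x) - ln (\<phi> i x)"
      using d by (simp add: field_simps)
    then show ?thesis using pos[OF in_cl[OF x]] by (simp add: exp_diff f_def)
  qed
  have trW: "tr (\<lambda>v. (- d / \<phi> i x) *\<^sub>R hess \<Omega> (\<phi> i) x v - (- d * (g \<bullet> v) / (\<phi> i x)\<^sup>2) *\<^sub>R g)
      = - d / f * laplacian \<Omega> (\<phi> i) x + d / f\<^sup>2 * (g \<bullet> g)"
  proof -
    have "tr (\<lambda>v. (- d / \<phi> i x) *\<^sub>R hess \<Omega> (\<phi> i) x v - (- d * (g \<bullet> v) / (\<phi> i x)\<^sup>2) *\<^sub>R g)
        = tr (\<lambda>v. (- d / f) *\<^sub>R hess \<Omega> (\<phi> i) x v - ((- d / f\<^sup>2) * (g \<bullet> v)) *\<^sub>R g)" by (simp add: f_def)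
    also have "\<dots> = - d / f * laplacian \<Omega> (\<phi> i) x - (- d / f\<^sup>2) * (g \<bullet> g)"
      by (simp only: tr_diff_rank_one tr_scaleR tr_hess)
    finally show ?thesis by simp
  qed
  have "d * (- d / f * laplacian \<Omega> (\<phi> i) x + d / f\<^sup>2 * (g \<bullet> g)) = d\<^sup>2 / f\<^sup>2 * (g \<bullet> g) - d / f * (d * laplacian \<Omega> (\<phi> i) x)"
    by (simp add: power2_eq_square algebra_simps)
  also have "\<dots> = d\<^sup>2 / f\<^sup>2 * (g \<bullet> g) + d / f * (b i x \<bullet> g) - d / f * (\<Sum>j\<in>UNIV-{i}. M x $ i $ j * \<phi> j x) - d * (M x $ i $ i - \<kappa>)"
    unfolding e using f0 by (simp add: field_simps)
  also have "d / f * (\<Sum>j\<in>UNIV-{i}. M x $ i $ j * \<phi> j x) = - (d * (\<Sum>j\<in>UNIV-{i}. - (M x $ i $ j) * (\<phi> j x / f)))"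
    by (simp add: sum_distrib_left sum_negf)
  finally show "d * tr (\<lambda>v. (- d / \<phi> i x) *\<^sub>R hess \<Omega> (\<phi> i) x v -
        (- d * (grad (closure \<Omega>) (\<phi> i) x \<bullet> v) / (\<phi> i x)\<^sup>2) *\<^sub>R grad (closure \<Omega>) (\<phi> i) x) =
    ((- d / \<phi> i x) *\<^sub>R grad (closure \<Omega>) (\<phi> i) x) \<bullet> ((- d / \<phi> i x) *\<^sub>R grad (closure \<Omega>) (\<phi> i) x) -
    b i x \<bullet> ((- d / \<phi> i x) *\<^sub>R grad (closure \<Omega>) (\<phi> i) x) +
    d * (\<Sum>j\<in>UNIV - {i}. - (M x $ i $ j) * exp ((- d * ln (\<phi> i x) - - d * ln (\<phi> j x)) / d)) - d * (M x $ i $ i - \<kappa>)"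
    unfolding ex unfolding g_def[symmetric] unfolding trW unfolding f_def[symmetric] by (simp add: power2_eq_square)
qed

text \<open>
  The quantity \<open>d exp (1 / sqrt d)\<close>, which the coupling terms reach on the diagonal, is unbounded as \<open>d\<close> tends to zero.
\<close>
lemma exp_inverse_sqrt_lower:
  assumes "0 < d" shows "1 / (64 * d) \<le> d * exp (1 / sqrt d)"
proof -
  define y where "y = 1 / sqrt d"
  have y: "y > 0" "y\<^sup>2 = 1 / d" using assms by (auto simp: y_def power_divide)
  have "y\<^sup>2 / 8 \<le> exp (y / 2)"
    using exp_lower_Taylor_quadratic[of "y / 2"] y by (simp add: power_divide)
  then have "(y\<^sup>2 / 8)\<^sup>2 \<le> (exp (y / 2))\<^sup>2" by (intro power_mono) auto
  also have "(exp (y / 2))\<^sup>2 = exp y" by (simp add: power2_eq_square flip: exp_add)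
  finally have "(1 / (8 * d))\<^sup>2 \<le> exp y" using y by (simp add: mult.commute)
  then have "d * (1 / (8 * d))\<^sup>2 \<le> d * exp y" using assms by (intro mult_left_mono) auto
  moreover have "d * (1 / (8 * d))\<^sup>2 = 1 / (64 * d)" using assms by (simp add: power2_eq_square)
  ultimately show ?thesis unfolding y_def by linarith
qed

text \<open>The constants of the doubling argument depend only on the geometry and on bounds for the coefficients,
  so that its conclusion holds for all sufficiently small \<open>d\<close>.\<close>

lemma (in neumann_geometry) uniform_estimate:
  fixes b :: "'m::finite \<Rightarrow> real^'n \<Rightarrow> real^'n" and M :: "real^'n \<Rightarrow> real^'m^'m"
  obtains r C d0 where "r > 0" "C \<ge> 0" "d0 > 0"
    "\<And>W gW HW d lam i j x y. hj_system \<Omega> \<nu> h gh Hh Hm G Q b M W gW HW d lam B Mb c \<Longrightarrow> d < d0 \<Longrightarrow>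
       x \<in> closure \<Omega> \<Longrightarrow> y \<in> closure \<Omega> \<Longrightarrow> norm (x - y) \<le> r \<Longrightarrow>
       W i x - W j y \<le> sqrt d + 2 * d * Hm + C * norm (x - y)"
proof (cases "B \<ge> 0 \<and> Mb \<ge> 0 \<and> c > 0")
  case False
  have "\<not> hj_system \<Omega> \<nu> h gh Hh Hm G Q b M W gW HW d lam B Mb c" for W gW HW d lam
    using False hj_system.B_nonneg hj_system.Mb_nonneg hj_system.c0 by metis
  then show ?thesis by (intro that[of 1 1 1]) auto
next
  case True
  define K where "K = Q"
  define E where "E = exp (2 * K * Hm)"
  define R where "R = 1 / (4 * K * G + 1)"
  define \<eta> where "\<eta> = 1 / (24 * B * E + 2 * B * G + 2)"
  define Cl where "Cl = 2 * Mb + real CARD('n) * G + G\<^sup>2 + B * G + real CARD('m) * Mb"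
  define L where "L = 4 * (2 * G + B + 5 * real CARD('n) * E / \<eta> + B * G + Cl + real CARD('n) * G) + 2"
  have pos: "B \<ge> 0" "Mb \<ge> 0" "c > 0" "G \<ge> 0" "K \<ge> 0" "E \<ge> 1" using True G_nonneg Q_nonneg Hm_nonneg by (auto simp: K_def E_def)
  define KG where "KG = 4 * K * G"
  have "0 \<le> KG" using pos by (simp add: KG_def)
  then have R: "0 < R" "R \<le> 1" "4 * K * G * R \<le> 1"
    unfolding R_def KG_def[symmetric] by (simp_all add: divide_le_eq)
  have eta: "\<eta> > 0" "1 / \<eta> = 24 * B * E + 2 * B * G + 2" using pos by (auto simp: \<eta>_def intro!: add_nonneg_pos)
  have Cl0: "Cl \<ge> 0" using pos by (simp add: Cl_def)
  have L2: "L \<ge> 2" using pos eta Cl0 by (simp add: L_def)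
  define X where "X = 66 * L * E * K * real CARD('n) * G + 2 * real CARD('n) * G
        + 4 * G * (6 * L * K * \<eta> + 1) * (12 * L * E + G) + (real CARD('m) + 2) * Mb"
  define Y where "Y = (6 * L * E + G)\<^sup>2 + 2 * B * (6 * L * E + G) + real CARD('m) * Mb + 2 * Mb + 2 * real CARD('n) * G"
  have X0: "X \<ge> 0" using pos L2 eta by (simp add: X_def)
  have Y0: "Y \<ge> 0" using pos L2 by (simp add: Y_def)
  define d0 where "d0 = Min {1, L * R / 2, R / (8 * \<eta>), 1 / (X + 1), c / (64 * (Y + 1))}"
  have d0: "d0 > 0" unfolding d0_def using R L2 eta X0 Y0 pos by (subst Min_gr_iff) (auto intro!: divide_pos_pos mult_pos_pos)
  show ?thesis
  proof (rule that[of "R / (2 * E)" "6 * L * E" d0])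
    show "0 < R / (2 * E)" "0 \<le> 6 * L * E" "0 < d0" using R pos L2 d0 by auto
    fix W :: "'m \<Rightarrow> real^'n \<Rightarrow> real" and gW HW d lam i j x y
    assume s: "hj_system \<Omega> \<nu> h gh Hh Hm G Q b M W gW HW d lam B Mb c" and dd: "d < d0"
      and xy: "x \<in> closure \<Omega>" "y \<in> closure \<Omega>" and r: "norm (x - y) \<le> R / (2 * E)"
    have dpos: "d > 0" using s by (rule hj_system.d0)
    have "d0 \<le> L * R / 2" "d0 \<le> R / (8 * \<eta>)" "d0 \<le> 1 / (X + 1)" "d0 \<le> c / (64 * (Y + 1))"
      unfolding d0_def by (rule Min_le; simp)+
    then have c1: "d < L * R / 2" "d < R / (8 * \<eta>)" "d < 1 / (X + 1)" "d < c / (64 * (Y + 1))" using dd by linarith+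
    have c2: "8 * \<eta> * d \<le> R" using c1(2) eta(1) by (simp add: field_simps)
    have "d * (X + 1) < 1" using c1(3) X0 by (simp add: less_divide_eq)
    then have c3: "d * X \<le> 1" using dpos by (simp add: algebra_simps)
    have "d * (64 * (Y + 1)) < c" using c1(4) Y0 by (simp add: less_divide_eq)
    then have "Y < c * (1 / (64 * d))" using dpos by (simp add: field_simps)
    also have "\<dots> \<le> c * (d * exp (1 / sqrt d))" using exp_inverse_sqrt_lower[OF dpos] pos by (intro mult_left_mono) auto
    finally have c4: "Y < d * c * exp (1 / sqrt d)" by (simp add: mult_ac)
    have cl: "Mb - lam \<le> Cl" using hj_system.lam_lower[OF s] unfolding Cl_def by linarith
    interpret e: hj_estimate \<Omega> \<nu> h gh Hh Hm G Q b M W gW HW d lam B Mb c K E R L \<eta> Cl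
    proof (intro hj_estimate.intro hj_estimate_axioms.intro s)
      show "d * (66 * L * E * K * real CARD('n) * G + 2 * real CARD('n) * G
        + 4 * G * (6 * L * K * \<eta> + 1) * (12 * L * E + G) + (real CARD('m) + 2) * Mb) \<le> 1" using c3 unfolding X_def .
      show "(6 * L * E + G)\<^sup>2 + 2 * B * (6 * L * E + G) + real CARD('m) * Mb + 2 * Mb + 2 * real CARD('n) * G
        < d * c * exp (1 / sqrt d)" using c4 unfolding Y_def .
    qed (use R L2 eta cl Cl0 c1 c2 in \<open>auto simp: K_def E_def L_def\<close>)
    have "E * norm (x - y) \<le> E * (R / (2 * E))" using r pos by (intro mult_left_mono) auto
    then have "E * norm (x - y) \<le> R / 2" using pos by simp
    from e.local_lipschitz_estimate[OF xy this]
    show "W i x - W j y \<le> sqrt d + 2 * d * Hm + 6 * L * E * norm (x - y)" .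
  qed
qed

section \<open>Convergence of the logarithmic transforms\<close>

lemma Ck1_continuous: "Ck_on 1 S f \<Longrightarrow> continuous_on S f"
  by (simp add: differentiable_imp_continuous_on)

theorem theorem2p1:
  fixes \<Omega> :: "(real^'n::finite) set"
    and \<nu> :: "real^'n \<Rightarrow> real^'n"
    and b :: "'m::finite \<Rightarrow> real^'n \<Rightarrow> real^'n"
    and M :: "real^'n \<Rightarrow> real^'m^'m"
    and \<phi> :: "real \<Rightarrow> 'm \<Rightarrow> real^'n \<Rightarrow> real"
    and d :: "nat \<Rightarrow> real"
  assumes "bounded_C2_domain \<Omega>"
    and "outward_unit_normal \<Omega> \<nu>"
    and "\<And>i. Ck_on 1 (closure \<Omega>) (b i)"
    and "Ck_on 1 (closure \<Omega>) M"
    and "\<And>i j x. i \<noteq> j \<Longrightarrow> x \<in> closure \<Omega> \<Longrightarrow> M x $ i $ j < 0"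
    and "\<And>\<delta>. \<delta> > 0 \<Longrightarrow> normalized_principal_eigenfunction \<Omega> \<nu> b M \<delta> (\<phi> \<delta>)"
    and "\<And>k. d k > 0" and "decseq d" and "d \<longlonglongrightarrow> 0"
  shows "\<exists>r W. strict_mono (r :: nat \<Rightarrow> nat) \<and>
      W1_infinity \<Omega> W \<and> continuous_on (closure \<Omega>) W \<and>
      (\<forall>i. uniform_limit (closure \<Omega>) (\<lambda>k x. - d (r k) * ln (\<phi> (d (r k)) i x)) W sequentially) \<and>
      viscosity_solution \<Omega> \<nu> b W \<and>
      (\<forall>x\<in>closure \<Omega>. 0 \<le> W x) \<and> (\<exists>x\<in>closure \<Omega>. W x = 0)"
proof -
  have dom: "open \<Omega>" "connected \<Omega>" "\<Omega> \<noteq> {}" "bounded \<Omega>" using assms(1) by (auto simp: bounded_C2_domain_def)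
  have bc: "continuous_on (closure \<Omega>) (b i)" for i by (rule Ck1_continuous[OF assms(3)])
  have Mc: "continuous_on (closure \<Omega>) M" by (rule Ck1_continuous[OF assms(4)])
  then have Mc': "continuous_on (closure \<Omega>) (\<lambda>x. M x $ i $ j)" for i j by (intro continuous_intros)
  obtain h gh Hh Hm G where geo: "neumann_geometry \<Omega> \<nu> h gh Hh Hm G G"
    and par: "\<And>x. x \<in> frontier \<Omega> \<Longrightarrow> \<exists>\<sigma>\<ge>1. gh x = \<sigma> *\<^sub>R \<nu> x"
    by (rule C2_domain_geometry[OF assms(1,2)]) blast
  interpret g: neumann_geometry \<Omega> \<nu> h gh Hh Hm G G by (rule geo)
  note K = g.compact_cl g.cl_ne
  obtain B where B: "\<And>i x. x \<in> closure \<Omega> \<Longrightarrow> norm (b i x) \<le> B"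
  proof -
    have "continuous_on (closure \<Omega>) (\<lambda>x. norm (b i x))" for i by (intro continuous_intros bc)
    from finite_family_attains_sup[OF finite UNIV_not_empty K this, of "\<lambda>i. i"] that show thesis by blast
  qed
  obtain Mb where Mb: "\<And>i j x. x \<in> closure \<Omega> \<Longrightarrow> \<bar>M x $ i $ j\<bar> \<le> Mb"
  proof -
    have "continuous_on (closure \<Omega>) (\<lambda>x. \<bar>M x $ fst p $ snd p\<bar>)" for p by (intro continuous_intros Mc')
    from finite_family_attains_sup[OF finite UNIV_not_empty K this, of "\<lambda>p. p"]
    obtain C where "\<And>p x. x \<in> closure \<Omega> \<Longrightarrow> \<bar>M x $ fst p $ snd p\<bar> \<le> C" by blast
    from this[of _ "(_, _)"] show thesis by (intro that[of C]) auto
  qed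
  \<comment> \<open>For a single component there are no off-diagonal entries, and any positive constant will do.\<close>
  obtain c where c: "c > 0" "\<And>i j x. x \<in> closure \<Omega> \<Longrightarrow> i \<noteq> j \<Longrightarrow> M x $ i $ j \<le> - c"
  proof (cases "{p :: 'm \<times> 'm. fst p \<noteq> snd p} = {}")
    case True
    then show ?thesis by (intro that[of 1]) auto
  next
    case False
    have "continuous_on (closure \<Omega>) (\<lambda>x. M x $ fst p $ snd p)" for p by (intro Mc')
    from finite_family_attains_sup[OF finite False K this, of "\<lambda>p. p"]
    obtain p z where p: "fst p \<noteq> snd p" "z \<in> closure \<Omega>"
      and m: "\<And>q x. fst q \<noteq> snd q \<Longrightarrow> x \<in> closure \<Omega> \<Longrightarrow> M x $ fst q $ snd q \<le> M z $ fst p $ snd p" by auto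
    have "M z $ fst p $ snd p < 0" using assms(5)[OF p] .
    then show ?thesis
      by (intro that[of "- (M z $ fst p $ snd p)"]) (use m[of "(_, _)"] in auto)
  qed
  obtain r C d0 where r: "r > 0" and C: "C \<ge> 0" and d0: "d0 > 0"
    and est: "\<And>W gW HW d lam i j x y. hj_system \<Omega> \<nu> h gh Hh Hm G G b M W gW HW d lam B Mb c \<Longrightarrow> d < d0 \<Longrightarrow>
       x \<in> closure \<Omega> \<Longrightarrow> y \<in> closure \<Omega> \<Longrightarrow> norm (x - y) \<le> r \<Longrightarrow>
       W i x - W j y \<le> sqrt d + 2 * d * Hm + C * norm (x - y)"
    by (rule g.uniform_estimate[of b M B Mb c]) blast
  \<comment> \<open>The estimates hold for small \<open>d\<close> only, so that an initial segment of the sequence is dropped.\<close>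
  have "\<forall>\<^sub>F k in sequentially. d k < min 1 d0" using order_tendstoD(2)[OF assms(9), of "min 1 d0"] d0 by simp
  then obtain k0 where k0: "\<And>k. k \<ge> k0 \<Longrightarrow> d k < min 1 d0" by (auto simp: eventually_sequentially)
  define D where "D k = d (k + k0)" for k
  have D: "0 < D k" "D k \<le> 1" "D k < d0" for k using assms(7) k0[of "k + k0"] by (auto simp: D_def)
  have Dlim: "D \<longlonglongrightarrow> 0" unfolding D_def by (rule LIMSEQ_ignore_initial_segment[OF assms(9)])
  have npe: "normalized_principal_eigenfunction \<Omega> \<nu> b M (D k) (\<phi> (D k))" for k by (rule assms(6)[OF D(1)])
  then have "\<exists>\<kappa>. eigenfunction \<Omega> \<nu> b M (D k) \<kappa> (\<phi> (D k))" for k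
    unfolding normalized_principal_eigenfunction_def by blast
  then obtain \<kappa> :: "nat \<Rightarrow> real" where ef: "\<And>k. eigenfunction \<Omega> \<nu> b M (D k) (\<kappa> k) (\<phi> (D k))" by metis
  have pos: "\<And>k i x. x \<in> closure \<Omega> \<Longrightarrow> 0 < \<phi> (D k) i x" and le1: "\<And>k i x. x \<in> closure \<Omega> \<Longrightarrow> \<phi> (D k) i x \<le> 1"
    and at1: "\<And>k. \<exists>i. \<exists>x\<in>closure \<Omega>. \<phi> (D k) i x = 1"
    using npe by (auto simp: normalized_principal_eigenfunction_def)
  define U where "U k i x = - D k * ln (\<phi> (D k) i x)" for k i x
  have "\<exists>gW HW. hj_system \<Omega> \<nu> h gh Hh Hm G G b M (U k) gW HW (D k) (\<kappa> k) B Mb c" for k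
    using g.eigenfunction_hj_system[OF D(1,2) ef pos B Mb c(2,1)] unfolding U_def by blast
  then obtain gW HW where sys: "\<And>k. hj_system \<Omega> \<nu> h gh Hh Hm G G b M (U k) (gW k) (HW k) (D k) (\<kappa> k) B Mb c" by metis
  define \<omega> where "\<omega> k = sqrt (D k) + 2 * D k * Hm" for k
  have "(\<lambda>k. sqrt (D k) + 2 * D k * Hm) \<longlonglongrightarrow> sqrt 0 + 2 * 0 * Hm" by (intro tendsto_intros Dlim)
  then have om: "\<omega> \<longlonglongrightarrow> 0" by (simp add: \<omega>_def[abs_def])
  have cont: "continuous_on (closure \<Omega>) (U k i)" for k i by (rule hj_system.W_cont[OF sys])
  have est': "U k i x - U k j y \<le> \<omega> k + C * norm (x - y)"
    if "x \<in> closure \<Omega>" "y \<in> closure \<Omega>" "norm (x - y) \<le> r" for k i j x y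
    unfolding \<omega>_def by (rule est[OF sys D(3) that])
  have nn: "0 \<le> U k i x" if "x \<in> closure \<Omega>" for k i x
    using pos[OF that, of k i] le1[OF that, of k i] D(1)[of k] by (simp add: U_def mult_nonneg_nonpos)
  have zero: "\<exists>i. \<exists>x\<in>closure \<Omega>. U k i x = 0" for k
  proof -
    obtain i x where "x \<in> closure \<Omega>" "\<phi> (D k) i x = 1" using at1 by blast
    then show ?thesis by (intro exI[of _ i] bexI[of _ x]) (simp_all add: U_def)
  qed
  have conn: "connected (closure \<Omega>)" by (rule connected_imp_connected_closure[OF dom(2)])
  obtain s V L B' where s: "strict_mono (s :: nat \<Rightarrow> nat)" and V: "continuous_on (closure \<Omega>) V"
    and unif: "\<And>i. uniform_limit (closure \<Omega>) (\<lambda>k. U (s k) i) V sequentially"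
    and L: "L \<ge> 0" "\<And>x y. x \<in> closure \<Omega> \<Longrightarrow> y \<in> closure \<Omega> \<Longrightarrow> \<bar>V x - V y\<bar> \<le> L * norm (x - y)"
    and B': "B' \<ge> 0" "\<And>x. x \<in> closure \<Omega> \<Longrightarrow> \<bar>V x\<bar> \<le> B'"
    and V0: "\<And>x. x \<in> closure \<Omega> \<Longrightarrow> 0 \<le> V x" "\<exists>x\<in>closure \<Omega>. V x = 0"
    by (rule asymptotic_lipschitz_limit[OF K(1) conn K(2) cont est' r C om nn zero]) (assumption+, rule that, assumption+)
  have "hj_sequence \<Omega> \<nu> h gh Hh Hm G G b M (\<lambda>k. U (s k)) (\<lambda>k. gW (s k)) (\<lambda>k. HW (s k)) (\<lambda>k. D (s k)) (\<lambda>k. \<kappa> (s k)) B Mb c V"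
  proof (intro hj_sequence.intro hj_sequence_axioms.intro geo sys unif bc par V)
    show "(\<lambda>k. D (s k)) \<longlonglongrightarrow> 0" using LIMSEQ_subseq_LIMSEQ[OF Dlim s] by (simp add: o_def)
  qed
  then have vs: "viscosity_solution \<Omega> \<nu> b V"
    unfolding viscosity_solution_def by (intro conjI hj_sequence.limit_subsolution hj_sequence.limit_supersolution)
  have W1: "W1_infinity \<Omega> V"
    by (rule lipschitz_W1_infinity[OF dom(1,4) _ B'(1) _ L(1)]) (use B'(2) L(2) g.in_cl in auto)
  have sm: "strict_mono (\<lambda>k. s k + k0)" using s by (auto simp: strict_mono_def)
  have ul: "uniform_limit (closure \<Omega>) (\<lambda>k x. - d (s k + k0) * ln (\<phi> (d (s k + k0)) i x)) V sequentially" for i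
    using unif[of i] by (simp add: U_def[abs_def] D_def)
  show ?thesis using sm W1 V ul vs V0 by (intro exI[of _ "\<lambda>k. s k + k0"] exI[of _ V]) auto
qed

end
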